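(* Let $\omega=(\sqrt5-1)/2$ and let $\Sigma_\omega\subset\mathbb R$ be the spectrum of the Almost Mathieu operator with coupling $b=2$ and frequency $\omega$. Each of the following open intervals is contained in the open spectral gap (bounded connected component of $\mathbb R\setminus\Sigma_\omega$) having the indicated label; in particular these 8 gaps are open (non-collapsed): \begin{itemize} \item $(-2.49080746353,\,-2.39389225666)$: label $-3$; \item $(-2.29908225829,\,-2.01696396030)$: label $2$; \item $(-1.84909334969,\,-0.214184658337)$: label $-1$; \item $(-0.110814328134,\,-0.0386155348422)$: label $4$; \item $(0.0386155348422,\,0.110814328134)$: label $-4$; \item $(0.214184658337,\,1.84909334969)$: label $1$; \item $(2.01696396030,\,2.29908225829)$: label $-2$; \item $(2.39389225666,\,2.49080746353)$: label $3$. \end{itemize} Moreover $(-\infty,-2.62263996148)$ and $(2.62263996148,+\infty)$ are contained in the lower and upper unbounded connected components of $\mathbb R\setminus\Sigma_\omega$, respectively (label $0$).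
   Context: The Almost Mathieu operator with coupling $b=2$, frequency $\omega$ and phase $\theta\in\mathbb T=\mathbb R/\mathbb Z$ acts on $\ell^2(\mathbb Z)$ by $$(H_{2,\omega,\theta}x)_n=x_{n+1}+x_{n-1}+2\cos(2\pi(\omega n+\theta))\,x_n,\qquad n\in\mathbb Z.$$ For irrational $\omega$ its spectrum is a compact subset of $\mathbb R$ independent of $\theta$, denoted $\Sigma_\omega$. A (open, non-collapsed) spectral gap is a connected component of $\mathbb R\setminus\Sigma_\omega$. The integrated density of states $N:\mathbb R\to[0,1]$ (the limit as $L\to\infty$ of $\frac1L$ times the number of eigenvalues $\le a$ of the restriction of the operator to $\{1,\dots,L\}$) is continuous, nondecreasing, and constant exactly on the components of $\mathbb R\setminus\Sigma_\omega$. By the Gap Labelling Theorem, on each bounded gap the value of $N$ is $\{k\omega\}$ for a unique integer $k$, called the label of the gap, where $\{\cdot\}$ denotes the fractional part. The two unbounded components (where $N=0$ and $N=1$) are given the label $0$. *)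

theory Defs
  imports "HOL-Analysis.Analysis" "Jordan_Normal_Form.Char_Poly"
begin

definition ell2 :: "(int \<Rightarrow> complex) set" where
  "ell2 = {x. (\<lambda>n. (cmod (x n))\<^sup>2) summable_on UNIV}"

definition ell2_norm :: "(int \<Rightarrow> complex) \<Rightarrow> real" where
  "ell2_norm x = sqrt (\<Sum>\<^sub>\<infinity>n. (cmod (x n))\<^sup>2)"

definition bounded_operator_ell2 :: "((int \<Rightarrow> complex) \<Rightarrow> (int \<Rightarrow> complex)) \<Rightarrow> bool" where
  "bounded_operator_ell2 T \<longleftrightarrow>
     (\<forall>x\<in>ell2. T x \<in> ell2) \<and>
     (\<forall>x\<in>ell2. \<forall>y\<in>ell2. T (\<lambda>n. x n + y n) = (\<lambda>n. T x n + T y n)) \<and>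
     (\<forall>c. \<forall>x\<in>ell2. T (\<lambda>n. c * x n) = (\<lambda>n. c * T x n)) \<and>
     (\<exists>C. \<forall>x\<in>ell2. ell2_norm (T x) \<le> C * ell2_norm x)"

text \<open>Operators are total functions on sequences, but only their values on \<open>ell2\<close> matter:
  \<open>z\<close> is in the spectrum iff \<open>T - z\<close> has no bounded two-sided inverse on \<open>ell2\<close>.\<close>

definition spectrum_ell2 :: "((int \<Rightarrow> complex) \<Rightarrow> (int \<Rightarrow> complex)) \<Rightarrow> complex set" where
  "spectrum_ell2 T = {z. \<not> (\<exists>R. bounded_operator_ell2 R \<and>
     (\<forall>x\<in>ell2. R (\<lambda>n. T x n - z * x n) = x \<and> (\<lambda>n. T (R x) n - z * R x n) = x))}"

definition almost_mathieu ::
  "real \<Rightarrow> real \<Rightarrow> real \<Rightarrow> (int \<Rightarrow> complex) \<Rightarrow> (int \<Rightarrow> complex)" where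
  "almost_mathieu b \<omega> \<theta> x =
     (\<lambda>n. x (n + 1) + x (n - 1)
          + complex_of_real (b * cos (2 * pi * (\<omega> * of_int n + \<theta>))) * x n)"

text \<open>The operator is self-adjoint, so its spectrum is contained in the real line and no
  spectral point is lost here.\<close>

definition am_spectrum :: "real \<Rightarrow> real \<Rightarrow> real \<Rightarrow> real set" where
  "am_spectrum b \<omega> \<theta> = {E. complex_of_real E \<in> spectrum_ell2 (almost_mathieu b \<omega> \<theta>)}"

definition spectral_gap :: "real \<Rightarrow> real \<Rightarrow> real \<Rightarrow> real set \<Rightarrow> bool" where
  "spectral_gap b \<omega> \<theta> G \<longleftrightarrow> G \<in> components (- am_spectrum b \<omega> \<theta>)"

text \<open>The restriction to the sites \<open>{1..L}\<close>; matrix indices start at \<open>0\<close>, so index \<open>i\<close>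
  is the site \<open>i + 1\<close>.\<close>

definition am_restriction :: "real \<Rightarrow> real \<Rightarrow> real \<Rightarrow> nat \<Rightarrow> real mat" where
  "am_restriction b \<omega> \<theta> L = mat L L (\<lambda>(i, j).
     if i = j then b * cos (2 * pi * (\<omega> * real (i + 1) + \<theta>))
     else if i = j + 1 \<or> j = i + 1 then 1 else 0)"

definition eigenvalue_count :: "real mat \<Rightarrow> real \<Rightarrow> nat" where
  "eigenvalue_count A a =
     (\<Sum>E | eigenvalue A E \<and> E \<le> a. Polynomial.order E (char_poly A))"

text \<open>Integrated density of states. A priori it depends on the phase.\<close>

definition ids :: "real \<Rightarrow> real \<Rightarrow> real \<Rightarrow> real \<Rightarrow> real" where
  "ids b \<omega> \<theta> a =
     lim (\<lambda>L. real (eigenvalue_count (am_restriction b \<omega> \<theta> L) a) / real L)"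

text \<open>For irrational \<open>\<omega>\<close> at most one \<open>k\<close> qualifies, because \<open>k \<mapsto> frac (k \<omega>)\<close> is
  then injective; the unbounded gaps get the label \<open>0\<close> by convention.\<close>

definition gap_has_label :: "real \<Rightarrow> real \<Rightarrow> real \<Rightarrow> real set \<Rightarrow> int \<Rightarrow> bool" where
  "gap_has_label b \<omega> \<theta> G k \<longleftrightarrow>
     spectral_gap b \<omega> \<theta> G \<and>
     (if bounded G then \<forall>a\<in>G. ids b \<omega> \<theta> a = frac (of_int k * \<omega>) else k = 0)"

end

theory Submission
  imports Defs
begin

text \<open>
  Along a solution of \<open>y (n + 1) + y (n - 1) + V n * y n = E * y n\<close> the slopes
  \<open>m n = y n / y (n - 1)\<close> obey the Riccati recursion \<open>m (n + 1) = E - V n - 1 / m n\<close>, and moving \<open>E\<close>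
  moves the slopes monotonically. The proof works with two sequences of slopes: \<open>a\<close>, which lags behind
  the recursion at the left end \<open>l\<close> of the energy interval, and \<open>b\<close>, which runs ahead of it at the
  right end \<open>u\<close> (predicate \<open>trapped\<close>). The arc from \<open>a n\<close> to \<open>b n\<close> is then mapped into the arc from
  \<open>a (n + 1)\<close> to \<open>b (n + 1)\<close> by every energy in between. Such a pair has two consequences.

  \<^item> The quadratic form that vanishes on the two ends of the arc grows along every solution
    (\<open>trap_step\<close>). Summing this growth over the whole line bounds \<open>H - E\<close> below on \<open>ell2\<close>
    (\<open>hyperbolic_gap_bounded_below\<close>), and a symmetric operator that is bounded below is invertible
    (\<open>bounded_below_resolvent\<close>). So the interval \<open>(l, u)\<close> contains no spectrum.

  \<^item> Completing squares with \<open>a\<close> (or \<open>b\<close>) writes the form of \<open>E - H\<close> on \<open>{1..L}\<close> as a sum of squares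
    weighted by the slopes, up to a sign-definite remainder. Hence the number of positive slopes
    bounds the number of eigenvalues up to \<open>E\<close> from both sides (\<open>hyperbolic_gap_count\<close>). If the
    positive slopes of \<open>a\<close> and of \<open>b\<close> have density \<open>\<rho>\<close> with bounded error, the integrated density of
    states is \<open>\<rho>\<close> on \<open>(l, u)\<close>.

  The density of states stays constant on the whole component: near an energy of the resolvent set
  each finite restriction has at most two eigenvalues, since three eigenvectors would combine to one
  that vanishes at both ends and is an approximate eigenvector on the line
  (\<open>few_eigenvalues_near_resolvent\<close>). A component on which the density is neither \<open>0\<close> nor \<open>1\<close> cannot
  reach the energies below or above the spectrum, so it is bounded (\<open>labelled_gap\<close>).

  What remains is to find slopes. The phases of an orbit of the rotation by \<open>\<omega>\<close> climb two towers of
  heights \<open>233\<close> and \<open>377\<close> over an arc of length about \<open>0.003\<close>, because \<open>144 / 233\<close> and \<open>233 / 377\<close> are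
  consecutive convergents of \<open>\<omega>\<close>. Letting the slopes depend on the level only, it suffices to follow
  the recursion once through \<open>377\<close> levels with the potential moved by the worst case over the arc,
  and to compare the slope at levels \<open>233\<close> and \<open>377\<close> with the initial one (\<open>tower_certificate\<close>). The
  density of positive slopes is then automatically of the form \<open>k * \<omega> + n\<close>, and \<open>k\<close> and \<open>n\<close> are read
  off from the numbers of positive slopes on the two towers (\<open>itinerary_count\<close>). The resulting
  integer computation is \<open>all_gaps_certified\<close>. It succeeds because the claimed
  intervals end about \<open>0.025\<close> inside the true gaps (numerically), while the worst case over the arc
  and all rounding errors cost less than \<open>0.022\<close>. Only
  negative energies are computed: shifting the phase by \<open>1 / 2\<close> changes the sign of the potential, which
  reflects the spectrum at \<open>0\<close> (\<open>hyperbolic_gap_mirror\<close>).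
\<close>

section \<open>Jacobi matrices and their eigenvalues\<close>

text \<open>Fewer homogeneous linear equations than unknowns have a nonzero solution; the proof eliminates
  one equation and one unknown at a time.\<close>

lemma nontrivial_combination:
  fixes m :: "'j \<Rightarrow> 'a \<Rightarrow> real"
  assumes "finite J" "finite S" "card J < card S"
  shows "\<exists>c. (\<exists>s\<in>S. c s \<noteq> 0) \<and> (\<forall>j\<in>J. (\<Sum>s\<in>S. c s * m j s) = 0)"
  using assms
proof (induction J arbitrary: S m rule: finite_induct)
  case empty
  then have "S \<noteq> {}" by auto
  then show ?case by (intro exI[of _ "\<lambda>_. 1"]) auto
next
  case (insert j J)
  show ?case
  proof (cases "\<forall>s\<in>S. m j s = 0")
    case True
    obtain c where "\<exists>s\<in>S. c s \<noteq> 0" "\<forall>j\<in>J. (\<Sum>s\<in>S. c s * m j s) = 0"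
      using insert.IH[of S m] insert.prems insert.hyps by auto
    with True show ?thesis by (intro exI[of _ c]) auto
  next
    case False
    then obtain s0 where s0: "s0 \<in> S" "m j s0 \<noteq> 0" by auto
    define S' where "S' = S - {s0}"
    have S': "S = insert s0 S'" "s0 \<notin> S'" "finite S'" "card J < card S'"
      using s0 insert.prems insert.hyps by (auto simp: S'_def)
    obtain c where c: "\<exists>s\<in>S'. c s \<noteq> 0"
      "\<And>i. i \<in> J \<Longrightarrow> (\<Sum>s\<in>S'. c s * (m i s - m i s0 * m j s / m j s0)) = 0"
      using insert.IH[of S' "\<lambda>i s. m i s - m i s0 * m j s / m j s0"] S' by blast
    define d where "d = (\<lambda>s. if s = s0 then - (\<Sum>s\<in>S'. c s * m j s) / m j s0 else c s)"
    have dS: "(\<Sum>s\<in>S. d s * m i s)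
        = (\<Sum>s\<in>S'. c s * m i s) - (\<Sum>s\<in>S'. c s * m j s) / m j s0 * m i s0" for i
    proof -
      have "(\<Sum>s\<in>S'. d s * m i s) = (\<Sum>s\<in>S'. c s * m i s)"
        using S'(2) by (intro sum.cong) (auto simp: d_def)
      then show ?thesis using S' by (simp add: d_def)
    qed
    have "(\<Sum>s\<in>S. d s * m i s) = 0" if "i \<in> J" for i
    proof -
      have "(\<Sum>s\<in>S'. c s * (m i s - m i s0 * m j s / m j s0))
          = (\<Sum>s\<in>S'. c s * m i s) - (\<Sum>s\<in>S'. c s * m j s) / m j s0 * m i s0"
        by (simp add: right_diff_distrib sum_subtractf sum_distrib_left sum_distrib_right
            sum_divide_distrib algebra_simps)
      with c(2)[OF that] dS show ?thesis by simp
    qed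
    moreover have "(\<Sum>s\<in>S. d s * m j s) = 0" using dS[of j] s0 by simp
    moreover have "\<exists>s\<in>S. d s \<noteq> 0" using c(1) S' by (auto simp: d_def)
    ultimately show ?thesis by (intro exI[of _ d]) auto
  qed
qed

text \<open>The solution with \<open>u 0 = 0\<close> and \<open>u 1 = 1\<close> of \<open>u (n + 1) + u (n - 1) + v n * u n = x * u n\<close>, as
  a polynomial in the energy \<open>x\<close>. The polynomial with index \<open>L + 1\<close> is the characteristic polynomial
  of the restriction to \<open>{1..L}\<close>. The coefficients are generic because the reality of the roots is
  shown over the complex numbers.\<close>

fun jacobi_poly :: "(nat \<Rightarrow> 'a::comm_ring_1) \<Rightarrow> nat \<Rightarrow> 'a poly" where
  "jacobi_poly v 0 = 0"
| "jacobi_poly v (Suc 0) = 1"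
| "jacobi_poly v (Suc (Suc n)) = [:- v (Suc n), 1:] * jacobi_poly v (Suc n) - jacobi_poly v n"

abbreviation jacobi_sol :: "(nat \<Rightarrow> 'a::comm_ring_1) \<Rightarrow> 'a \<Rightarrow> nat \<Rightarrow> 'a" where
  "jacobi_sol v x n \<equiv> poly (jacobi_poly v n) x"

lemma jacobi_sol_rec: "n \<ge> 1 \<Longrightarrow> jacobi_sol v x (Suc n) + jacobi_sol v x (n - 1) + v n * jacobi_sol v x n = x * jacobi_sol v x n"
  by (cases n) (auto simp: algebra_simps)

lemma degree_jacobi_poly:
  fixes v :: "nat \<Rightarrow> 'a::idom"
  shows "degree (jacobi_poly v (Suc n)) = n \<and> jacobi_poly v (Suc n) \<noteq> 0"
proof (induction n rule: less_induct)
  case (less n)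
  show ?case
  proof (cases n)
    case (Suc m)
    have a: "degree (jacobi_poly v (Suc m)) = m" "jacobi_poly v (Suc m) \<noteq> 0" using less Suc by auto
    have b: "degree (jacobi_poly v m) < Suc m"
      using less[of "m - 1"] Suc by (cases m) auto
    have c: "degree ([:- v (Suc m), 1:] * jacobi_poly v (Suc m)) = Suc m"
      using a by (subst degree_mult_eq) auto
    have "degree (jacobi_poly v (Suc (Suc m))) = Suc m"
      using b c by (simp only: jacobi_poly.simps diff_conv_add_uminus)
        (subst degree_add_eq_left, auto)
    then show ?thesis using Suc by (metis degree_0 nat.distinct(1))
  qed auto
qed

text \<open>The three-term recursion makes this sum telescope. At two roots of the polynomial with index
  \<open>n + 1\<close> the right-hand side vanishes: this gives orthogonality of eigenvectors, reality of roots
  (for \<open>y = cnj x\<close>) and, in the confluent form, simplicity of roots.\<close>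

lemma christoffel_darboux:
  "(x - y) * (\<Sum>i=1..n. jacobi_sol v x i * jacobi_sol v y i)
    = jacobi_sol v x (Suc n) * jacobi_sol v y n - jacobi_sol v x n * jacobi_sol v y (Suc n)"
  by (induction n) (auto simp: algebra_simps)

lemma christoffel_darboux_confluent:
  fixes v :: "nat \<Rightarrow> 'a::idom"
  shows "(\<Sum>i=1..n. (jacobi_sol v x i)\<^sup>2)
    = poly (pderiv (jacobi_poly v (Suc n))) x * jacobi_sol v x n - poly (pderiv (jacobi_poly v n)) x * jacobi_sol v x (Suc n)"
  by (induction n) (auto simp: algebra_simps pderiv_mult pderiv_diff pderiv_add pderiv_smult pderiv_pCons power2_eq_square)

lemma jacobi_sol_of_real: "jacobi_sol (\<lambda>n. complex_of_real (v n)) (complex_of_real x) n = complex_of_real (jacobi_sol v x n)"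
  by (induction v n rule: jacobi_poly.induct) auto

lemma jacobi_sol_cnj: "jacobi_sol (\<lambda>n. complex_of_real (v n)) (cnj z) n = cnj (jacobi_sol (\<lambda>n. complex_of_real (v n)) z n)"
  by (induction v n rule: jacobi_poly.induct) auto

definition jacobi_roots :: "(nat \<Rightarrow> real) \<Rightarrow> nat \<Rightarrow> real set" where
  "jacobi_roots v L = {x. jacobi_sol v x (Suc L) = 0}"

lemma jacobi_sol_norm_pos: "L \<ge> 1 \<Longrightarrow> (\<Sum>i=1..L. (jacobi_sol v x i)\<^sup>2) > (0::real)"
  by (intro sum_pos2[of _ 1]) auto

lemma jacobi_poly_roots_real:
  assumes "jacobi_sol (\<lambda>n. complex_of_real (v n)) z (Suc L) = 0"
  shows "\<exists>x. z = complex_of_real x"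
proof (cases "L = 0")
  case True
  then show ?thesis using assms by simp
next
  case False
  let ?u = "\<lambda>z. jacobi_sol (\<lambda>n. complex_of_real (v n)) z"
  have "(z - cnj z) * (\<Sum>i=1..L. ?u z i * ?u (cnj z) i) = 0"
    using christoffel_darboux[of z "cnj z" "\<lambda>n. complex_of_real (v n)" L] assms by (simp add: jacobi_sol_cnj)
  moreover have "(\<Sum>i=1..L. ?u z i * ?u (cnj z) i) = complex_of_real (\<Sum>i=1..L. (cmod (?u z i))\<^sup>2)"
    by (simp only: of_real_sum, rule sum.cong[OF refl], simp only: jacobi_sol_cnj,
        simp add: complex_norm_square[symmetric])
  moreover have "(\<Sum>i=1..L. (cmod (?u z i))\<^sup>2) > 0"
    using False by (intro sum_pos2[of _ 1]) auto
  ultimately have "z = cnj z" by (auto simp del: of_real_sum)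
  then show ?thesis by (metis Reals_cnj_iff Reals_cases)
qed

text \<open>All complex roots are real by \<open>jacobi_poly_roots_real\<close> and simple by the confluent identity,
  so a polynomial of degree \<open>L\<close> has \<open>L\<close> real roots.\<close>

lemma card_jacobi_roots: "card (jacobi_roots v L) = L" and finite_jacobi_roots: "finite (jacobi_roots v L)"
proof -
  let ?p = "jacobi_poly (\<lambda>n. complex_of_real (v n)) (Suc L)"
  have sq: "rsquarefree ?p"
    unfolding rsquarefree_roots
  proof (intro allI notI, elim conjE)
    fix z assume z: "poly ?p z = 0" "poly (pderiv ?p) z = 0"
    then obtain x where x: "z = complex_of_real x" using jacobi_poly_roots_real by blast
    have "L \<noteq> 0" using z by (intro notI) auto
    have "(\<Sum>i=1..L. (jacobi_sol (\<lambda>n. complex_of_real (v n)) z i)\<^sup>2) = 0"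
      using z by (subst christoffel_darboux_confluent) auto
    moreover have "(\<Sum>i=1..L. (jacobi_sol (\<lambda>n. complex_of_real (v n)) z i)\<^sup>2)
        = complex_of_real (\<Sum>i=1..L. (jacobi_sol v x i)\<^sup>2)"
      by (simp add: x jacobi_sol_of_real)
    ultimately show False using jacobi_sol_norm_pos[of L v x] \<open>L \<noteq> 0\<close> 
      by (simp del: of_real_sum of_real_power)
  qed
  have p0: "?p \<noteq> 0" "degree ?p = L" using degree_jacobi_poly by blast+
  have "degree (Polynomial.smult (lead_coeff ?p) (\<Prod>z|poly ?p z = 0. [:-z, 1:])) = L"
    using complex_poly_decompose_rsquarefree[OF sq] p0 by simp
  then have c: "card {z. poly ?p z = 0} = L"
  proof -
    assume *: "degree (Polynomial.smult (lead_coeff ?p) (\<Prod>z|poly ?p z = 0. [:-z, 1:])) = L"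
    have "lead_coeff ?p \<noteq> 0" using p0(1) leading_coeff_0_iff by blast
    then have "degree (\<Prod>z|poly ?p z = 0. [:-z, 1:]) = L"
      using * by (simp only: degree_smult_eq if_False)
    then show ?thesis by (simp add: degree_prod_sum_eq)
  qed
  have "{z. poly ?p z = 0} = complex_of_real ` jacobi_roots v L"
  proof -
    have "z \<in> complex_of_real ` jacobi_roots v L" if "poly ?p z = 0" for z
      using jacobi_poly_roots_real[OF that] that by (auto simp: jacobi_roots_def jacobi_sol_of_real simp del: jacobi_poly.simps)
    moreover have "poly ?p z = 0" if "z \<in> complex_of_real ` jacobi_roots v L" for z
      using that by (auto simp: jacobi_roots_def jacobi_sol_of_real simp del: jacobi_poly.simps)
    ultimately show ?thesis by blast
  qed
  with c show "card (jacobi_roots v L) = L"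
    by (metis card_image inj_of_real inj_on_subset subset_UNIV)
  show "finite (jacobi_roots v L)"
    unfolding jacobi_roots_def by (rule poly_roots_finite) (use degree_jacobi_poly in blast)
qed

lemma jacobi_sol_orthogonal:
  assumes "x \<in> jacobi_roots v L" "y \<in> jacobi_roots v L" "x \<noteq> y"
  shows "(\<Sum>i=1..L. jacobi_sol v x i * jacobi_sol v y i) = 0"
  using christoffel_darboux[of x y v L] assms by (simp add: jacobi_roots_def)

definition jacobi_mat :: "(nat \<Rightarrow> real) \<Rightarrow> nat \<Rightarrow> real mat" where
  "jacobi_mat v L = mat L L (\<lambda>(i, j).
     if i = j then v (i + 1) else if i = j + 1 \<or> j = i + 1 then 1 else 0)"

lemma jacobi_mat_eigenvalue:
  assumes "x \<in> jacobi_roots v L" "L \<ge> 1"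
  shows "eigenvalue (jacobi_mat v L) x"
proof -
  let ?w = "vec L (\<lambda>i. jacobi_sol v x (Suc i))"
  have "jacobi_mat v L *\<^sub>v ?w = x \<cdot>\<^sub>v ?w"
  proof (rule eq_vecI)
    fix i assume "i < dim_vec (x \<cdot>\<^sub>v ?w)"
    then have i: "i < L" by simp
    have "(jacobi_mat v L *\<^sub>v ?w) $ i
      = (\<Sum>j\<in>{0..<L}. (if i = j then v (i + 1) else if i = j + 1 \<or> j = i + 1 then 1 else 0) * jacobi_sol v x (Suc j))"
      using i by (simp add: jacobi_mat_def scalar_prod_def)
    also have "\<dots> = (\<Sum>j\<in>{0..<L}. (if j = i then v (i + 1) * jacobi_sol v x (Suc i) else 0)
        + (if j = i - 1 then (if i \<ge> 1 then jacobi_sol v x i else 0) else 0)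
        + (if j = i + 1 then jacobi_sol v x (i + 2) else 0))"
      by (intro sum.cong refl) auto
    also have "\<dots> = v (i + 1) * jacobi_sol v x (i + 1) + (if i \<ge> 1 then jacobi_sol v x i else 0)
        + (if i + 1 < L then jacobi_sol v x (i + 2) else 0)"
      using i by (auto simp: sum.distrib)
    also have "(if i \<ge> 1 then jacobi_sol v x i else 0) = jacobi_sol v x i" by (cases i) auto
    also have "(if i + 1 < L then jacobi_sol v x (i + 2) else 0) = jacobi_sol v x (i + 2)"
    proof (cases "i + 1 < L")
      case False
      then have "i + 2 = Suc L" using i by simp
      then show ?thesis using assms by (simp add: jacobi_roots_def del: jacobi_poly.simps)
    qed simp
    also have "v (i + 1) * jacobi_sol v x (i + 1) + jacobi_sol v x i + jacobi_sol v x (i + 2) = x * jacobi_sol v x (i + 1)"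
      using jacobi_sol_rec[of "i + 1" v x] by (simp add: algebra_simps)
    finally show "(jacobi_mat v L *\<^sub>v ?w) $ i = (x \<cdot>\<^sub>v ?w) $ i" using i by simp
  qed (simp add: jacobi_mat_def)
  moreover have "?w \<noteq> 0\<^sub>v L"
  proof
    assume "?w = 0\<^sub>v L"
    then have "?w $ 0 = 0" using assms by simp
    then show False using assms by simp
  qed
  ultimately show ?thesis
    unfolding eigenvalue_def eigenvector_def by (intro exI[of _ ?w]) (simp add: jacobi_mat_def)
qed

text \<open>The \<open>L\<close> roots have explicit eigenvectors, so they exhaust the characteristic polynomial of
  degree \<open>L\<close> and each has multiplicity one. No determinant needs to be expanded.\<close>

lemma eigenvalue_count_jacobi:
  "eigenvalue_count (jacobi_mat v L) E = card {x \<in> jacobi_roots v L. x \<le> E}"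
proof (cases "L = 0")
  case True
  have "\<not> eigenvalue (jacobi_mat v L) x" for x
    using True by (auto simp: eigenvalue_def eigenvector_def jacobi_mat_def)
  then show ?thesis using True by (simp add: eigenvalue_count_def jacobi_roots_def)
next
  case False
  let ?A = "jacobi_mat v L" and ?p = "char_poly (jacobi_mat v L)"
  have A: "?A \<in> carrier_mat L L" by (simp add: jacobi_mat_def)
  have dp: "degree ?p = L" "?p \<noteq> 0" using degree_monic_char_poly[OF A] by auto
  have fin: "finite {x. poly ?p x = 0}" using dp by (simp add: poly_roots_finite)
  have ev: "{x. poly ?p x = 0} = {x. eigenvalue ?A x}"
    using eigenvalue_root_char_poly[OF A] by auto
  have sub: "jacobi_roots v L \<subseteq> {x. poly ?p x = 0}"
    using jacobi_mat_eigenvalue False ev by auto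
  have le: "(\<Sum>x | poly ?p x = 0. order x ?p) \<le> L"
    using dp by (metis order_sum_degree)
  have ge1: "x \<in> {x. poly ?p x = 0} \<Longrightarrow> 1 \<le> order x ?p" for x
    using dp by (auto simp: order_root[of ?p x])
  have "card {x. poly ?p x = 0} \<le> (\<Sum>x | poly ?p x = 0. order x ?p)"
    using sum_mono[OF ge1, of "{x. poly ?p x = 0}" "\<lambda>x. x"] by simp
  then have "card {x. poly ?p x = 0} \<le> card (jacobi_roots v L)" using le card_jacobi_roots[of v L] by simp
  then have eq: "jacobi_roots v L = {x. poly ?p x = 0}" using sub fin card_seteq by blast
  have "order x ?p = 1" if x: "x \<in> jacobi_roots v L" for x
  proof (rule ccontr)
    assume "order x ?p \<noteq> 1"
    then have "1 < order x ?p" using ge1 x eq by force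
    then have "(\<Sum>x\<in>jacobi_roots v L. 1) < (\<Sum>x\<in>jacobi_roots v L. order x ?p)"
      using ge1 x unfolding eq by (intro sum_strict_mono_ex1 fin) auto
    then show False using le card_jacobi_roots[of v L] eq by simp
  qed
  then have "(\<Sum>x | eigenvalue ?A x \<and> x \<le> E. order x ?p) = (\<Sum>x | eigenvalue ?A x \<and> x \<le> E. 1)"
    using eq ev by (intro sum.cong) auto
  moreover have "{x. eigenvalue ?A x \<and> x \<le> E} = {x \<in> jacobi_roots v L. x \<le> E}"
    using eq ev by auto
  ultimately show ?thesis unfolding eigenvalue_count_def by (simp only: card_eq_sum)
qed

section \<open>Jacobi operators on the line\<close>

text \<open>Finite sums control everything about \<open>ell2\<close> used here; this is how membership and norm bounds
  are established throughout.\<close>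

lemma ell2_boundedI:
  assumes "\<And>F. finite F \<Longrightarrow> L2_set (\<lambda>n. cmod (x n)) F \<le> C"
  shows "x \<in> ell2" "ell2_norm x \<le> C"
proof -
  have C: "0 \<le> C" using assms[of "{}"] by simp
  have b: "(\<Sum>n\<in>F. (cmod (x n))\<^sup>2) \<le> C\<^sup>2" if "finite F" for F
    using assms[OF that] C unfolding L2_set_def
    by (metis real_sqrt_le_iff real_sqrt_unique)
  have s: "(\<lambda>n. (cmod (x n))\<^sup>2) summable_on UNIV"
    using b by (intro nonneg_bdd_above_summable_on bdd_aboveI[of _ "C\<^sup>2"]) auto
  then show "x \<in> ell2" by (simp add: ell2_def)
  have "(\<Sum>\<^sub>\<infinity>n. (cmod (x n))\<^sup>2) \<le> C\<^sup>2"
    using s b by (intro infsum_le_finite_sums) auto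
  then show "ell2_norm x \<le> C" unfolding ell2_norm_def using C by (metis real_sqrt_abs real_sqrt_le_iff abs_of_nonneg)
qed

lemma ell2_norm_nonneg: "0 \<le> ell2_norm x"
  by (simp add: ell2_norm_def infsum_nonneg)

lemma ell2_norm_square: "(ell2_norm x)\<^sup>2 = (\<Sum>\<^sub>\<infinity>n. (cmod (x n))\<^sup>2)"
  by (simp add: ell2_norm_def infsum_nonneg)

lemma L2_set_le_ell2_norm:
  assumes "x \<in> ell2" "finite F"
  shows "L2_set (\<lambda>n. cmod (x n)) F \<le> ell2_norm x"
  using assms unfolding L2_set_def ell2_norm_def ell2_def
  by (intro real_sqrt_le_mono finite_sum_le_infsum) auto

lemma norm_le_ell2_norm: "x \<in> ell2 \<Longrightarrow> cmod (x n) \<le> ell2_norm x"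
  using L2_set_le_ell2_norm[of x "{n}"] by simp

lemma ell2_norm_eq_0D: "x \<in> ell2 \<Longrightarrow> ell2_norm x = 0 \<Longrightarrow> x = (\<lambda>n. 0)"
  using norm_le_ell2_norm[of x] by (intro ext) force

lemma ell2_add:
  assumes "x \<in> ell2" "y \<in> ell2"
  shows "(\<lambda>n. x n + y n) \<in> ell2" "ell2_norm (\<lambda>n. x n + y n) \<le> ell2_norm x + ell2_norm y"
proof -
  have *: "L2_set (\<lambda>n. cmod (x n + y n)) F \<le> ell2_norm x + ell2_norm y" if "finite F" for F
  proof -
    have "L2_set (\<lambda>n. cmod (x n + y n)) F \<le> L2_set (\<lambda>n. cmod (x n) + cmod (y n)) F"
      by (intro L2_set_mono) (auto simp: norm_triangle_ineq)
    also have "\<dots> \<le> L2_set (\<lambda>n. cmod (x n)) F + L2_set (\<lambda>n. cmod (y n)) F"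
      by (rule L2_set_triangle_ineq)
    finally show ?thesis using L2_set_le_ell2_norm[OF assms(1) that] L2_set_le_ell2_norm[OF assms(2) that] by linarith
  qed
  show "(\<lambda>n. x n + y n) \<in> ell2" "ell2_norm (\<lambda>n. x n + y n) \<le> ell2_norm x + ell2_norm y"
    using ell2_boundedI[OF *] by auto
qed

lemma ell2_mult:
  assumes "x \<in> ell2" "\<And>n. cmod (v n) \<le> B"
  shows "(\<lambda>n. v n * x n) \<in> ell2" "ell2_norm (\<lambda>n. v n * x n) \<le> B * ell2_norm x"
proof -
  have B: "0 \<le> B" using assms(2)[of 0] norm_ge_zero order_trans by blast
  have *: "L2_set (\<lambda>n. cmod (v n * x n)) F \<le> B * ell2_norm x" if "finite F" for F
  proof -
    have "L2_set (\<lambda>n. cmod (v n * x n)) F \<le> L2_set (\<lambda>n. B * cmod (x n)) F"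
      by (intro L2_set_mono) (auto simp: norm_mult assms(2) mult_right_mono)
    also have "\<dots> = B * L2_set (\<lambda>n. cmod (x n)) F"
      using B by (simp add: L2_set_right_distrib)
    finally show ?thesis using L2_set_le_ell2_norm[OF assms(1) that] B
      by (meson mult_left_mono order_trans)
  qed
  show "(\<lambda>n. v n * x n) \<in> ell2" "ell2_norm (\<lambda>n. v n * x n) \<le> B * ell2_norm x"
    using ell2_boundedI[OF *] by auto
qed

lemmas ell2_scale = ell2_mult[where v = "\<lambda>_. c" and B = "cmod c" for c, OF _ order_refl]

lemma bij_int_shift: "bij_betw (\<lambda>n::int. n + k) UNIV UNIV"
  by (rule bij_betwI[where g = "\<lambda>n. n - k"]) auto

lemma infsum_int_shift: "(\<Sum>\<^sub>\<infinity>n. f (n + k :: int)) = (\<Sum>\<^sub>\<infinity>n. f n)"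
  using infsum_reindex_bij_betw[OF bij_int_shift] .

lemma summable_int_shift: "(\<lambda>n. f (n + k :: int)) summable_on UNIV \<longleftrightarrow> f summable_on UNIV"
  using summable_on_reindex_bij_betw[OF bij_int_shift] .

lemma ell2_shift: "(\<lambda>n. x (n + k)) \<in> ell2 \<longleftrightarrow> x \<in> ell2" "ell2_norm (\<lambda>n. x (n + k)) = ell2_norm x"
  using summable_int_shift[of "\<lambda>n. (cmod (x n))\<^sup>2" k] infsum_int_shift[of "\<lambda>n. (cmod (x n))\<^sup>2" k]
  by (simp_all add: ell2_def ell2_norm_def)

definition jacobi_op :: "(int \<Rightarrow> real) \<Rightarrow> (int \<Rightarrow> complex) \<Rightarrow> int \<Rightarrow> complex" where
  "jacobi_op W x = (\<lambda>n. x (n + 1) + x (n - 1) + complex_of_real (W n) * x n)"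

lemma jacobi_op_ell2:
  assumes "x \<in> ell2" "\<And>n. \<bar>W n\<bar> \<le> B"
  shows "jacobi_op W x \<in> ell2" "ell2_norm (jacobi_op W x) \<le> (2 + B) * ell2_norm x"
proof -
  note s1 = ell2_shift[of x 1] and s2 = ell2_shift[of x "-1"]
  have a: "(\<lambda>n. x (n + 1) + x (n - 1)) \<in> ell2" "ell2_norm (\<lambda>n. x (n + 1) + x (n - 1)) \<le> 2 * ell2_norm x"
    using ell2_add[of "\<lambda>n. x (n + 1)" "\<lambda>n. x (n - 1)"] s1 s2 assms(1) by auto
  have b: "(\<lambda>n. complex_of_real (W n) * x n) \<in> ell2"
    "ell2_norm (\<lambda>n. complex_of_real (W n) * x n) \<le> B * ell2_norm x"
    using ell2_mult[of x "\<lambda>n. complex_of_real (W n)" B] assms by auto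
  show "jacobi_op W x \<in> ell2" "ell2_norm (jacobi_op W x) \<le> (2 + B) * ell2_norm x"
    using ell2_add[OF a(1) b(1)] a(2) b(2) by (auto simp: jacobi_op_def distrib_right)
qed

lemma jacobi_op_linear:
  "jacobi_op W (\<lambda>n. x n + y n) = (\<lambda>n. jacobi_op W x n + jacobi_op W y n)"
  "jacobi_op W (\<lambda>n. x n - y n) = (\<lambda>n. jacobi_op W x n - jacobi_op W y n)"
  "jacobi_op W (\<lambda>n. c * x n) = (\<lambda>n. c * jacobi_op W x n)"
  by (auto simp: jacobi_op_def algebra_simps)

lemma ell2_diff: "x \<in> ell2 \<Longrightarrow> y \<in> ell2 \<Longrightarrow> (\<lambda>n. x n - y n) \<in> ell2"
  using ell2_add(1)[of x "\<lambda>n. -1 * y n"] ell2_scale(1)[of y "-1"] by simp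

text \<open>The real part of the Hilbert space inner product, which is enough to expand squared norms.\<close>

definition ell2_inner :: "(int \<Rightarrow> complex) \<Rightarrow> (int \<Rightarrow> complex) \<Rightarrow> real" where
  "ell2_inner x y = (\<Sum>\<^sub>\<infinity>n. inner (x n) (y n))"

lemma ell2_inner_summable:
  assumes "x \<in> ell2" "y \<in> ell2"
  shows "(\<lambda>n. inner (x n) (y n)) summable_on UNIV"
proof -
  have "(\<lambda>n. norm (inner (x n) (y n))) summable_on UNIV"
  proof (rule Infinite_Sum.abs_summable_on_comparison_test')
  show "(\<lambda>n. (cmod (x n))\<^sup>2 + (cmod (y n))\<^sup>2) summable_on UNIV"
    using assms by (intro summable_on_add) (auto simp: ell2_def)
  show "norm (inner (x n) (y n)) \<le> (cmod (x n))\<^sup>2 + (cmod (y n))\<^sup>2" for n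
  proof -
    have "norm (inner (x n) (y n)) \<le> cmod (x n) * cmod (y n)" using Cauchy_Schwarz_ineq2 by auto
    also have "\<dots> \<le> (cmod (x n))\<^sup>2 + (cmod (y n))\<^sup>2"
      using sum_squares_bound[of "cmod (x n)" "cmod (y n)"]
        mult_nonneg_nonneg[OF norm_ge_zero[of "x n"] norm_ge_zero[of "y n"]] by linarith
    finally show ?thesis .
  qed
  qed
  then show ?thesis by (rule Infinite_Sum.abs_summable_summable)
qed

lemma ell2_inner_add:
  assumes "x \<in> ell2" "y \<in> ell2" "z \<in> ell2"
  shows "ell2_inner x (\<lambda>n. y n + z n) = ell2_inner x y + ell2_inner x z"
    and "ell2_inner (\<lambda>n. y n + z n) x = ell2_inner y x + ell2_inner z x"
  using assms by (simp_all add: ell2_inner_def inner_add_left inner_add_right infsum_add ell2_inner_summable)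

lemma ell2_inner_shift: "ell2_inner x (\<lambda>n. y (n + k)) = ell2_inner (\<lambda>n. x (n - k)) y"
  using infsum_int_shift[of "\<lambda>n. inner (x (n - k)) (y n)" k] by (simp add: ell2_inner_def)

lemma jacobi_op_symmetric:
  assumes "x \<in> ell2" "y \<in> ell2" "\<And>n. \<bar>W n\<bar> \<le> B"
  shows "ell2_inner x (jacobi_op W y) = ell2_inner (jacobi_op W x) y"
proof -
  have sh: "(\<lambda>n. z (n + 1)) \<in> ell2" "(\<lambda>n. z (n - 1)) \<in> ell2" if "z \<in> ell2" for z
    using that ell2_shift(1)[of z 1] ell2_shift(1)[of z "-1"] by auto
  have m: "(\<lambda>n. complex_of_real (W n) * z n) \<in> ell2" if "z \<in> ell2" for z
    using ell2_mult(1)[of z "\<lambda>n. complex_of_real (W n)" B] assms(3) that by auto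
  have "ell2_inner x (jacobi_op W y) = ell2_inner x (\<lambda>n. y (n + 1)) + ell2_inner x (\<lambda>n. y (n - 1))
      + ell2_inner x (\<lambda>n. complex_of_real (W n) * y n)"
    using assms sh m ell2_add(1) by (simp add: jacobi_op_def ell2_inner_add)
  also have "ell2_inner x (\<lambda>n. y (n + 1)) = ell2_inner (\<lambda>n. x (n - 1)) y"
    by (rule ell2_inner_shift)
  also have "ell2_inner x (\<lambda>n. y (n - 1)) = ell2_inner (\<lambda>n. x (n + 1)) y"
    using ell2_inner_shift[of x y "-1"] by simp
  also have "ell2_inner x (\<lambda>n. complex_of_real (W n) * y n) = ell2_inner (\<lambda>n. complex_of_real (W n) * x n) y"
    by (simp add: ell2_inner_def inner_complex_def algebra_simps)
  finally show ?thesis using assms sh m ell2_add(1) by (simp add: jacobi_op_def ell2_inner_add)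
qed

lemma ell2_norm_diff_square:
  assumes "x \<in> ell2" "y \<in> ell2"
  shows "(ell2_norm (\<lambda>n. x n - complex_of_real t * y n))\<^sup>2
    = (ell2_norm x)\<^sup>2 - 2 * t * ell2_inner x y + t\<^sup>2 * (ell2_norm y)\<^sup>2"
proof -
  have e: "(cmod (a - complex_of_real t * b))\<^sup>2 = (cmod a)\<^sup>2 + (- 2 * t) * (inner a b) + t\<^sup>2 * (cmod b)\<^sup>2" for a b
    unfolding cmod_power2 inner_complex_def by (simp add: power2_eq_square algebra_simps)
  have s: "(\<lambda>n. (cmod (x n))\<^sup>2) summable_on UNIV" "(\<lambda>n. (cmod (y n))\<^sup>2) summable_on UNIV"
    using assms by (auto simp: ell2_def)
  show ?thesis
    unfolding ell2_norm_square e ell2_inner_def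
    by (subst infsum_add | intro summable_on_add summable_on_cmult_right s ell2_inner_summable assms
        | subst infsum_cmult_right)+ (simp_all add: infsum_cmult_right')
qed

lemma ell2_inner_self: "ell2_inner x x = (ell2_norm x)\<^sup>2"
  by (simp add: ell2_inner_def ell2_norm_square power2_norm_eq_inner)

text \<open>For small \<open>t\<close> the operator \<open>S = 1 - t T\<^sup>2\<close> is a contraction, since
  \<open>norm (S x)\<^sup>2 \<le> norm x\<^sup>2 - t norm (T x)\<^sup>2\<close>. So \<open>T\<^sup>2 g = T f\<close> is solved by the Neumann series
  \<open>g = \<Sum> S\<^sup>k (t T f)\<close>, and injectivity of \<open>T\<close> turns this into \<open>T g = f\<close>. The series is summed
  coordinatewise; this commutes with \<open>T\<close> because \<open>T\<close> couples only neighbouring sites.\<close>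

lemma bounded_below_surj:
  assumes W: "\<And>n. \<bar>W n\<bar> \<le> B" and k: "k > 0"
    and low: "\<And>x. x \<in> ell2 \<Longrightarrow> k * ell2_norm x \<le> ell2_norm (jacobi_op W x)"
    and f: "f \<in> ell2"
  shows "\<exists>g\<in>ell2. jacobi_op W g = f"
proof -
  let ?T = "jacobi_op W"
  have B: "B \<ge> 0" using W[of 0] by linarith
  \<comment> \<open>\<open>2 + B\<close> bounds the norm of the operator; adding \<open>k\<close> ensures \<open>k \<le> M\<close>.\<close>
  define M where "M = 2 + B + k"
  have M: "M > 0" "k \<le> M" using B k by (auto simp: M_def)
  define t where "t = 1 / M\<^sup>2"
  have t: "t > 0" "t * M\<^sup>2 = 1" using M by (auto simp: t_def)
  define r where "r = sqrt (1 - t * k\<^sup>2)"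
  have r0: "0 \<le> 1 - t * k\<^sup>2"
  proof -
    have "t * k\<^sup>2 \<le> t * M\<^sup>2" using t M k by (intro mult_left_mono power_mono) auto
    then show ?thesis using t by simp
  qed
  then have r: "0 \<le> r" "r < 1" "r\<^sup>2 = 1 - t * k\<^sup>2" using t k by (auto simp: r_def)
  have T2: "?T x \<in> ell2" "ell2_norm (?T x) \<le> M * ell2_norm x" if "x \<in> ell2" for x
  proof -
    have "(2 + B) * ell2_norm x \<le> M * ell2_norm x"
      using k by (intro mult_right_mono ell2_norm_nonneg) (auto simp: M_def)
    then show "?T x \<in> ell2" "ell2_norm (?T x) \<le> M * ell2_norm x"
      using jacobi_op_ell2[where W = W and B = B, OF that] W by force+
  qed
  define S where "S = (\<lambda>x n. x n - complex_of_real t * ?T (?T x) n)"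
  have S: "S x \<in> ell2" "ell2_norm (S x) \<le> r * ell2_norm x" if x: "x \<in> ell2" for x
  proof -
    note Tx = T2(1)[OF x] and TTx = T2(1)[OF T2(1)[OF x]]
    show "S x \<in> ell2" unfolding S_def using ell2_diff[OF x ell2_scale(1)[OF TTx, of "complex_of_real t"]] by simp
    have "t\<^sup>2 * (ell2_norm (?T (?T x)))\<^sup>2 \<le> t\<^sup>2 * (M * ell2_norm (?T x))\<^sup>2"
      using T2(2)[OF Tx] ell2_norm_nonneg by (intro mult_left_mono power_mono) auto
    also have "\<dots> = t * (t * M\<^sup>2) * (ell2_norm (?T x))\<^sup>2"
      by (simp add: power_mult_distrib power2_eq_square mult_ac)
    finally have TT: "t\<^sup>2 * (ell2_norm (?T (?T x)))\<^sup>2 \<le> t * (ell2_norm (?T x))\<^sup>2"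
      using t by simp
    have "(ell2_norm (S x))\<^sup>2 = (ell2_norm x)\<^sup>2 - 2 * t * ell2_inner x (?T (?T x)) + t\<^sup>2 * (ell2_norm (?T (?T x)))\<^sup>2"
      unfolding S_def by (rule ell2_norm_diff_square[OF x TTx])
    also have "ell2_inner x (?T (?T x)) = (ell2_norm (?T x))\<^sup>2"
      using jacobi_op_symmetric[OF x Tx W] by (simp add: ell2_inner_self)
    also have "(ell2_norm x)\<^sup>2 - 2 * t * (ell2_norm (?T x))\<^sup>2 + t\<^sup>2 * (ell2_norm (?T (?T x)))\<^sup>2
        \<le> (ell2_norm x)\<^sup>2 - t * (ell2_norm (?T x))\<^sup>2" using TT by simp
    also have "\<dots> \<le> (ell2_norm x)\<^sup>2 - t * (k * ell2_norm x)\<^sup>2"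
      using low[OF x] t k ell2_norm_nonneg by (intro diff_left_mono mult_left_mono power_mono) auto
    also have "\<dots> = (r * ell2_norm x)\<^sup>2" by (simp only: power_mult_distrib r(3)) (simp add: algebra_simps)
    finally show "ell2_norm (S x) \<le> r * ell2_norm x"
      using r ell2_norm_nonneg by (meson mult_nonneg_nonneg power2_le_imp_le)
  qed
  define h where "h = (\<lambda>n. complex_of_real t * ?T f n)"
  have h: "h \<in> ell2" unfolding h_def using ell2_scale(1)[OF T2(1)[OF f]] .
  define w where "w = (\<lambda>k. (S ^^ k) h)"
  have w: "w k \<in> ell2" "ell2_norm (w k) \<le> r ^ k * ell2_norm h" for k
  proof (induction k)
    case (Suc k)
    { case 1 then show ?case using S Suc by (simp add: w_def) }
    { case 2 
      have "ell2_norm (S (w k)) \<le> r * ell2_norm (w k)" using S Suc by blast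
      also have "\<dots> \<le> r * (r ^ k * ell2_norm h)" using Suc r by (intro mult_left_mono) auto
      finally show ?case by (simp add: w_def mult.assoc) }
  qed (auto simp: w_def h)
  have sw: "summable (\<lambda>k. w k n)" for n
  proof (rule summable_comparison_test)
    show "\<exists>N. \<forall>k\<ge>N. norm (w k n) \<le> r ^ k * ell2_norm h"
      using w norm_le_ell2_norm order_trans by blast
    show "summable (\<lambda>k. r ^ k * ell2_norm h)" using r by (intro summable_mult2 summable_geometric) auto
  qed
  define G where "G = (\<lambda>K n. \<Sum>k<K. w k n)"
  define g where "g = (\<lambda>n. \<Sum>k. w k n)"
  have lim: "(\<lambda>K. G K n) \<longlonglongrightarrow> g n" for n
    unfolding G_def g_def using sw by (rule summable_LIMSEQ)
  have limT: "(\<lambda>K. ?T (x K) n) \<longlonglongrightarrow> ?T y n" if "\<And>n. (\<lambda>K. x K n) \<longlonglongrightarrow> y n" for x y n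
    unfolding jacobi_op_def by (intro tendsto_intros that)
  have GS: "S (G K) n = G (Suc K) n - h n" for K n
  proof (induction K arbitrary: n)
    case 0
    show ?case by (simp add: G_def S_def jacobi_op_def w_def)
  next
    case (Suc K)
    have G1: "G (Suc K) = (\<lambda>n. G K n + w K n)" by (simp add: G_def)
    have S_add: "S (\<lambda>n. x n + y n) n = S x n + S y n" for x y
      by (simp add: S_def jacobi_op_def algebra_simps)
    have "S (G (Suc K)) n = S (G K) n + S (w K) n" unfolding G1 by (rule S_add)
    also have "S (w K) n = w (Suc K) n" by (simp add: w_def)
    finally show ?case using Suc by (simp add: G_def)
  qed
  have TTg: "complex_of_real t * ?T (?T g) n = h n" for n
  proof -
    have "(\<lambda>K. S (G K) n) \<longlonglongrightarrow> S g n"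
      unfolding S_def by (intro tendsto_intros limT lim)
    moreover have "(\<lambda>K. S (G K) n) \<longlonglongrightarrow> g n - h n"
      unfolding GS by (intro tendsto_intros LIMSEQ_Suc lim)
    ultimately have "S g n = g n - h n" by (rule LIMSEQ_unique)
    then show ?thesis by (simp add: S_def)
  qed
  have G: "G K \<in> ell2 \<and> ell2_norm (G K) \<le> (\<Sum>k<K. r ^ k * ell2_norm h)" for K
  proof (induction K)
    case 0
    have "(\<lambda>n. 0) \<in> ell2" "ell2_norm (\<lambda>n. 0) \<le> 0"
      using ell2_boundedI[of "\<lambda>n. 0" 0] by (auto simp: L2_set_def)
    then show ?case by (simp add: G_def)
  next
    case (Suc K)
    have "G (Suc K) = (\<lambda>n. G K n + w K n)" by (simp add: G_def)
    then show ?case using ell2_add[of "G K" "w K"] Suc w[of K] by auto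
  qed
  have g: "g \<in> ell2"
  proof (rule ell2_boundedI(1))
    fix F :: "int set" assume F: "finite F"
    have "(\<lambda>K. L2_set (\<lambda>n. cmod (G K n)) F) \<longlonglongrightarrow> L2_set (\<lambda>n. cmod (g n)) F"
      unfolding L2_set_def by (intro tendsto_intros lim)
    moreover have "L2_set (\<lambda>n. cmod (G K n)) F \<le> 1 / (1 - r) * ell2_norm h" for K
    proof -
      have "(\<Sum>k<K. r ^ k) \<le> 1 / (1 - r)"
        using r sum_le_suminf[of "\<lambda>k. r ^ k" "{..<K}"] by (simp add: suminf_geometric summable_geometric)
      then have "(\<Sum>k<K. r ^ k) * ell2_norm h \<le> 1 / (1 - r) * ell2_norm h"
        using ell2_norm_nonneg by (intro mult_right_mono) auto
      then show ?thesis using L2_set_le_ell2_norm[of "G K" F] F G[of K]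
        by (simp add: sum_distrib_right) 
    qed
    ultimately show "L2_set (\<lambda>n. cmod (g n)) F \<le> 1 / (1 - r) * ell2_norm h"
      by (intro LIMSEQ_le_const2) auto
  qed
  let ?e = "\<lambda>n. ?T g n - f n"
  have e: "?e \<in> ell2" using ell2_diff[OF T2(1)[OF g] f] .
  have "?T ?e n = 0" for n
    using TTg[of n] t by (simp add: jacobi_op_linear(2) h_def)
  then have "?T ?e = (\<lambda>n. 0)" by auto
  then have "k * ell2_norm ?e \<le> 0" using low[OF e] by (simp add: ell2_norm_def)
  then have "ell2_norm ?e = 0" using k ell2_norm_nonneg[of ?e] by (simp add: mult_le_0_iff)
  then have "?e = (\<lambda>n. 0)" using ell2_norm_eq_0D[OF e] by blast
  then have "?T g = f" by (metis eq_iff_diff_eq_0 ext)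
  then show ?thesis using g by blast
qed

text \<open>Solutions of \<open>T g = f\<close> are unique, so choosing one is linear, and the lower bound for \<open>T\<close> is
  an upper bound for this inverse.\<close>

lemma bounded_below_resolvent:
  assumes W: "\<And>n. \<bar>W n\<bar> \<le> B" and k: "k > 0"
    and low: "\<And>x. x \<in> ell2 \<Longrightarrow> k * ell2_norm x \<le> ell2_norm (jacobi_op W x)"
  shows "\<exists>R. bounded_operator_ell2 R \<and> (\<forall>x\<in>ell2. R (jacobi_op W x) = x \<and> jacobi_op W (R x) = x)"
proof -
  let ?T = "jacobi_op W"
  have T2: "?T x \<in> ell2" if "x \<in> ell2" for x
    using jacobi_op_ell2(1)[where W = W and B = B, OF that] W by blast
  have inj: "x = y" if "x \<in> ell2" "y \<in> ell2" "?T x = ?T y" for x y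
  proof -
    let ?e = "\<lambda>n. x n - y n"
    have e: "?e \<in> ell2" using ell2_diff that by blast
    have "?T ?e = (\<lambda>n. 0)" using that(3) by (intro ext) (simp add: jacobi_op_linear)
    then have "k * ell2_norm ?e \<le> 0" using low[OF e] by (simp add: ell2_norm_def)
    then have "ell2_norm ?e = 0" using k ell2_norm_nonneg[of ?e] by (simp add: mult_le_0_iff)
    then have "?e = (\<lambda>n. 0)" using ell2_norm_eq_0D[OF e] by blast
    then show ?thesis by (metis eq_iff_diff_eq_0 ext)
  qed
  define R where "R = (\<lambda>f. SOME g. g \<in> ell2 \<and> ?T g = f)"
  have R: "R f \<in> ell2" "?T (R f) = f" if "f \<in> ell2" for f
  proof -
    have "\<exists>g. g \<in> ell2 \<and> ?T g = f" using bounded_below_surj[OF W k low that] by blast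
    from someI_ex[OF this] show "R f \<in> ell2" "?T (R f) = f" by (auto simp: R_def)
  qed
  have "R (\<lambda>n. x n + y n) = (\<lambda>n. R x n + R y n)" if "x \<in> ell2" "y \<in> ell2" for x y
  proof (rule inj)
    show "R (\<lambda>n. x n + y n) \<in> ell2" "(\<lambda>n. R x n + R y n) \<in> ell2"
      using R(1) ell2_add(1) that by blast+
    show "?T (R (\<lambda>n. x n + y n)) = ?T (\<lambda>n. R x n + R y n)"
      using R(2)[OF ell2_add(1)[OF that]] R(2) that by (simp only: jacobi_op_linear)
  qed
  moreover have "R (\<lambda>n. c * x n) = (\<lambda>n. c * R x n)" if "x \<in> ell2" for c x
  proof (rule inj)
    show "R (\<lambda>n. c * x n) \<in> ell2" "(\<lambda>n. c * R x n) \<in> ell2"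
      using R(1) ell2_scale(1) that by blast+
    show "?T (R (\<lambda>n. c * x n)) = ?T (\<lambda>n. c * R x n)"
      using R(2)[OF ell2_scale(1)[OF that]] R(2)[OF that] by (simp only: jacobi_op_linear)
  qed
  moreover have "ell2_norm (R x) \<le> 1 / k * ell2_norm x" if "x \<in> ell2" for x
    using low[OF R(1)[OF that]] R(2)[OF that] k by (simp add: field_simps)
  ultimately have "bounded_operator_ell2 R"
    unfolding bounded_operator_ell2_def using R(1) by blast
  moreover have "R (?T x) = x" if "x \<in> ell2" for x
    using inj[OF R(1)[OF T2[OF that]] that] R(2)[OF T2[OF that]] by blast
  ultimately show ?thesis using R(2) by blast
qed

section \<open>Trapped slopes keep the energy out of the spectrum\<close>

text \<open>With \<open>t = E - V n\<close> the slope \<open>m\<close> moves to \<open>t - 1 / m\<close>. The slope \<open>a (n + 1)\<close> is at most the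
  image of \<open>a n\<close> at energy \<open>l\<close> and \<open>b (n + 1)\<close> is at least the image of \<open>b n\<close> at energy \<open>u\<close>. Slopes
  live on the projective line, where the arc from \<open>a n\<close> to \<open>b n\<close> may pass through infinity (when
  \<open>b n < a n\<close>); the last condition says that an arc whose image passes through infinity is followed
  by an arc that passes through infinity, so that the new arc contains the image of the old one
  instead of its complement.\<close>

definition trapped :: "real \<Rightarrow> (int \<Rightarrow> real) \<Rightarrow> real \<Rightarrow> real \<Rightarrow> int \<Rightarrow> (int \<Rightarrow> real) \<Rightarrow> (int \<Rightarrow> real) \<Rightarrow> bool" where
  "trapped K V l u N a b \<longleftrightarrow> (\<forall>n\<ge>N.
     1 / K \<le> \<bar>a n\<bar> \<and> \<bar>a n\<bar> \<le> K \<and> 1 / K \<le> \<bar>b n\<bar> \<and> \<bar>b n\<bar> \<le> K \<and> 1 / K \<le> \<bar>b n - a n\<bar> \<and>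
     a (n + 1) + 1 / a n \<le> l - V n \<and> u - V n \<le> b (n + 1) + 1 / b n \<and>
     (1 / a n < 1 / b n \<longrightarrow> b (n + 1) < a (n + 1)))"

text \<open>The form in \<open>(y, z) = (y (n - 1), y n)\<close> that vanishes at the slopes \<open>a\<close> and \<open>b\<close> and is
  positive on the arc between them. Dividing by \<open>b - a\<close> fixes its discriminant, so that a transfer
  matrix, having determinant one, carries the form of an arc to the form of the image arc. So
  normalized, the form grows when the arc grows.\<close>

definition trap_form :: "real \<Rightarrow> real \<Rightarrow> real \<Rightarrow> real \<Rightarrow> real" where
  "trap_form a b y z = (z - a * y) * (b * y - z) / (b - a)"

text \<open>In the coordinates \<open>A = 1 / a\<close>, \<open>B = - 1 / b\<close> before the step and \<open>\<alpha> = t - a'\<close>, \<open>\<beta> = b' - t\<close>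
  after it, the form of an arc is the same expression. It increases in both parameters as long as
  their sum keeps its sign; the two squares come from moving one parameter at a time.\<close>

lemma trap_form_increment:
  fixes A B \<alpha> \<beta> y z :: real
  assumes "A + B \<noteq> 0" "A + \<beta> \<noteq> 0" "\<alpha> + \<beta> \<noteq> 0"
  shows "(\<alpha> * z - y) * (\<beta> * z + y) / (\<alpha> + \<beta>) - (A * z - y) * (B * z + y) / (A + B)
    = (\<alpha> - A) * (\<beta> * z + y)\<^sup>2 / ((A + \<beta>) * (\<alpha> + \<beta>)) + (\<beta> - B) * (A * z - y)\<^sup>2 / ((A + B) * (A + \<beta>))"
proof -
  have 1: "(\<alpha> * z - y) * (\<beta> * z + y) / (\<alpha> + \<beta>) - (A * z - y) * (\<beta> * z + y) / (A + \<beta>)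
      = (\<alpha> - A) * (\<beta> * z + y)\<^sup>2 / ((A + \<beta>) * (\<alpha> + \<beta>))"
    using assms by (simp add: divide_simps power2_eq_square) (simp add: algebra_simps)
  have 2: "(A * z - y) * (\<beta> * z + y) / (A + \<beta>) - (A * z - y) * (B * z + y) / (A + B)
      = (\<beta> - B) * (A * z - y)\<^sup>2 / ((A + B) * (A + \<beta>))"
    using assms by (simp add: divide_simps power2_eq_square) (simp add: algebra_simps)
  show ?thesis using 1 2 by linarith
qed

text \<open>Both squares in \<open>trap_form_increment\<close> come with positive weights, because \<open>A + B\<close>, \<open>A + \<beta>\<close> and
  \<open>\<alpha> + \<beta>\<close> have the same sign: this is where the condition on arcs through infinity enters. The two
  linear forms that are squared add up to \<open>(A + \<beta>) z\<close>, so together they control \<open>z\<close>.\<close>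

lemma trap_step:
  fixes a b a' b' t y z d K :: real
  assumes a: "1 / K \<le> \<bar>a\<bar>" "1 / K \<le> \<bar>b\<bar>" and b': "\<bar>a'\<bar> \<le> K" "\<bar>b'\<bar> \<le> K"
    and ne: "a \<noteq> b" "a' \<noteq> b'" and K: "K > 0" and d: "d > 0" and t: "\<bar>t\<bar> \<le> K"
    and lo: "a' + 1 / a \<le> t - d" and hi: "t + d \<le> b' + 1 / b"
    and ord: "1 / a < 1 / b \<longrightarrow> b' < a'"
  shows "d ^ 3 / (32 * K\<^sup>2) * z\<^sup>2 \<le> trap_form a' b' z (t * z - y) - trap_form a b y z"
proof -
  define A B \<alpha> \<beta> where "A = 1 / a" and "B = - 1 / b" and "\<alpha> = t - a'" and "\<beta> = b' - t"
  have nz: "a \<noteq> 0" "b \<noteq> 0" using a K by (auto simp: divide_le_0_iff)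
  have bA: "\<bar>A\<bar> \<le> K" "\<bar>B\<bar> \<le> K" using a nz K
    by (simp_all add: A_def B_def abs_divide divide_simps mult.commute)
  have b\<alpha>: "\<bar>\<alpha>\<bar> \<le> 2 * K" "\<bar>\<beta>\<bar> \<le> 2 * K" using b' t by (auto simp: \<alpha>_def \<beta>_def)
  have e: "\<alpha> - A \<ge> d" "\<beta> - B \<ge> d" using lo hi by (auto simp: A_def B_def \<alpha>_def \<beta>_def)
  have n1: "A + B \<noteq> 0" using nz ne by (auto simp: A_def B_def divide_simps)
  have n2: "\<alpha> + \<beta> \<noteq> 0" using ne by (auto simp: \<alpha>_def \<beta>_def)
  have sgn: "(A + B > 0 \<and> A + \<beta> \<ge> d \<and> \<alpha> + \<beta> > 0) \<or> (A + B < 0 \<and> A + \<beta> \<le> - d \<and> \<alpha> + \<beta> < 0)"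
  proof (cases "A + B > 0")
    case True
    then show ?thesis using e d by linarith
  next
    case False
    then have "A + B < 0" using n1 by linarith
    then have "1 / a < 1 / b" by (simp add: A_def B_def)
    then have "\<alpha> + \<beta> < 0" using ord by (simp add: \<alpha>_def \<beta>_def)
    then show ?thesis using e d False n1 by linarith
  qed
  have n3: "A + \<beta> \<noteq> 0" using sgn d by linarith
  have f1: "trap_form a' b' z (t * z - y) = (\<alpha> * z - y) * (\<beta> * z + y) / (\<alpha> + \<beta>)"
    by (simp add: trap_form_def \<alpha>_def \<beta>_def algebra_simps)
  have f2: "trap_form a b y z = (A * z - y) * (B * z + y) / (A + B)"
    using nz ne n1 by (simp add: trap_form_def A_def B_def divide_simps) (simp add: algebra_simps)
  have pos: "(A + \<beta>) * (\<alpha> + \<beta>) > 0" "(A + B) * (A + \<beta>) > 0"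
    using sgn d by (auto simp: zero_less_mult_iff)
  have ub: "(A + \<beta>) * (\<alpha> + \<beta>) \<le> 16 * K\<^sup>2" "(A + B) * (A + \<beta>) \<le> 16 * K\<^sup>2"
  proof -
    have "\<bar>A + \<beta>\<bar> * \<bar>\<alpha> + \<beta>\<bar> \<le> (4 * K) * (4 * K)"
      using bA b\<alpha> K by (intro mult_mono) auto
    then show "(A + \<beta>) * (\<alpha> + \<beta>) \<le> 16 * K\<^sup>2"
      by (simp add: power2_eq_square) (metis abs_le_D1 abs_mult)
    have "\<bar>A + B\<bar> * \<bar>A + \<beta>\<bar> \<le> (4 * K) * (4 * K)"
      using bA b\<alpha> K by (intro mult_mono) auto
    then show "(A + B) * (A + \<beta>) \<le> 16 * K\<^sup>2"
      by (simp add: power2_eq_square) (metis abs_le_D1 abs_mult)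
  qed
  have g: "d * s / (16 * K\<^sup>2) \<le> c * s / D" if "d \<le> c" "0 \<le> s" "0 < D" "D \<le> 16 * K\<^sup>2" for c s D :: real
    using that d by (intro frac_le mult_right_mono) auto
  have "d ^ 3 / (32 * K\<^sup>2) * z\<^sup>2 = d * (d\<^sup>2 * z\<^sup>2 / 2) / (16 * K\<^sup>2)"
    by (simp add: power3_eq_cube power2_eq_square)
  also have "\<dots> \<le> d * (((A + \<beta>) * z)\<^sup>2 / 2) / (16 * K\<^sup>2)"
  proof -
    have "d\<^sup>2 \<le> (A + \<beta>)\<^sup>2" using sgn d by (intro abs_le_square_iff[THEN iffD1]) auto
    then show ?thesis using d by (intro divide_right_mono mult_left_mono) (auto simp: power_mult_distrib mult_right_mono)
  qed
  also have "\<dots> \<le> d * ((\<beta> * z + y)\<^sup>2 + (A * z - y)\<^sup>2) / (16 * K\<^sup>2)"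
  proof -
    have "(p + r)\<^sup>2 / 2 \<le> p\<^sup>2 + r\<^sup>2" for p r :: real
      using zero_le_power2[of "p - r"] by (simp add: power2_sum power2_diff)
    from this[of "\<beta> * z + y" "A * z - y"]
    have "((A + \<beta>) * z)\<^sup>2 / 2 \<le> (\<beta> * z + y)\<^sup>2 + (A * z - y)\<^sup>2"
      by (simp add: distrib_right add.commute)
    then show ?thesis using d by (intro divide_right_mono mult_left_mono) auto
  qed
  also have "\<dots> = d * (\<beta> * z + y)\<^sup>2 / (16 * K\<^sup>2) + d * (A * z - y)\<^sup>2 / (16 * K\<^sup>2)"
    by (simp add: add_divide_distrib distrib_left)
  also have "\<dots> \<le> (\<alpha> - A) * (\<beta> * z + y)\<^sup>2 / ((A + \<beta>) * (\<alpha> + \<beta>)) + (\<beta> - B) * (A * z - y)\<^sup>2 / ((A + B) * (A + \<beta>))"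
    by (intro add_mono g e pos ub) auto
  finally show ?thesis using trap_form_increment[OF n1 n3 n2, of z y] f1 f2 by simp
qed

lemma trap_form_bound:
  assumes "\<bar>a\<bar> \<le> K" "\<bar>b\<bar> \<le> K" "1 / K \<le> \<bar>b - a\<bar>" "K \<ge> 1"
  shows "\<bar>trap_form a b y z\<bar> \<le> 4 * K ^ 3 * (y\<^sup>2 + z\<^sup>2)"
    and "\<bar>trap_form a b y (z + f) - trap_form a b y z\<bar> \<le> 2 * K\<^sup>2 * \<bar>f\<bar> * (\<bar>y\<bar> + \<bar>z\<bar> + \<bar>z + f\<bar>)"
proof -
  have n: "b \<noteq> a" using assms by (auto simp: divide_le_0_iff)
  have inv: "1 / \<bar>b - a\<bar> \<le> K" using assms n by (simp add: divide_simps mult.commute)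
  have "\<bar>z - a * y\<bar> \<le> K * (\<bar>y\<bar> + \<bar>z\<bar>)" if "\<bar>a\<bar> \<le> K" for a
  proof -
    have "\<bar>z - a * y\<bar> \<le> \<bar>z\<bar> + \<bar>a\<bar> * \<bar>y\<bar>" by (metis abs_mult abs_triangle_ineq4)
    also have "\<dots> \<le> K * \<bar>z\<bar> + K * \<bar>y\<bar>" using that assms
      by (intro add_mono mult_right_mono) (auto simp: mult_le_cancel_right1)
    finally show ?thesis by (simp add: algebra_simps)
  qed
  from this[OF assms(1)] this[OF assms(2)]
  have "\<bar>z - a * y\<bar> * \<bar>b * y - z\<bar> \<le> (K * (\<bar>y\<bar> + \<bar>z\<bar>)) * (K * (\<bar>y\<bar> + \<bar>z\<bar>))"
    using assms by (intro mult_mono) (auto simp: abs_minus_commute)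
  then have "\<bar>z - a * y\<bar> * \<bar>b * y - z\<bar> * (1 / \<bar>b - a\<bar>) \<le> ((K * (\<bar>y\<bar> + \<bar>z\<bar>)) * (K * (\<bar>y\<bar> + \<bar>z\<bar>))) * K"
    using inv assms by (rule_tac mult_mono) auto
  moreover have "\<bar>trap_form a b y z\<bar> = \<bar>z - a * y\<bar> * \<bar>b * y - z\<bar> * (1 / \<bar>b - a\<bar>)"
    by (simp add: trap_form_def abs_mult abs_divide)
  moreover have "((K * (\<bar>y\<bar> + \<bar>z\<bar>)) * (K * (\<bar>y\<bar> + \<bar>z\<bar>))) * K = K ^ 3 * (\<bar>y\<bar> + \<bar>z\<bar>)\<^sup>2"
    by (simp only: power3_eq_cube power2_eq_square mult_ac)
  ultimately have "\<bar>trap_form a b y z\<bar> \<le> K ^ 3 * (\<bar>y\<bar> + \<bar>z\<bar>)\<^sup>2" by simp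
  also have "\<dots> \<le> K ^ 3 * (4 * (y\<^sup>2 + z\<^sup>2))"
  proof -
    have "0 \<le> (\<bar>y\<bar> - \<bar>z\<bar>)\<^sup>2" by simp
    then have "2 * (\<bar>y\<bar> * \<bar>z\<bar>) \<le> y\<^sup>2 + z\<^sup>2" by (simp add: power2_diff)
    moreover have "(\<bar>y\<bar> + \<bar>z\<bar>)\<^sup>2 = y\<^sup>2 + z\<^sup>2 + 2 * (\<bar>y\<bar> * \<bar>z\<bar>)" by (simp add: power2_sum)
    moreover have "p \<le> 4 * s" if "2 * q \<le> s" "p = s + 2 * q" "0 \<le> s" for p q s :: real
      using that by linarith
    moreover have "0 \<le> y\<^sup>2 + z\<^sup>2" by simp
    ultimately have "(\<bar>y\<bar> + \<bar>z\<bar>)\<^sup>2 \<le> 4 * (y\<^sup>2 + z\<^sup>2)" by blast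
    then show ?thesis using assms by (intro mult_left_mono) auto
  qed
  finally show "\<bar>trap_form a b y z\<bar> \<le> 4 * K ^ 3 * (y\<^sup>2 + z\<^sup>2)" by (simp only: mult_ac)
  have eq: "trap_form a b y (z + f) - trap_form a b y z = f * ((a + b) * y - z - (z + f)) / (b - a)"
    using n by (simp add: trap_form_def divide_simps) (simp add: algebra_simps)
  have "\<bar>(a + b) * y - z - (z + f)\<bar> \<le> 2 * K * (\<bar>y\<bar> + \<bar>z\<bar> + \<bar>z + f\<bar>)"
  proof -
    have "\<bar>(a + b) * y\<bar> \<le> 2 * K * \<bar>y\<bar>" using assms by (simp add: abs_mult mult_right_mono)
    moreover have "\<bar>z\<bar> \<le> 2 * K * \<bar>z\<bar>" "\<bar>z + f\<bar> \<le> 2 * K * \<bar>z + f\<bar>"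
      using assms by (simp_all add: mult_le_cancel_right1)
    ultimately have "\<bar>(a + b) * y - z - (z + f)\<bar> \<le> 2 * K * \<bar>y\<bar> + 2 * K * \<bar>z\<bar> + 2 * K * \<bar>z + f\<bar>"
      by linarith
    then show ?thesis by (simp only: distrib_left)
  qed
  then have le: "\<bar>f\<bar> * \<bar>(a + b) * y - z - (z + f)\<bar> * (1 / \<bar>b - a\<bar>)
      \<le> (\<bar>f\<bar> * (2 * K * (\<bar>y\<bar> + \<bar>z\<bar> + \<bar>z + f\<bar>))) * K"
    using inv assms by (intro mult_mono) auto
  have "\<bar>trap_form a b y (z + f) - trap_form a b y z\<bar>
      = \<bar>f\<bar> * \<bar>(a + b) * y - z - (z + f)\<bar> * (1 / \<bar>b - a\<bar>)"
    unfolding eq by (simp add: abs_mult abs_divide)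
  also note le
  also have "(\<bar>f\<bar> * (2 * K * (\<bar>y\<bar> + \<bar>z\<bar> + \<bar>z + f\<bar>))) * K = 2 * K\<^sup>2 * \<bar>f\<bar> * (\<bar>y\<bar> + \<bar>z\<bar> + \<bar>z + f\<bar>)"
    by (simp only: power2_eq_square mult_ac)
  finally show "\<bar>trap_form a b y (z + f) - trap_form a b y z\<bar> \<le> 2 * K\<^sup>2 * \<bar>f\<bar> * (\<bar>y\<bar> + \<bar>z\<bar> + \<bar>z + f\<bar>)" .
qed


lemma trapped_mono:
  assumes "trapped K V l u N a b" "1 \<le> K" "K \<le> K'"
  shows "trapped K' V l u N a b"
proof -
  have "1 / K' \<le> 1 / K" using assms by (simp add: frac_le)
  with assms show ?thesis unfolding trapped_def by (meson order_trans)
qed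

text \<open>For a sequence \<open>y\<close> with defect \<open>f = (H - E) y\<close> the growth of the form telescopes, up to an
  error from \<open>f\<close>.\<close>

lemma trapped_real_estimate:
  fixes y :: "int \<Rightarrow> real"
  assumes trap: "trapped K V l u N a b" and E: "l + d \<le> E" "E + d \<le> u" and d: "d > 0"
    and K: "K \<ge> 1" and t: "\<And>n. \<bar>E - V n\<bar> \<le> K"
    and f: "\<And>n. f n = y (n + 1) + y (n - 1) + (V n - E) * y n"
  shows "d ^ 3 / (32 * K\<^sup>2) * (\<Sum>i<m. (y (N + int i))\<^sup>2)
    \<le> 4 * K ^ 3 * ((y (N + int m - 1))\<^sup>2 + (y (N + int m))\<^sup>2 + (y (N - 1))\<^sup>2 + (y N)\<^sup>2)
      + 2 * K\<^sup>2 * (K + 1) * (\<Sum>i<m. \<bar>f (N + int i)\<bar>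
          * (\<bar>y (N + int i - 1)\<bar> + \<bar>y (N + int i)\<bar> + \<bar>y (N + int i + 1)\<bar>))"
proof -
  define q where "q = (\<lambda>n. trap_form (a n) (b n) (y (n - 1)) (y n))"
  have st: "d ^ 3 / (32 * K\<^sup>2) * (y n)\<^sup>2 \<le> q (n + 1) - q n
      + 2 * K\<^sup>2 * (K + 1) * (\<bar>f n\<bar> * (\<bar>y (n - 1)\<bar> + \<bar>y n\<bar> + \<bar>y (n + 1)\<bar>))" if n: "n \<ge> N" for n
  proof -
    have T: "1 / K \<le> \<bar>a n\<bar>" "1 / K \<le> \<bar>b n\<bar>" "1 / K \<le> \<bar>b n - a n\<bar>"
      "a (n + 1) + 1 / a n \<le> l - V n" "u - V n \<le> b (n + 1) + 1 / b n"
      "1 / a n < 1 / b n \<longrightarrow> b (n + 1) < a (n + 1)"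
      and T1: "\<bar>a (n + 1)\<bar> \<le> K" "\<bar>b (n + 1)\<bar> \<le> K" "1 / K \<le> \<bar>b (n + 1) - a (n + 1)\<bar>"
      using trap n by (simp_all add: trapped_def)
    have ne: "a n \<noteq> b n" "a (n + 1) \<noteq> b (n + 1)" using T(3) T1(3) K by (auto simp: divide_le_0_iff)
    let ?g = "(E - V n) * y n - y (n - 1)"
    have gf: "?g + f n = y (n + 1)" by (simp add: f algebra_simps)
    have "d ^ 3 / (32 * K\<^sup>2) * (y n)\<^sup>2 \<le> trap_form (a (n + 1)) (b (n + 1)) (y n) ?g - q n"
      unfolding q_def
      by (rule trap_step[OF T(1,2) T1(1,2) ne _ d t]) (use T E K in auto)
    moreover have "\<bar>q (n + 1) - trap_form (a (n + 1)) (b (n + 1)) (y n) ?g\<bar>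
        \<le> 2 * K\<^sup>2 * \<bar>f n\<bar> * (\<bar>y n\<bar> + \<bar>?g\<bar> + \<bar>y (n + 1)\<bar>)"
      using trap_form_bound(2)[OF T1 K, of "y n" ?g "f n"] unfolding gf q_def by simp
    moreover have "2 * K\<^sup>2 * \<bar>f n\<bar> * (\<bar>y n\<bar> + \<bar>?g\<bar> + \<bar>y (n + 1)\<bar>)
        \<le> 2 * K\<^sup>2 * \<bar>f n\<bar> * ((K + 1) * (\<bar>y (n - 1)\<bar> + \<bar>y n\<bar> + \<bar>y (n + 1)\<bar>))"
    proof (rule mult_left_mono)
      have "\<bar>?g\<bar> \<le> \<bar>E - V n\<bar> * \<bar>y n\<bar> + \<bar>y (n - 1)\<bar>" by (metis abs_mult abs_triangle_ineq4)
      also have "\<dots> \<le> K * \<bar>y n\<bar> + \<bar>y (n - 1)\<bar>" using t by (intro add_right_mono mult_right_mono) auto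
      finally have 1: "\<bar>?g\<bar> \<le> K * \<bar>y n\<bar> + \<bar>y (n - 1)\<bar>" .
      have 2: "0 \<le> K * \<bar>y (n - 1)\<bar>" "0 \<le> K * \<bar>y (n + 1)\<bar>" using K by auto
      show "\<bar>y n\<bar> + \<bar>?g\<bar> + \<bar>y (n + 1)\<bar> \<le> (K + 1) * (\<bar>y (n - 1)\<bar> + \<bar>y n\<bar> + \<bar>y (n + 1)\<bar>)"
        using 1 2 by (simp add: algebra_simps)
    qed auto
    moreover have "2 * K\<^sup>2 * \<bar>f n\<bar> * ((K + 1) * (\<bar>y (n - 1)\<bar> + \<bar>y n\<bar> + \<bar>y (n + 1)\<bar>))
        = 2 * K\<^sup>2 * (K + 1) * (\<bar>f n\<bar> * (\<bar>y (n - 1)\<bar> + \<bar>y n\<bar> + \<bar>y (n + 1)\<bar>))"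
      by (simp only: mult_ac)
    ultimately show ?thesis by linarith
  qed
  have "d ^ 3 / (32 * K\<^sup>2) * (\<Sum>i<m. (y (N + int i))\<^sup>2)
      \<le> (\<Sum>i<m. q (N + int i + 1) - q (N + int i) + 2 * K\<^sup>2 * (K + 1) * (\<bar>f (N + int i)\<bar>
          * (\<bar>y (N + int i - 1)\<bar> + \<bar>y (N + int i)\<bar> + \<bar>y (N + int i + 1)\<bar>)))"
    unfolding sum_distrib_left by (rule sum_mono) (rule st, simp)
  also have "\<dots> = (\<Sum>i<m. q (N + int (Suc i)) - q (N + int i)) + 2 * K\<^sup>2 * (K + 1) * (\<Sum>i<m. \<bar>f (N + int i)\<bar>
          * (\<bar>y (N + int i - 1)\<bar> + \<bar>y (N + int i)\<bar> + \<bar>y (N + int i + 1)\<bar>))"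
    by (simp only: sum.distrib sum_distrib_left[symmetric] of_nat_Suc) (simp add: add_ac)
  also have "(\<Sum>i<m. q (N + int (Suc i)) - q (N + int i)) = q (N + int m) - q N"
    by (subst sum_lessThan_telescope) simp
  also have "q (N + int m) - q N \<le> 4 * K ^ 3 * ((y (N + int m - 1))\<^sup>2 + (y (N + int m))\<^sup>2 + (y (N - 1))\<^sup>2 + (y N)\<^sup>2)"
  proof -
    have "\<bar>q n\<bar> \<le> 4 * K ^ 3 * ((y (n - 1))\<^sup>2 + (y n)\<^sup>2)" if "n \<ge> N" for n
      unfolding q_def using trap that K by (intro trap_form_bound) (auto simp: trapped_def)
    from this[of N] this[of "N + int m"] show ?thesis by (simp add: algebra_simps)
  qed
  finally show ?thesis by simp
qed

lemma ell2_tail_small: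
  assumes "x \<in> ell2" "e > 0"
  shows "finite {n. (cmod (x n))\<^sup>2 \<ge> e}"
proof (rule ccontr)
  assume inf: "infinite {n. (cmod (x n))\<^sup>2 \<ge> e}"
  obtain k :: nat where k: "(ell2_norm x)\<^sup>2 < real k * e"
    using assms(2) reals_Archimedean3 by blast
  obtain F where F: "finite F" "card F = k" "F \<subseteq> {n. (cmod (x n))\<^sup>2 \<ge> e}"
    using infinite_arbitrarily_large[OF inf] by blast
  have "real k * e = (\<Sum>n\<in>F. e)" using F by simp
  also have "\<dots> \<le> (\<Sum>n\<in>F. (cmod (x n))\<^sup>2)" using F by (intro sum_mono) auto
  also have "\<dots> \<le> (ell2_norm x)\<^sup>2"
    unfolding ell2_norm_square using assms F by (intro finite_sum_le_infsum) (auto simp: ell2_def)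
  finally show False using k by simp
qed

text \<open>Trapped slopes exist from arbitrarily far to the left on, with common bounds, so that boundary
  terms on the left vanish in the limit; and the positive slopes have density \<open>\<rho>\<close> with bounded
  discrepancy.\<close>

definition hyperbolic_gap :: "(int \<Rightarrow> real) \<Rightarrow> real \<Rightarrow> real \<Rightarrow> real \<Rightarrow> bool" where
  "hyperbolic_gap V l u \<rho> \<longleftrightarrow> (\<exists>K\<ge>1. \<forall>R. \<exists>N\<le>R. \<exists>a b C. trapped K V l u N a b \<and>
     (\<forall>L. \<bar>real (card {n \<in> {1..int L}. 0 < a n}) - \<rho> * real L\<bar> \<le> C \<and>
          \<bar>real (card {n \<in> {1..int L}. 0 < b n}) - \<rho> * real L\<bar> \<le> C))"

text \<open>An element of \<open>ell2\<close> is small near both ends of a long interval, so in \<open>trapped_real_estimate\<close>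
  (for its real and imaginary parts) only the defect remains, and the Cauchy-Schwarz inequality
  applies.\<close>

lemma hyperbolic_gap_bounded_below:
  assumes gap: "hyperbolic_gap V l u \<rho>" and B: "\<And>n. \<bar>V n\<bar> \<le> B" and E: "l < E" "E < u"
  shows "\<exists>k>0. \<forall>x\<in>ell2. k * ell2_norm x \<le> ell2_norm (jacobi_op (\<lambda>n. V n - E) x)"
proof -
  define d where "d = min (E - l) (u - E)"
  have d: "d > 0" "l + d \<le> E" "E + d \<le> u" using E by (auto simp: d_def)
  obtain K0 where K0: "K0 \<ge> 1" "\<And>R. \<exists>N\<le>R. \<exists>a b. trapped K0 V l u N a b"
    using gap unfolding hyperbolic_gap_def by blast
  define K where "K = K0 + \<bar>E\<bar> + B"
  have "B \<ge> 0" using B[of 0] by linarith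
  then have K: "K \<ge> 1" "K0 \<le> K" and t: "\<bar>E - V n\<bar> \<le> K" for n
    using K0(1) B[of n] by (auto simp: K_def)
  define c where "c = d ^ 3 / (32 * K\<^sup>2)"
  define D where "D = 2 * K\<^sup>2 * (K + 1)"
  have c: "c > 0" and D: "D > 0" using d K by (auto simp: c_def D_def)
  have main: "c * (ell2_norm x)\<^sup>2 \<le> D * (6 * ell2_norm (jacobi_op (\<lambda>n. V n - E) x) * ell2_norm x)"
    if x: "x \<in> ell2" for x
  proof -
    let ?f = "jacobi_op (\<lambda>n. V n - E) x"
    let ?P = "6 * ell2_norm ?f * ell2_norm x"
    have f: "?f \<in> ell2"
    proof (rule jacobi_op_ell2(1)[OF x])
      show "\<bar>V n - E\<bar> \<le> B + \<bar>E\<bar>" for n using B[of n] by linarith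
    qed
    have fin: "c * (\<Sum>n\<in>F. (cmod (x n))\<^sup>2) \<le> D * ?P" if F: "finite F" for F
    proof (rule field_le_epsilon)
      fix e :: real assume e: "e > 0"
      define e' where "e' = e / (32 * K ^ 3)"
      have e': "e' > 0" using e K by (simp add: e'_def)
      have "finite (F \<union> {n. (cmod (x n))\<^sup>2 \<ge> e'})" using ell2_tail_small[OF x e'] F by simp
      then obtain R where R: "\<And>n. n \<in> F \<union> {n. (cmod (x n))\<^sup>2 \<ge> e'} \<Longrightarrow> \<bar>n\<bar> \<le> R"
        by (metis Max_ge finite_imageI imageI)
      \<comment> \<open>The interval from \<open>N\<close> to \<open>\<bar>R\<bar> + 2\<close> contains \<open>F\<close>, and \<open>x\<close> is small at both of its ends.\<close>
      obtain N a b where N: "N \<le> - \<bar>R\<bar> - 1" and tr0: "trapped K0 V l u N a b"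
        using K0(2) by blast
      have tr: "trapped K V l u N a b" using trapped_mono[OF tr0 K0(1) K(2)] .
      define m where "m = nat (\<bar>R\<bar> + 2 - N)"
      have m: "N + int m = \<bar>R\<bar> + 2" 
      proof -
        have "0 \<le> \<bar>R\<bar> + 2 - N" using N by linarith
        then show ?thesis unfolding m_def by simp
      qed
      define T :: "(int \<Rightarrow> real) \<Rightarrow> (int \<Rightarrow> real) \<Rightarrow> nat \<Rightarrow> real" where
        "T = (\<lambda>f y i. \<bar>f (N + int i)\<bar> * (\<bar>y (N + int i - 1)\<bar> + \<bar>y (N + int i)\<bar> + \<bar>y (N + int i + 1)\<bar>))"
      define bd where "bd = (\<lambda>y::int \<Rightarrow> real. (y (N + int m - 1))\<^sup>2 + (y (N + int m))\<^sup>2 + (y (N - 1))\<^sup>2 + (y N)\<^sup>2)"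
      have est: "c * (\<Sum>i<m. (y (N + int i))\<^sup>2) \<le> 4 * K ^ 3 * bd y + D * (\<Sum>i<m. T f y i)"
        if "\<And>n. f n = y (n + 1) + y (n - 1) + (V n - E) * y n" for f y
        unfolding c_def D_def T_def bd_def
        by (rule trapped_real_estimate[OF tr d(2,3,1) K(1) t that])
      define X where "X = (\<lambda>n. cmod (x n))"
      have 1: "c * (\<Sum>i<m. (Re (x (N + int i)))\<^sup>2) \<le> 4 * K ^ 3 * bd (\<lambda>n. Re (x n)) + D * (\<Sum>i<m. T (\<lambda>n. Re (?f n)) (\<lambda>n. Re (x n)) i)"
        by (rule est) (simp add: jacobi_op_def)
      have 2: "c * (\<Sum>i<m. (Im (x (N + int i)))\<^sup>2) \<le> 4 * K ^ 3 * bd (\<lambda>n. Im (x n)) + D * (\<Sum>i<m. T (\<lambda>n. Im (?f n)) (\<lambda>n. Im (x n)) i)"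
        by (rule est) (simp add: jacobi_op_def)
      have T_le: "T (\<lambda>n. Re (?f n)) (\<lambda>n. Re (x n)) i \<le> T (\<lambda>n. cmod (?f n)) X i"
        "T (\<lambda>n. Im (?f n)) (\<lambda>n. Im (x n)) i \<le> T (\<lambda>n. cmod (?f n)) X i" for i
        unfolding T_def X_def by (intro mult_mono add_mono; simp add: abs_Re_le_cmod abs_Im_le_cmod)+
      have T_sum: "(\<Sum>i<m. T (\<lambda>n. cmod (?f n)) X i) \<le> 3 * ell2_norm ?f * ell2_norm x"
      proof -
        have sh: "L2_set (\<lambda>i. X (N + int i + k)) {..<m} \<le> ell2_norm x" for k
        proof -
          have "L2_set (\<lambda>i. X (N + int i + k)) {..<m} = L2_set X ((\<lambda>i. N + int i + k) ` {..<m})"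
            by (simp add: L2_set_def sum.reindex inj_on_def)
          then show ?thesis using L2_set_le_ell2_norm[OF x] by (simp add: X_def)
        qed
        have fs: "L2_set (\<lambda>i. cmod (?f (N + int i))) {..<m} \<le> ell2_norm ?f"
        proof -
          have "L2_set (\<lambda>i. cmod (?f (N + int i))) {..<m} = L2_set (\<lambda>n. cmod (?f n)) ((\<lambda>i. N + int i) ` {..<m})"
            by (simp add: L2_set_def sum.reindex inj_on_def)
          then show ?thesis using L2_set_le_ell2_norm[OF f] by simp
        qed
        have p: "(\<Sum>i<m. cmod (?f (N + int i)) * X (N + int i + k)) \<le> ell2_norm ?f * ell2_norm x" for k
        proof -
          have "(\<Sum>i<m. cmod (?f (N + int i)) * X (N + int i + k))
            \<le> L2_set (\<lambda>i. cmod (?f (N + int i))) {..<m} * L2_set (\<lambda>i. X (N + int i + k)) {..<m}"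
            using L2_set_mult_ineq[of "\<lambda>i. cmod (?f (N + int i))" "\<lambda>i. X (N + int i + k)" "{..<m}"]
            by (simp add: X_def)
          also have "\<dots> \<le> ell2_norm ?f * ell2_norm x"
            by (intro mult_mono sh fs) (auto simp: ell2_norm_nonneg)
          finally show ?thesis .
        qed
        have "(\<Sum>i<m. T (\<lambda>n. cmod (?f n)) X i) = (\<Sum>i<m. cmod (?f (N + int i)) * X (N + int i + (-1)))
            + (\<Sum>i<m. cmod (?f (N + int i)) * X (N + int i + 0)) + (\<Sum>i<m. cmod (?f (N + int i)) * X (N + int i + 1))"
          by (simp add: T_def X_def sum.distrib distrib_left)
        then show ?thesis using p[of "-1"] p[of 0] p[of 1] by linarith
      qed
      have small: "(X n)\<^sup>2 \<le> e'" if "\<bar>n\<bar> > R" for n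
        using R[of n] that by (force simp: X_def)
      have bd_le: "bd (\<lambda>n. Re (x n)) + bd (\<lambda>n. Im (x n)) \<le> 4 * e'"
      proof -
        have "bd (\<lambda>n. Re (x n)) + bd (\<lambda>n. Im (x n)) = bd X"
          by (simp add: bd_def X_def cmod_power2)
        also have "\<dots> \<le> e' + e' + e' + e'"
          unfolding bd_def using N m by (intro add_mono small) auto
        finally show ?thesis by simp
      qed
      have "F \<subseteq> (\<lambda>i. N + int i) ` {..<m}"
      proof
        fix n assume "n \<in> F"
        then have "\<bar>n\<bar> \<le> R" using R by blast
        then have "n = N + int (nat (n - N))" "nat (n - N) < m" using N m by auto
        then show "n \<in> (\<lambda>i. N + int i) ` {..<m}" by blast
      qed
      then have "(\<Sum>n\<in>F. (cmod (x n))\<^sup>2) \<le> (\<Sum>n\<in>(\<lambda>i. N + int i) ` {..<m}. (cmod (x n))\<^sup>2)"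
        by (intro sum_mono2) auto
      also have "\<dots> = (\<Sum>i<m. (cmod (x (N + int i)))\<^sup>2)" by (simp add: sum.reindex inj_on_def)
      also have "\<dots> = (\<Sum>i<m. (Re (x (N + int i)))\<^sup>2) + (\<Sum>i<m. (Im (x (N + int i)))\<^sup>2)"
        by (simp add: cmod_power2 sum.distrib)
      finally have "c * (\<Sum>n\<in>F. (cmod (x n))\<^sup>2) \<le> c * ((\<Sum>i<m. (Re (x (N + int i)))\<^sup>2) + (\<Sum>i<m. (Im (x (N + int i)))\<^sup>2))"
        using c by (intro mult_left_mono) auto
      also have "\<dots> \<le> 4 * K ^ 3 * (bd (\<lambda>n. Re (x n)) + bd (\<lambda>n. Im (x n)))
          + D * ((\<Sum>i<m. T (\<lambda>n. Re (?f n)) (\<lambda>n. Re (x n)) i) + (\<Sum>i<m. T (\<lambda>n. Im (?f n)) (\<lambda>n. Im (x n)) i))"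
        using 1 2 by (simp add: distrib_left)
      also have "\<dots> \<le> 4 * K ^ 3 * (4 * e') + D * (3 * ell2_norm ?f * ell2_norm x + 3 * ell2_norm ?f * ell2_norm x)"
      proof (intro add_mono mult_left_mono bd_le)
        show "(\<Sum>i<m. T (\<lambda>n. Re (?f n)) (\<lambda>n. Re (x n)) i) \<le> 3 * ell2_norm ?f * ell2_norm x"
          using sum_mono[of "{..<m}", OF T_le(1)] T_sum by (meson order_trans)
        show "(\<Sum>i<m. T (\<lambda>n. Im (?f n)) (\<lambda>n. Im (x n)) i) \<le> 3 * ell2_norm ?f * ell2_norm x"
          using sum_mono[of "{..<m}", OF T_le(2)] T_sum by (meson order_trans)
      qed (use K D in auto)
      also have "\<dots> \<le> D * ?P + e"
      proof -
        have "4 * K ^ 3 * (4 * e') = e / 2" using K by (simp add: e'_def)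
        then show ?thesis using e by (simp add: algebra_simps)
      qed
      finally show "c * (\<Sum>n\<in>F. (cmod (x n))\<^sup>2) \<le> D * ?P + e" .
    qed
    have "(\<Sum>\<^sub>\<infinity>n. (cmod (x n))\<^sup>2) \<le> D * ?P / c"
      using x fin c by (intro infsum_le_finite_sums) (auto simp: ell2_def field_simps)
    then show ?thesis using c by (simp add: ell2_norm_square field_simps)
  qed
  show ?thesis
  proof (intro exI[of _ "c / (6 * D)"] conjI ballI)
    show "c / (6 * D) > 0" using c D by simp
    fix x assume x: "x \<in> ell2"
    show "c / (6 * D) * ell2_norm x \<le> ell2_norm (jacobi_op (\<lambda>n. V n - E) x)"
    proof (cases "ell2_norm x = 0")
      case False
      then have "ell2_norm x > 0" using ell2_norm_nonneg[of x] by simp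
      then show ?thesis using main[OF x] D by (simp add: power2_eq_square field_simps)
    qed (simp add: ell2_norm_nonneg)
  qed
qed

section \<open>Counting eigenvalues with slopes\<close>

lemma jacobi_sol_combination_product:
  assumes "\<Lambda> \<subseteq> jacobi_roots v L"
  shows "(\<Sum>n=1..L. (\<Sum>x\<in>\<Lambda>. c x * jacobi_sol v x n) * (\<Sum>x\<in>\<Lambda>. d x * jacobi_sol v x n))
    = (\<Sum>x\<in>\<Lambda>. c x * d x * (\<Sum>n=1..L. (jacobi_sol v x n)\<^sup>2))"
proof -
  have fin: "finite \<Lambda>" using assms finite_jacobi_roots finite_subset by blast
  have "(\<Sum>n=1..L. (\<Sum>x\<in>\<Lambda>. c x * jacobi_sol v x n) * (\<Sum>y\<in>\<Lambda>. d y * jacobi_sol v y n))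
      = (\<Sum>n=1..L. \<Sum>x\<in>\<Lambda>. \<Sum>y\<in>\<Lambda>. c x * d y * (jacobi_sol v x n * jacobi_sol v y n))"
    by (simp add: sum_product algebra_simps)
  also have "\<dots> = (\<Sum>x\<in>\<Lambda>. \<Sum>y\<in>\<Lambda>. \<Sum>n=1..L. c x * d y * (jacobi_sol v x n * jacobi_sol v y n))"
    by (subst sum.swap, rule sum.cong[OF refl], rule sum.swap)
  also have "\<dots> = (\<Sum>x\<in>\<Lambda>. \<Sum>y\<in>\<Lambda>. if y = x then c x * d x * (\<Sum>n=1..L. (jacobi_sol v x n)\<^sup>2) else 0)"
  proof (intro sum.cong refl)
    fix x y assume "x \<in> \<Lambda>" "y \<in> \<Lambda>"
    then show "(\<Sum>n=1..L. c x * d y * (jacobi_sol v x n * jacobi_sol v y n))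
        = (if y = x then c x * d x * (\<Sum>n=1..L. (jacobi_sol v x n)\<^sup>2) else 0)"
      using jacobi_sol_orthogonal[of x v L y] assms
      by (auto simp: sum_distrib_left[symmetric] power2_eq_square)
  qed
  also have "\<dots> = (\<Sum>x\<in>\<Lambda>. c x * d x * (\<Sum>n=1..L. (jacobi_sol v x n)\<^sup>2))"
    using fin by simp
  finally show ?thesis .
qed

lemma jacobi_sol_combination_rec:
  fixes v :: "nat \<Rightarrow> real"
  assumes "n \<ge> 1"
  shows "(E - v n) * (\<Sum>x\<in>\<Lambda>. c x * jacobi_sol v x n) - (\<Sum>x\<in>\<Lambda>. c x * jacobi_sol v x (Suc n)) - (\<Sum>x\<in>\<Lambda>. c x * jacobi_sol v x (n - 1))
    = (\<Sum>x\<in>\<Lambda>. (c x * (E - x)) * jacobi_sol v x n)"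
proof -
  have u: "jacobi_sol v x (Suc n) = x * jacobi_sol v x n - jacobi_sol v x (n - 1) - v n * jacobi_sol v x n" for x
    using jacobi_sol_rec[OF assms, of v x] by linarith
  have "(E - v n) * (\<Sum>x\<in>\<Lambda>. c x * jacobi_sol v x n) - (\<Sum>x\<in>\<Lambda>. c x * jacobi_sol v x (Suc n)) - (\<Sum>x\<in>\<Lambda>. c x * jacobi_sol v x (n - 1))
      = (\<Sum>x\<in>\<Lambda>. (E - v n) * (c x * jacobi_sol v x n) - c x * jacobi_sol v x (Suc n) - c x * jacobi_sol v x (n - 1))"
    by (simp only: sum_distrib_left sum_subtractf)
  also have "\<dots> = (\<Sum>x\<in>\<Lambda>. (c x * (E - x)) * jacobi_sol v x n)"
    by (rule sum.cong[OF refl], simp only: u) (simp add: algebra_simps)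
  finally show ?thesis .
qed

text \<open>Completing squares from site to site: when \<open>a\<close> solves the Riccati recursion exactly, this is
  the factorization of a tridiagonal form with the slopes as pivots.\<close>

lemma riccati_form_identity:
  fixes a t x :: "nat \<Rightarrow> real"
  assumes "\<And>n. 1 \<le> n \<Longrightarrow> n \<le> Suc L \<Longrightarrow> a n \<noteq> 0"
  shows "(\<Sum>n=1..L. x n * (t n * x n - x (Suc n) - x (n - 1)))
    = (\<Sum>n=1..L. (t n - a (Suc n) - 1 / a n) * (x n)\<^sup>2)
      + (\<Sum>n=1..L. a (Suc n) * (x n - x (Suc n) / a (Suc n))\<^sup>2)
      + (x 1)\<^sup>2 / a 1 - x 0 * x 1 - (x (Suc L))\<^sup>2 / a (Suc L) + x L * x (Suc L)"
  using assms
proof (induction L)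
  case (Suc L)
  have "a (Suc (Suc L)) \<noteq> 0" "a (Suc L) \<noteq> 0" using Suc.prems by auto
  then have "x (Suc L) * (t (Suc L) * x (Suc L) - x (Suc (Suc L)) - x L)
      = (t (Suc L) - a (Suc (Suc L)) - 1 / a (Suc L)) * (x (Suc L))\<^sup>2
        + a (Suc (Suc L)) * (x (Suc L) - x (Suc (Suc L)) / a (Suc (Suc L)))\<^sup>2
        - (x (Suc (Suc L)))\<^sup>2 / a (Suc (Suc L)) + x (Suc L) * x (Suc (Suc L))
        + (x (Suc L))\<^sup>2 / a (Suc L) - x L * x (Suc L)"
    by (simp add: power2_eq_square field_simps)
  then show ?case using Suc.IH Suc.prems by simp
qed simp

lemma finite_jacobi_roots_filter: "finite {x \<in> jacobi_roots v L. P x}"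
  using finite_jacobi_roots by simp

text \<open>On the subspace where the squares with negative weights vanish the form of \<open>E - H\<close> is
  nonnegative, but on the span of the eigenvectors with eigenvalues above \<open>E\<close> it is negative. These
  subspaces meet only in \<open>0\<close>, which bounds the dimension. The first of the squares involves the site
  \<open>0\<close>, where all eigenvectors vanish; this is why slopes up to index \<open>L + 1\<close> are counted.\<close>

lemma card_eigenvalues_above:
  assumes a: "\<And>n. 1 \<le> n \<Longrightarrow> n \<le> Suc L \<Longrightarrow> a n \<noteq> 0"
    and ric: "\<And>n. 1 \<le> n \<Longrightarrow> n \<le> L \<Longrightarrow> a (Suc n) + 1 / a n \<le> E - v n"
  shows "card {x \<in> jacobi_roots v L. E < x} \<le> card {n \<in> {1..Suc L}. a n < 0}"
proof (rule ccontr)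
  let ?J = "{n \<in> {1..Suc L}. a n < 0}" and ?S = "{x \<in> jacobi_roots v L. E < x}"
  assume "\<not> ?thesis"
  then have "card ?J < card ?S" by simp
  from nontrivial_combination[OF _ finite_jacobi_roots_filter this, of "\<lambda>j x. jacobi_sol v x (j - 1) - jacobi_sol v x j / a j"]
  obtain c where c0: "\<exists>x\<in>?S. c x \<noteq> 0"
    and c: "\<And>j. j \<in> ?J \<Longrightarrow> (\<Sum>x\<in>?S. c x * (jacobi_sol v x (j - 1) - jacobi_sol v x j / a j)) = 0"
    by auto
  define y where "y = (\<lambda>n. \<Sum>x\<in>?S. c x * jacobi_sol v x n)"
  have cy: "y (j - 1) - y j / a j = 0" if "j \<in> ?J" for j
    using c[OF that] by (simp add: y_def right_diff_distrib sum_subtractf sum_divide_distrib)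
  have y0: "y 0 = 0" "y (Suc L) = 0"
    by (auto simp: y_def jacobi_roots_def simp del: jacobi_poly.simps(2,3) intro!: sum.neutral)
  have L: "L \<ge> 1" using c0 by (cases L) (auto simp: jacobi_roots_def)
  have "(\<Sum>n=1..L. y n * ((E - v n) * y n - y (Suc n) - y (n - 1)))
      = (\<Sum>n=1..L. (\<Sum>x\<in>?S. c x * jacobi_sol v x n) * (\<Sum>x\<in>?S. (c x * (E - x)) * jacobi_sol v x n))"
    unfolding y_def by (intro sum.cong refl arg_cong2[where f = "(*)"] jacobi_sol_combination_rec) auto
  also have "\<dots> = (\<Sum>x\<in>?S. c x * (c x * (E - x)) * (\<Sum>n=1..L. (jacobi_sol v x n)\<^sup>2))"
    by (rule jacobi_sol_combination_product) auto
  also have "\<dots> < 0"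
  proof -
    have nn: "c x * (c x * (E - x)) * (\<Sum>n=1..L. (jacobi_sol v x n)\<^sup>2) \<le> 0" if "x \<in> ?S" for x
    proof -
      have "c x * (c x * (E - x)) \<le> 0" using that by (simp add: mult.assoc[symmetric] mult_nonneg_nonpos)
      then show ?thesis by (simp add: mult_nonpos_nonneg sum_nonneg)
    qed
    obtain x where x: "x \<in> ?S" "c x \<noteq> 0" using c0 by blast
    have "c x * c x * (E - x) < 0" using x
      by (intro mult_pos_neg) (auto simp: zero_less_mult_iff linorder_neq_iff)
    then have "c x * (c x * (E - x)) < 0" by (simp only: mult.assoc)
    then have "c x * (c x * (E - x)) * (\<Sum>n=1..L. (jacobi_sol v x n)\<^sup>2) < 0"
      using jacobi_sol_norm_pos[OF L] by (simp add: mult_neg_pos)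
    then have "(\<Sum>x\<in>?S. c x * (c x * (E - x)) * (\<Sum>n=1..L. (jacobi_sol v x n)\<^sup>2)) < (\<Sum>x\<in>?S. 0)"
      using x nn by (intro sum_strict_mono_ex1 finite_jacobi_roots_filter) auto
    then show ?thesis by simp
  qed
  finally have "(\<Sum>n=1..L. y n * ((E - v n) * y n - y (Suc n) - y (n - 1))) < 0" .
  moreover have "(\<Sum>n=1..L. y n * ((E - v n) * y n - y (Suc n) - y (n - 1))) \<ge> 0"
  proof -
    have "0 \<le> (\<Sum>n=1..L. (E - v n - a (Suc n) - 1 / a n) * (y n)\<^sup>2)"
      using ric by (intro sum_nonneg mult_nonneg_nonneg) (auto simp: algebra_simps)
    moreover have "0 \<le> (\<Sum>n=1..L. a (Suc n) * (y n - y (Suc n) / a (Suc n))\<^sup>2)"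
    proof (rule sum_nonneg)
      fix n assume n: "n \<in> {1..L}"
      show "0 \<le> a (Suc n) * (y n - y (Suc n) / a (Suc n))\<^sup>2"
        using cy[of "Suc n"] n by (cases "a (Suc n) < 0") auto
    qed
    moreover have "0 \<le> (y 1)\<^sup>2 / a 1" 
      using cy[of 1] y0 a[of 1] by (cases "a 1 < 0") auto
    ultimately show ?thesis
      using riccati_form_identity[where a = a and x = y and t = "\<lambda>n. E - v n" and L = L, OF a] y0 by simp
  qed
  ultimately show False by simp
qed

text \<open>The same dimension count with the squares of positive weight removed. The margin \<open>d\<close> makes the
  form strictly negative, so that \<open>E\<close> itself may be an eigenvalue.\<close>

lemma card_eigenvalues_below:
  assumes a: "\<And>n. 1 \<le> n \<Longrightarrow> n \<le> Suc L \<Longrightarrow> a n \<noteq> 0"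
    and ric: "\<And>n. 1 \<le> n \<Longrightarrow> n \<le> L \<Longrightarrow> E - v n + d \<le> a (Suc n) + 1 / a n" and d: "d > 0"
  shows "card {x \<in> jacobi_roots v L. x \<le> E} \<le> card {n \<in> {1..Suc L}. 0 < a n}"
proof (rule ccontr)
  let ?J = "{n \<in> {1..Suc L}. 0 < a n}" and ?S = "{x \<in> jacobi_roots v L. x \<le> E}"
  assume "\<not> ?thesis"
  then have "card ?J < card ?S" by simp
  from nontrivial_combination[OF _ finite_jacobi_roots_filter this, of "\<lambda>j x. jacobi_sol v x (j - 1) - jacobi_sol v x j / a j"]
  obtain c where c0: "\<exists>x\<in>?S. c x \<noteq> 0"
    and c: "\<And>j. j \<in> ?J \<Longrightarrow> (\<Sum>x\<in>?S. c x * (jacobi_sol v x (j - 1) - jacobi_sol v x j / a j)) = 0"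
    by auto
  define y where "y = (\<lambda>n. \<Sum>x\<in>?S. c x * jacobi_sol v x n)"
  have cy: "y (j - 1) - y j / a j = 0" if "j \<in> ?J" for j
    using c[OF that] by (simp add: y_def right_diff_distrib sum_subtractf sum_divide_distrib)
  have y0: "y 0 = 0" "y (Suc L) = 0"
    by (auto simp: y_def jacobi_roots_def simp del: jacobi_poly.simps(2,3) intro!: sum.neutral)
  have L: "L \<ge> 1" using c0 by (cases L) (auto simp: jacobi_roots_def)
  have "(\<Sum>n=1..L. y n * ((E - v n) * y n - y (Suc n) - y (n - 1)))
      = (\<Sum>n=1..L. (\<Sum>x\<in>?S. c x * jacobi_sol v x n) * (\<Sum>x\<in>?S. (c x * (E - x)) * jacobi_sol v x n))"
    unfolding y_def by (intro sum.cong refl arg_cong2[where f = "(*)"] jacobi_sol_combination_rec) auto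
  also have "\<dots> = (\<Sum>x\<in>?S. c x * (c x * (E - x)) * (\<Sum>n=1..L. (jacobi_sol v x n)\<^sup>2))"
    by (rule jacobi_sol_combination_product) auto
  also have "\<dots> \<ge> 0"
  proof (rule sum_nonneg)
    fix x assume "x \<in> ?S"
    then have "0 \<le> (c x * c x) * (E - x)" by simp
    then show "0 \<le> c x * (c x * (E - x)) * (\<Sum>n=1..L. (jacobi_sol v x n)\<^sup>2)"
      by (simp only: mult.assoc) (intro mult_nonneg_nonneg[of "c x * (c x * (E - x))", unfolded mult.assoc] sum_nonneg; simp)
  qed
  finally have "0 \<le> (\<Sum>n=1..L. y n * ((E - v n) * y n - y (Suc n) - y (n - 1)))" .
  moreover have "(\<Sum>n=1..L. y n * ((E - v n) * y n - y (Suc n) - y (n - 1))) \<le> - d * (\<Sum>n=1..L. (y n)\<^sup>2)"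
  proof -
    have "(\<Sum>n=1..L. (E - v n - a (Suc n) - 1 / a n) * (y n)\<^sup>2) \<le> (\<Sum>n=1..L. - d * (y n)\<^sup>2)"
    proof (intro sum_mono mult_right_mono)
      fix n assume "n \<in> {1..L}"
      then show "E - v n - a (Suc n) - 1 / a n \<le> - d" using ric[of n] by simp
    qed simp
    moreover have "(\<Sum>n=1..L. a (Suc n) * (y n - y (Suc n) / a (Suc n))\<^sup>2) \<le> 0"
    proof (rule sum_nonpos)
      fix n assume n: "n \<in> {1..L}"
      show "a (Suc n) * (y n - y (Suc n) / a (Suc n))\<^sup>2 \<le> 0"
        using cy[of "Suc n"] n by (cases "0 < a (Suc n)") (auto simp: mult_nonpos_nonneg)
    qed
    moreover have "(y 1)\<^sup>2 / a 1 \<le> 0" 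
      using cy[of 1] y0 a[of 1] by (cases "0 < a 1") (auto simp: divide_nonneg_nonpos)
    ultimately show ?thesis
      using riccati_form_identity[where a = a and x = y and t = "\<lambda>n. E - v n" and L = L, OF a] y0 by (simp add: sum_distrib_left)
  qed
  moreover have "(\<Sum>n=1..L. (y n)\<^sup>2) > 0"
  proof -
    have "(\<Sum>n=1..L. (y n)\<^sup>2) = (\<Sum>x\<in>?S. c x * c x * (\<Sum>n=1..L. (jacobi_sol v x n)\<^sup>2))"
      unfolding y_def power2_eq_square[of "sum _ _"] by (rule jacobi_sol_combination_product) auto
    also have "\<dots> > 0"
    proof -
      obtain x where x: "x \<in> ?S" "c x \<noteq> 0" using c0 by blast
      then have "c x * c x > 0" using not_real_square_gt_zero[of "c x"] by blast
      then have "c x * c x * (\<Sum>n=1..L. (jacobi_sol v x n)\<^sup>2) > 0"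
        using jacobi_sol_norm_pos[OF L] by simp
      then show ?thesis using x
        by (intro sum_pos2[OF finite_jacobi_roots_filter x(1)]) (auto simp: sum_nonneg)
    qed
    finally show ?thesis .
  qed
  ultimately show False using mult_pos_pos[OF d] by fastforce
qed

lemma card_int_interval_bounds:
  fixes L :: nat
  shows "card {n \<in> {1..Suc L}. P (int n)} \<le> card {n \<in> {1..int L}. P n} + 1"
    and "card {n \<in> {1..int L}. P n} \<le> card {n \<in> {1..Suc L}. P (int n)}"
proof -
  have eq: "card {n \<in> {1..int L}. P n} = card {n \<in> {1..L}. P (int n)}" for L
  proof -
    have "{n \<in> {1..int L}. P n} = int ` {n \<in> {1..L}. P (int n)}"
    proof -
      have "n \<in> int ` {n \<in> {1..L}. P (int n)}" if "n \<in> {1..int L}" "P n" for n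
        using that by (intro image_eqI[of _ _ "nat n"]) auto
      then show ?thesis by auto
    qed
    then show ?thesis by (simp add: card_image)
  qed
  have "{n \<in> {1..Suc L}. P (int n)} \<subseteq> insert (Suc L) {n \<in> {1..L}. P (int n)}" by auto
  then have "card {n \<in> {1..Suc L}. P (int n)} \<le> card (insert (Suc L) {n \<in> {1..L}. P (int n)})"
    by (intro card_mono) auto
  also have "\<dots> \<le> card {n \<in> {1..L}. P (int n)} + 1" by (simp add: card_insert_le_m1 card_insert_if)
  finally show "card {n \<in> {1..Suc L}. P (int n)} \<le> card {n \<in> {1..int L}. P n} + 1" using eq by simp
  show "card {n \<in> {1..int L}. P n} \<le> card {n \<in> {1..Suc L}. P (int n)}"
    unfolding eq by (intro card_mono) auto
qed

lemma hyperbolic_gap_count: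
  assumes gap: "hyperbolic_gap V l u \<rho>" and E: "l < E" "E < u"
  shows "\<exists>C. \<forall>L. \<bar>real (eigenvalue_count (jacobi_mat (\<lambda>n. V (int n)) L) E) - \<rho> * real L\<bar> \<le> C"
proof -
  obtain K where K: "K \<ge> 1" and *: "\<forall>R. \<exists>N\<le>R. \<exists>a b C. trapped K V l u N a b \<and>
     (\<forall>L. \<bar>real (card {n \<in> {1..int L}. 0 < a n}) - \<rho> * real L\<bar> \<le> C \<and>
          \<bar>real (card {n \<in> {1..int L}. 0 < b n}) - \<rho> * real L\<bar> \<le> C)"
    using gap unfolding hyperbolic_gap_def by blast
  obtain N a b C where N: "N \<le> 1" and tr: "trapped K V l u N a b"
    and C: "\<And>L. \<bar>real (card {n \<in> {1..int L}. 0 < a n}) - \<rho> * real L\<bar> \<le> C"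
      "\<And>L. \<bar>real (card {n \<in> {1..int L}. 0 < b n}) - \<rho> * real L\<bar> \<le> C"
    using *[rule_format, of 1] by blast
  have nz: "a n \<noteq> 0" "b n \<noteq> 0" if "n \<ge> 1" for n
  proof -
    have "1 / K \<le> \<bar>a n\<bar>" "1 / K \<le> \<bar>b n\<bar>" using tr that N by (simp_all add: trapped_def)
    moreover have "1 / K > 0" using K by simp
    ultimately show "a n \<noteq> 0" "b n \<noteq> 0" by auto
  qed
  have r: "a (n + 1) + 1 / a n \<le> l - V n" "u - V n \<le> b (n + 1) + 1 / b n" if "n \<ge> 1" for n
    using tr that N unfolding trapped_def by auto
  have "\<bar>real (eigenvalue_count (jacobi_mat (\<lambda>n. V (int n)) L) E) - \<rho> * real L\<bar> \<le> C + 1" for L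
  proof -
    let ?v = "\<lambda>n. V (int n)"
    have up: "card {x \<in> jacobi_roots ?v L. E < x} \<le> card {n \<in> {1..Suc L}. a (int n) < 0}"
    proof (rule card_eigenvalues_above)
      fix n :: nat assume "1 \<le> n"
      then show "a (int n) \<noteq> 0" using nz[of "int n"] by simp
    next
      fix n :: nat assume "1 \<le> n"
      then show "a (int (Suc n)) + 1 / a (int n) \<le> E - V (int n)" using r(1)[of "int n"] E by (simp add: add.commute)
    qed
    have dn: "card {x \<in> jacobi_roots ?v L. x \<le> E} \<le> card {n \<in> {1..Suc L}. 0 < b (int n)}"
    proof (rule card_eigenvalues_below[where d = "u - E"])
      fix n :: nat assume "1 \<le> n"
      then show "b (int n) \<noteq> 0" using nz[of "int n"] by simp
    next
      fix n :: nat assume "1 \<le> n"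
      then show "E - V (int n) + (u - E) \<le> b (int (Suc n)) + 1 / b (int n)" using r(2)[of "int n"] E by (simp add: add.commute)
    qed (use E in simp)
    have "card {x \<in> jacobi_roots ?v L. x \<le> E} + card {x \<in> jacobi_roots ?v L. E < x} = card (jacobi_roots ?v L)"
      by (subst card_Un_disjoint[symmetric]) (auto intro!: arg_cong[where f = card] simp: finite_jacobi_roots_filter)
    moreover have "card {n \<in> {1..Suc L}. a (int n) < 0} + card {n \<in> {1..Suc L}. 0 < a (int n)} = card {1..Suc L}"
    proof (subst card_Un_disjoint[symmetric])
      have *: "a (int n) < 0 \<or> 0 < a (int n)" if "n \<in> {1..Suc L}" for n
        using nz(1)[of "int n"] that by fastforce
      have "{n \<in> {1..Suc L}. a (int n) < 0} \<union> {n \<in> {1..Suc L}. 0 < a (int n)} = {1..Suc L}"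
        using * by blast
      then show "card ({n \<in> {1..Suc L}. a (int n) < 0} \<union> {n \<in> {1..Suc L}. 0 < a (int n)}) = card {1..Suc L}"
        by simp
    qed auto
    ultimately have "card {n \<in> {1..Suc L}. 0 < a (int n)} \<le> card {x \<in> jacobi_roots ?v L. x \<le> E} + 1"
      using up card_jacobi_roots[of ?v L] by simp
    then show ?thesis
      using dn C[of L] card_int_interval_bounds(1)[of L "\<lambda>n. 0 < b n"] card_int_interval_bounds(2)[of L "\<lambda>n. 0 < a n"]
      unfolding eigenvalue_count_jacobi by linarith
  qed
  then show ?thesis by blast
qed

text \<open>A combination of three eigenvectors can be made to vanish at the sites \<open>1\<close> and \<open>L\<close>. Extended
  by zero it is mapped by \<open>H - E\<close> to the extension of the combination on \<open>{1..L}\<close>, without boundary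
  terms, so it is an approximate eigenvector on the line.\<close>

lemma few_eigenvalues_near_resolvent:
  assumes C: "C > 0" "\<And>x. x \<in> ell2 \<Longrightarrow> ell2_norm x \<le> C * ell2_norm (jacobi_op (\<lambda>n. V n - E) x)"
  shows "card {x \<in> jacobi_roots (\<lambda>n. V (int n)) L. \<bar>x - E\<bar> < 1 / C} \<le> 2"
proof (rule ccontr)
  let ?v = "\<lambda>n. V (int n)"
  let ?S = "{x \<in> jacobi_roots ?v L. \<bar>x - E\<bar> < 1 / C}"
  assume "\<not> ?thesis"
  then have "card {1, L} < card ?S" by (simp add: card_insert_if split: if_splits)
  from nontrivial_combination[OF _ finite_jacobi_roots_filter this, of "\<lambda>j x. jacobi_sol ?v x j"]
  obtain c where c0: "\<exists>x\<in>?S. c x \<noteq> 0"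
    and c: "\<And>j. j \<in> {1, L} \<Longrightarrow> (\<Sum>x\<in>?S. c x * jacobi_sol ?v x j) = 0"
    by blast
  define y where "y = (\<lambda>n. \<Sum>x\<in>?S. c x * jacobi_sol ?v x n)"
  define z where "z = (\<lambda>n. \<Sum>x\<in>?S. (c x * (E - x)) * jacobi_sol ?v x n)"
  have yb: "y 1 = 0" "y L = 0" using c[of 1] c[of L] by (simp_all add: y_def)
  have y0: "y 0 = 0" "y (Suc L) = 0"
    by (auto simp: y_def jacobi_roots_def simp del: jacobi_poly.simps(2,3) intro!: sum.neutral)
  have L: "L \<ge> 1" using c0 by (cases L) (auto simp: jacobi_roots_def)
  have rec: "(E - ?v n) * y n - y (Suc n) - y (n - 1) = z n" if "n \<ge> 1" for n
    unfolding y_def z_def by (rule jacobi_sol_combination_rec[OF that])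
  define ext where "ext = (\<lambda>w (n::int). if 1 \<le> n \<and> n \<le> int L then complex_of_real (w (nat n)) else 0)"
  have ext: "ext w \<in> ell2 \<and> (ell2_norm (ext w))\<^sup>2 = (\<Sum>n=1..L. (w n)\<^sup>2)" for w
  proof -
    have s: "((\<lambda>n. (cmod (ext w n))\<^sup>2) has_sum (\<Sum>n\<in>{1..int L}. (cmod (ext w n))\<^sup>2)) UNIV"
      by (rule has_sum_finite_neutralI[where B = "{1..int L}"]) (auto simp: ext_def)
    have "(\<Sum>n\<in>{1..int L}. (cmod (ext w n))\<^sup>2) = (\<Sum>n=1..L. (w n)\<^sup>2)"
      by (rule sum.reindex_bij_witness[of _ int nat]) (auto simp: ext_def)
    then show ?thesis using s unfolding ell2_norm_square ell2_def
      by (auto simp: has_sum_imp_summable infsumI)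
  qed
  have T: "jacobi_op (\<lambda>n. V n - E) (ext y) = ext (\<lambda>n. - z n)"
  proof
    fix n :: int
    consider "n < 0" | "n = 0" | "1 \<le> n" "n \<le> int L" | "n = int L + 1" | "n > int L + 1" by linarith
    then show "jacobi_op (\<lambda>n. V n - E) (ext y) n = ext (\<lambda>n. - z n) n"
    proof cases
      case 3
      define m where "m = nat n"
      have n: "n = int m" "m \<ge> 1" "m \<le> L" using 3 by (auto simp: m_def)
      have "ext y (n + 1) = complex_of_real (y (Suc m))"
      proof (cases "m = L")
        case True
        then show ?thesis using n y0 by (simp add: ext_def)
      next
        case False
        then have "nat (n + 1) = Suc m" using n by simp
        then show ?thesis using n False by (simp add: ext_def)
      qed
      moreover have "ext y (n - 1) = complex_of_real (y (m - 1))"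
      proof (cases "m = 1")
        case True
        then show ?thesis using n y0 by (simp add: ext_def)
      next
        case False
        then have "nat (n - 1) = m - 1" using n by simp
        then show ?thesis using n False by (simp add: ext_def)
      qed
      moreover have "ext y n = complex_of_real (y m)" "ext (\<lambda>n. - z n) n = complex_of_real (- z m)"
        using n by (auto simp: ext_def)
      ultimately show ?thesis using rec[OF n(2)] n(1)
        by (simp add: jacobi_op_def flip: of_real_add of_real_mult of_real_diff) (simp add: algebra_simps)
    qed (use yb L in \<open>auto simp: jacobi_op_def ext_def\<close>)
  qed
  have ny: "(ell2_norm (ext y))\<^sup>2 = (\<Sum>x\<in>?S. c x * c x * (\<Sum>n=1..L. (jacobi_sol ?v x n)\<^sup>2))"
    using ext[of y] jacobi_sol_combination_product[of ?S ?v L c c] by (simp add: y_def power2_eq_square)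
  have nz: "(ell2_norm (ext (\<lambda>n. - z n)))\<^sup>2
      = (\<Sum>x\<in>?S. (c x * (E - x)) * (c x * (E - x)) * (\<Sum>n=1..L. (jacobi_sol ?v x n)\<^sup>2))"
    using ext[of "\<lambda>n. - z n"] jacobi_sol_combination_product[of ?S ?v L "\<lambda>x. c x * (E - x)" "\<lambda>x. c x * (E - x)"]
    by (simp add: z_def power2_eq_square)
  have "(\<Sum>x\<in>?S. (c x * (E - x)) * (c x * (E - x)) * (\<Sum>n=1..L. (jacobi_sol ?v x n)\<^sup>2))
      < (\<Sum>x\<in>?S. (1 / C)\<^sup>2 * (c x * c x * (\<Sum>n=1..L. (jacobi_sol ?v x n)\<^sup>2)))"
  proof (rule sum_strict_mono_ex1)
    have sq: "(E - x)\<^sup>2 < (1 / C)\<^sup>2" if "x \<in> ?S" for x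
      using that power_strict_mono[of "\<bar>E - x\<bar>" "1 / C" 2] by (simp add: abs_minus_commute)
    have e: "(c x * (E - x)) * (c x * (E - x)) * s = (E - x)\<^sup>2 * (c x * c x * s)" for x s
      by (simp add: power2_eq_square)
    show "\<forall>x\<in>?S. (c x * (E - x)) * (c x * (E - x)) * (\<Sum>n=1..L. (jacobi_sol ?v x n)\<^sup>2)
        \<le> (1 / C)\<^sup>2 * (c x * c x * (\<Sum>n=1..L. (jacobi_sol ?v x n)\<^sup>2))"
      unfolding e using sq by (intro ballI mult_right_mono) (auto simp: sum_nonneg less_imp_le)
    obtain x where x: "x \<in> ?S" "c x \<noteq> 0" using c0 by blast
    then have "c x * c x > 0" using not_real_square_gt_zero[of "c x"] by blast
    then have "c x * c x * (\<Sum>n=1..L. (jacobi_sol ?v x n)\<^sup>2) > 0" using jacobi_sol_norm_pos[OF L] by simp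
    then show "\<exists>x\<in>?S. (c x * (E - x)) * (c x * (E - x)) * (\<Sum>n=1..L. (jacobi_sol ?v x n)\<^sup>2)
        < (1 / C)\<^sup>2 * (c x * c x * (\<Sum>n=1..L. (jacobi_sol ?v x n)\<^sup>2))"
      unfolding e using sq x by (intro bexI[of _ x] mult_strict_right_mono) auto
  qed (rule finite_jacobi_roots_filter)
  then have "(ell2_norm (ext (\<lambda>n. - z n)))\<^sup>2 < (1 / C)\<^sup>2 * (ell2_norm (ext y))\<^sup>2"
    unfolding nz ny
    by (simp only: sum_distrib_left[of "(1 / C)\<^sup>2" "\<lambda>x. c x * c x * (\<Sum>n=1..L. (jacobi_sol ?v x n)\<^sup>2)" ?S])
  also have "\<dots> \<le> (1 / C)\<^sup>2 * (C * ell2_norm (ext (\<lambda>n. - z n)))\<^sup>2"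
    using C(2)[of "ext y"] ext[of y] T by (intro mult_left_mono power_mono) (auto simp: ell2_norm_nonneg)
  also have "\<dots> = (ell2_norm (ext (\<lambda>n. - z n)))\<^sup>2" using C(1) by (simp add: power_mult_distrib power_divide)
  finally show False by simp
qed

section \<open>Itineraries through two Rokhlin towers\<close>

lemma card_less_Suc_filter:
  "card {i. i < Suc h \<and> P i} = card {i. i < h \<and> P i} + (if P h then 1 else 0)"
proof -
  have "{i. i < Suc h \<and> P i} = (if P h then insert h {i. i < h \<and> P i} else {i. i < h \<and> P i})"
    using less_Suc_eq by auto
  then show ?thesis by simp
qed

text \<open>The levels are the rotated copies \<open>h * \<omega> + [- r, r]\<close> of a base arc. After \<open>M1\<close> steps the
  rotation has moved a point of the base by \<open>D1 > 0\<close>, after \<open>M\<close> steps by \<open>D < 0\<close>. The base has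
  length \<open>D1 - D\<close>, so a point that would leave it on the right after \<open>M1\<close> steps is back inside after
  \<open>M\<close> steps.\<close>

locale rokhlin_towers =
  fixes \<omega> :: real and M1 M :: nat and p1 p :: int
  assumes heights: "0 < M1" "M1 < M"
    and drift1: "0 < real M1 * \<omega> - p1" and drift: "real M * \<omega> - p < 0"
begin

definition D1 :: real where "D1 = real M1 * \<omega> - p1"
definition D :: real where "D = real M * \<omega> - p"
definition r :: real where "r = (D1 - D) / 2"

lemma D_bounds: "0 < D1" "D < 0" "0 < r" "D1 \<le> 2 * r"
  using drift1 drift by (auto simp: D1_def D_def r_def)

text \<open>A state \<open>(h, s)\<close> stands for the phase \<open>h * \<omega> + s\<close> modulo \<open>1\<close>.\<close>

fun next_state :: "nat \<times> real \<Rightarrow> nat \<times> real" where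
  "next_state (h, s) =
     (if Suc h = M1 \<and> s + D1 \<le> r then (0, s + D1)
      else if Suc h = M then (0, s + D) else (Suc h, s))"

definition tracks :: "real \<Rightarrow> nat \<times> real \<Rightarrow> bool" where
  "tracks \<phi> = (\<lambda>(h, s). h < M \<and> \<bar>s\<bar> \<le> r \<and> (M1 \<le> h \<longrightarrow> r < s + D1) \<and> \<phi> - (real h * \<omega> + s) \<in> \<int>)"

lemma tracks_next:
  assumes "tracks \<phi> z"
  shows "tracks (\<phi> + \<omega>) (next_state z)"
proof -
  obtain h s where z: "z = (h, s)" by (cases z)
  have t: "h < M" "\<bar>s\<bar> \<le> r" "M1 \<le> h \<Longrightarrow> r < s + D1" "\<phi> - (real h * \<omega> + s) \<in> \<int>"
    using assms by (auto simp: tracks_def z)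
  consider (ret1) "Suc h = M1" "s + D1 \<le> r" | (ret) "\<not> (Suc h = M1 \<and> s + D1 \<le> r)" "Suc h = M"
    | (up) "\<not> (Suc h = M1 \<and> s + D1 \<le> r)" "Suc h \<noteq> M" by blast
  then show ?thesis
  proof cases
    case ret1
    have "\<phi> + \<omega> - (s + D1) = \<phi> - (real h * \<omega> + s) + of_int p1"
    proof -
      have "real M1 = real h + 1" using ret1(1) by simp
      then show ?thesis by (simp add: D1_def algebra_simps)
    qed
    then have "\<phi> + \<omega> - (s + D1) \<in> \<int>" using t(4) Ints_add Ints_of_int by metis
    then show ?thesis using ret1 t D_bounds heights by (auto simp: z tracks_def)
  next
    case ret
    have "\<phi> + \<omega> - (s + D) = \<phi> - (real h * \<omega> + s) + of_int p"
    proof -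
      have "real M = real h + 1" using ret(2) by simp
      then show ?thesis by (simp add: D_def algebra_simps)
    qed
    then have i: "\<phi> + \<omega> - (s + D) \<in> \<int>" using t(4) Ints_add Ints_of_int by metis
    have "M1 \<le> h" using ret(2) heights by simp
    then have "r < s + D1" using t by simp
    moreover have "D = D1 - 2 * r" by (simp add: r_def field_simps)
    ultimately have "\<bar>s + D\<bar> \<le> r" using t(2) D_bounds(2) by linarith
    then show ?thesis using ret i D_bounds heights by (auto simp: z tracks_def)
  next
    case up
    have "\<phi> + \<omega> - (real (Suc h) * \<omega> + s) = \<phi> - (real h * \<omega> + s)" by (simp add: algebra_simps)
    then have "\<phi> + \<omega> - (real (Suc h) * \<omega> + s) \<in> \<int>" using t(4) by (simp only:)
    then show ?thesis using up t by (auto simp: z tracks_def simp del: of_nat_Suc)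
  qed
qed

text \<open>Going back by \<open>M1\<close> steps shifts the phase to the left by \<open>D1\<close>, which is less than the length
  of the base, so the base cannot be jumped over.\<close>

lemma base_visit:
  "\<exists>N\<le>R. \<exists>s. \<bar>s\<bar> \<le> r \<and> \<omega> * of_int N + \<theta> - s \<in> \<int>"
proof -
  define \<phi> where "\<phi> = \<omega> * of_int R + \<theta>"
  \<comment> \<open>The right end \<open>j + r\<close> of a translate of the base that lies to the left of \<open>\<phi>\<close>.\<close>
  define j where "j = \<lfloor>\<phi> - r\<rfloor>"
  define k where "k = nat \<lceil>(\<phi> - j - r) / D1\<rceil>"
  have "0 \<le> (\<phi> - j - r) / D1" 
  proof -
    have "0 \<le> \<phi> - j - r" unfolding j_def by linarith
    then show ?thesis using D_bounds by simp
  qed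
  then have k: "(\<phi> - j - r) / D1 \<le> real k" "real k < (\<phi> - j - r) / D1 + 1"
    unfolding k_def by linarith+
  define s where "s = \<phi> - real k * D1 - j"
  have "\<bar>s\<bar> \<le> r"
    using k D_bounds by (simp add: s_def field_simps)
  moreover have "\<omega> * of_int (R - int (M1 * k)) + \<theta> - s = of_int (j - int k * p1)"
    by (simp add: s_def \<phi>_def D1_def algebra_simps)
  ultimately show ?thesis
    by (intro exI[of _ "R - int (M1 * k)"] conjI exI[of _ s]) auto
qed

definition itinerary :: "real \<Rightarrow> nat \<Rightarrow> nat \<times> real" where
  "itinerary s m = (next_state ^^ m) (0, s)"

lemma itinerary_tracks:
  assumes "\<bar>s\<bar> \<le> r" "\<phi> - s \<in> \<int>"
  shows "tracks (\<phi> + real m * \<omega>) (itinerary s m)"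
proof (induction m)
  case 0
  then show ?case using assms heights by (simp add: itinerary_def tracks_def)
next
  case (Suc m)
  then show ?case using tracks_next[OF Suc] by (simp add: itinerary_def algebra_simps)
qed

text \<open>The counting function minus its mean is a coboundary: with \<open>G\<close> as in the proof each step of
  the itinerary changes \<open>G\<close> by the indicator of \<open>P\<close> minus \<open>\<rho>\<close>. The linear term \<open>- k * s\<close> absorbs the
  drift at the two returns, which is possible exactly because the counts on the towers are integer
  combinations of height and winding number.\<close>

lemma itinerary_count:
  fixes P :: "nat \<Rightarrow> bool" and k n0 :: int
  assumes s: "\<bar>s\<bar> \<le> r"
    and P1: "int (card {h. h < M1 \<and> P h}) = n0 * int M1 + k * p1"
    and P: "int (card {h. h < M \<and> P h}) = n0 * int M + k * p"
  shows "\<bar>real (card {i. i < m \<and> P (fst (itinerary s i))}) - (of_int k * \<omega> + of_int n0) * real m\<bar>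
    \<le> real M + real M * \<bar>of_int k * \<omega> + of_int n0\<bar> + 2 * \<bar>of_int k\<bar> * r"
proof -
  define \<rho> where "\<rho> = of_int k * \<omega> + of_int n0"
  \<comment> \<open>The transfer function of the coboundary.\<close>
  define G where "G = (\<lambda>(h, s). real (card {i. i < h \<and> P i}) - real h * \<rho> - of_int k * s)"
  have tr: "tracks (s + real m * \<omega>) (itinerary s m)" for m
    using itinerary_tracks[OF s, of s] by simp
  have ret1: "real (card {i. i < M1 \<and> P i}) - real M1 * \<rho> = - of_int k * D1"
  proof -
    have "real (card {i. i < M1 \<and> P i}) = of_int (int (card {i. i < M1 \<and> P i}))" by simp
    then show ?thesis unfolding P1 by (simp add: \<rho>_def D1_def algebra_simps)
  qed
  have ret: "real (card {i. i < M \<and> P i}) - real M * \<rho> = - of_int k * D"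
  proof -
    have "real (card {i. i < M \<and> P i}) = of_int (int (card {i. i < M \<and> P i}))" by simp
    then show ?thesis unfolding P by (simp add: \<rho>_def D_def algebra_simps)
  qed
  have step: "(if P h then 1 else 0) - \<rho> = G (next_state (h, t)) - G (h, t)" for h t
    using ret1 ret card_less_Suc_filter[of h P]
    by (auto simp: G_def algebra_simps)
  have "real (card {i. i < m \<and> P (fst (itinerary s i))}) - \<rho> * real m = G (itinerary s m) - G (itinerary s 0)"
  proof (induction m)
    case (Suc m)
    obtain h t where ht: "itinerary s m = (h, t)" by (cases "itinerary s m")
    have "itinerary s (Suc m) = next_state (h, t)" using ht by (simp add: itinerary_def)
    then show ?case using Suc step[of h t] ht 
      by (auto simp: card_less_Suc_filter algebra_simps)
  qed simp
  moreover have "\<bar>G (itinerary s m) - G (itinerary s 0)\<bar> \<le> real M + real M * \<bar>\<rho>\<bar> + 2 * \<bar>of_int k\<bar> * r"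
  proof -
    obtain h t where ht: "itinerary s m = (h, t)" by (cases "itinerary s m")
    have b: "h < M" "\<bar>t\<bar> \<le> r" using tr[of m] ht by (auto simp: tracks_def)
    have "card {i. i < h \<and> P i} \<le> card {..<h}" by (intro card_mono) auto
    then have c: "real (card {i. i < h \<and> P i}) \<le> real M" using b by simp
    have d: "real h * \<bar>\<rho>\<bar> \<le> real M * \<bar>\<rho>\<bar>" using b by (intro mult_right_mono) auto
    have "\<bar>of_int k * t\<bar> \<le> \<bar>of_int k\<bar> * r" "\<bar>of_int k * s\<bar> \<le> \<bar>of_int k\<bar> * r"
      using b s by (auto simp: abs_mult intro!: mult_left_mono)
    moreover have "\<bar>real h * \<rho>\<bar> = real h * \<bar>\<rho>\<bar>" by (simp add: abs_mult)
    moreover have "G (itinerary s m) - G (itinerary s 0) = real (card {i. i < h \<and> P i}) - real h * \<rho> - of_int k * t + of_int k * s"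
      using ht by (simp add: G_def itinerary_def)
    ultimately show ?thesis using c d by linarith
  qed
  ultimately show ?thesis unfolding \<rho>_def by simp
qed

definition riccati_step :: "real \<Rightarrow> real \<Rightarrow> real \<Rightarrow> (nat \<Rightarrow> real) \<Rightarrow> (nat \<Rightarrow> real) \<Rightarrow> (nat \<Rightarrow> real) \<Rightarrow> nat \<Rightarrow> nat \<Rightarrow> bool" where
  "riccati_step l u \<delta> c a b h h' \<longleftrightarrow> a h' + 1 / a h \<le> l - c h - \<delta> \<and> u - c h + \<delta> \<le> b h' + 1 / b h \<and>
     (1 / a h < 1 / b h \<longrightarrow> b h' < a h')"

text \<open>Slopes that depend on the level only: every step of an itinerary climbs one level or returns
  to level \<open>0\<close> from the top of one of the towers.\<close>

lemma tower_certificate: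
  fixes pot :: "real \<Rightarrow> real" and a b c :: "nat \<Rightarrow> real" and k n0 :: int
  assumes per: "\<And>x i. pot (x + of_int i) = pot x"
    and pot: "\<And>h s. h < M \<Longrightarrow> \<bar>s\<bar> \<le> r \<Longrightarrow> \<bar>pot (real h * \<omega> + s) - c h\<bar> \<le> \<delta>"
    and nz: "\<And>h. h < M \<Longrightarrow> a h \<noteq> 0 \<and> b h \<noteq> 0 \<and> a h \<noteq> b h"
    and up: "\<And>h. Suc h < M \<Longrightarrow> riccati_step l u \<delta> c a b h (Suc h)"
    and ret: "riccati_step l u \<delta> c a b (M1 - 1) 0" "riccati_step l u \<delta> c a b (M - 1) 0"
    and count: "\<And>f m q. f \<in> {a, b} \<Longrightarrow> (m, q) \<in> {(M1, p1), (M, p)} \<Longrightarrow>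
      int (card {h. h < m \<and> 0 < f h}) = n0 * int m + k * q"
  shows "hyperbolic_gap (\<lambda>n. pot (\<omega> * of_int n + \<theta>)) l u (of_int k * \<omega> + of_int n0)"
proof -
  define \<rho> where "\<rho> = of_int k * \<omega> + of_int n0"
  define w where "w = (\<lambda>h. \<bar>a h\<bar> + 1 / \<bar>a h\<bar> + \<bar>b h\<bar> + 1 / \<bar>b h\<bar> + 1 / \<bar>b h - a h\<bar>)"
  define K where "K = 1 + (\<Sum>h<M. w h)"
  have w0: "w h \<ge> 0" for h by (simp add: w_def)
  then have K1: "K \<ge> 1" by (simp add: K_def sum_nonneg)
  have wK: "w h \<le> K" if "h < M" for h
    using member_le_sum[of h "{..<M}" w] w0 that by (simp add: K_def)
  have Kb: "1 / K \<le> \<bar>a h\<bar> \<and> \<bar>a h\<bar> \<le> K \<and> 1 / K \<le> \<bar>b h\<bar> \<and> \<bar>b h\<bar> \<le> K \<and> 1 / K \<le> \<bar>b h - a h\<bar>"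
    if h: "h < M" for h
  proof -
    have inv: "1 / K \<le> x" if "x > 0" "1 / x \<le> K" for x
      using that K1 by (simp add: field_simps)
    have p: "\<bar>a h\<bar> > 0" "\<bar>b h\<bar> > 0" "\<bar>b h - a h\<bar> > 0" using nz[OF h] by auto
    then have q: "1 / \<bar>a h\<bar> > 0" "1 / \<bar>b h\<bar> > 0" "1 / \<bar>b h - a h\<bar> > 0" by (auto simp del: zero_less_abs_iff)
    have "\<bar>a h\<bar> \<le> K" "\<bar>b h\<bar> \<le> K" "1 / \<bar>a h\<bar> \<le> K" "1 / \<bar>b h\<bar> \<le> K" "1 / \<bar>b h - a h\<bar> \<le> K"
      using wK[OF h] p q unfolding w_def by linarith+
    then show ?thesis using inv p by blast
  qed
  have "\<exists>N\<le>R. \<exists>a' b' C. trapped K (\<lambda>n. pot (\<omega> * of_int n + \<theta>)) l u N a' b' \<and>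
     (\<forall>L. \<bar>real (card {n \<in> {1..int L}. 0 < a' n}) - \<rho> * real L\<bar> \<le> C \<and>
          \<bar>real (card {n \<in> {1..int L}. 0 < b' n}) - \<rho> * real L\<bar> \<le> C)" for R
  proof -
    obtain N s where N: "N \<le> min R 1" and s: "\<bar>s\<bar> \<le> r" and Ns: "\<omega> * of_int N + \<theta> - s \<in> \<int>"
      using base_visit by blast
    define lev where "lev = (\<lambda>n::int. fst (itinerary s (nat (n - N))))"
    have track: "lev n < M \<and> \<bar>pot (\<omega> * of_int n + \<theta>) - c (lev n)\<bar> \<le> \<delta> \<and>
        riccati_step l u \<delta> c a b (lev n) (lev (n + 1))" if n: "n \<ge> N" for n
    proof -
      obtain h t where ht: "itinerary s (nat (n - N)) = (h, t)" by (cases "itinerary s (nat (n - N))")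
      have "tracks (\<omega> * of_int N + \<theta> + real (nat (n - N)) * \<omega>) (h, t)"
        using itinerary_tracks[OF s Ns, of "nat (n - N)"] ht by simp
      also have "\<omega> * of_int N + \<theta> + real (nat (n - N)) * \<omega> = \<omega> * of_int n + \<theta>"
        using n by (simp add: algebra_simps)
      finally have tr: "h < M" "\<bar>t\<bar> \<le> r" "M1 \<le> h \<Longrightarrow> r < t + D1" "\<omega> * of_int n + \<theta> - (real h * \<omega> + t) \<in> \<int>"
        by (auto simp: tracks_def)
      then obtain i where "\<omega> * of_int n + \<theta> - (real h * \<omega> + t) = of_int i" by (auto elim: Ints_cases)
      then have "\<omega> * of_int n + \<theta> = (real h * \<omega> + t) + of_int i" by simp
      then have "pot (\<omega> * of_int n + \<theta>) = pot (real h * \<omega> + t)" using per by metis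
      moreover have "nat (n + 1 - N) = Suc (nat (n - N))" using n by simp
      then have "lev (n + 1) = fst (next_state (h, t))" using ht by (simp add: lev_def itinerary_def)
      moreover have "lev n = h" using ht by (simp add: lev_def)
      moreover have "riccati_step l u \<delta> c a b h (fst (next_state (h, t)))"
        using up[of h] ret tr(1) by (auto split: if_splits)
      ultimately show ?thesis using pot[OF tr(1,2)] tr(1) by simp
    qed
    have trap: "trapped K (\<lambda>n. pot (\<omega> * of_int n + \<theta>)) l u N (a \<circ> lev) (b \<circ> lev)"
      unfolding trapped_def
    proof (intro allI impI)
      fix n assume n: "n \<ge> N"
      from track[OF n] Kb[of "lev n"]
      show "1 / K \<le> \<bar>(a \<circ> lev) n\<bar> \<and> \<bar>(a \<circ> lev) n\<bar> \<le> K \<and> 1 / K \<le> \<bar>(b \<circ> lev) n\<bar> \<and> \<bar>(b \<circ> lev) n\<bar> \<le> K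
        \<and> 1 / K \<le> \<bar>(b \<circ> lev) n - (a \<circ> lev) n\<bar>
        \<and> (a \<circ> lev) (n + 1) + 1 / (a \<circ> lev) n \<le> l - pot (\<omega> * of_int n + \<theta>)
        \<and> u - pot (\<omega> * of_int n + \<theta>) \<le> (b \<circ> lev) (n + 1) + 1 / (b \<circ> lev) n
        \<and> (1 / (a \<circ> lev) n < 1 / (b \<circ> lev) n \<longrightarrow> (b \<circ> lev) (n + 1) < (a \<circ> lev) (n + 1))"
        unfolding riccati_step_def o_def by linarith
    qed
    define C0 where "C0 = real M + real M * \<bar>\<rho>\<bar> + 2 * \<bar>of_int k\<bar> * r"
    have cnt: "\<bar>real (card {n \<in> {1..int L}. 0 < (f \<circ> lev) n}) - \<rho> * real L\<bar> \<le> 2 * C0"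
      if f: "f \<in> {a, b}" for f L
    proof -
      define S where "S = (\<lambda>m. card {i. i < m \<and> 0 < f (fst (itinerary s i))})"
      have S: "\<bar>real (S m) - \<rho> * real m\<bar> \<le> C0" for m
        unfolding S_def C0_def \<rho>_def
        by (rule itinerary_count[OF s]) (use count[OF f] in auto)
      \<comment> \<open>Site \<open>1\<close> is reached after \<open>m1\<close> steps of the itinerary.\<close>
      define m1 where "m1 = nat (1 - N)"
      have m1: "int m1 = 1 - N" using N by (simp add: m1_def)
      define A where "A = {i. i < m1 \<and> 0 < f (fst (itinerary s i))}"
      define B where "B = {i. m1 \<le> i \<and> i < m1 + L \<and> 0 < f (fst (itinerary s i))}"
      have "finite A" by (rule finite_subset[of _ "{..<m1}"]) (auto simp: A_def)
      moreover have "finite B" by (rule finite_subset[of _ "{..<m1 + L}"]) (auto simp: B_def)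
      moreover have "A \<inter> B = {}" by (auto simp: A_def B_def)
      moreover have "{i. i < m1 + L \<and> 0 < f (fst (itinerary s i))} = A \<union> B"
        unfolding A_def B_def by auto
      ultimately have "S (m1 + L) = S m1 + card B"
        unfolding S_def A_def[symmetric] by (simp add: card_Un_disjoint)
      also have "card B = card {n \<in> {1..int L}. 0 < (f \<circ> lev) n}"
        unfolding B_def
        by (rule bij_betw_same_card[of "\<lambda>i. N + int i"], rule bij_betwI[where g = "\<lambda>n. nat (n - N)"])
          (use m1 in \<open>auto simp: lev_def\<close>)
      finally have "real (card {n \<in> {1..int L}. 0 < (f \<circ> lev) n}) = real (S (m1 + L)) - real (S m1)" by simp
      then show ?thesis using S[of "m1 + L"] S[of m1] by (simp add: distrib_left)
    qed
    show ?thesis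
      using N trap cnt[of a] cnt[of b]
      by (intro exI[of _ N] conjI exI[of _ "a \<circ> lev"] exI[of _ "b \<circ> lev"] exI[of _ "2 * C0"]) auto
  qed
  then show ?thesis unfolding hyperbolic_gap_def \<rho>_def using K1 by blast
qed

end

section \<open>The integer computation\<close>

text \<open>The pair \<open>(c, s)\<close> is \<open>10\<^sup>6\<close> times the cosine and sine of \<open>2 * pi * h * \<omega>\<close>, rotated by rounded
  values of \<open>cos (2 * pi * \<omega>)\<close> and \<open>sin (2 * pi * \<omega>)\<close>; the entry \<open>c div 50\<close> is \<open>10\<^sup>4\<close> times the
  potential \<open>2 * cos (2 * pi * h * \<omega>)\<close>.\<close>

fun potentials :: "nat \<Rightarrow> int \<Rightarrow> int \<Rightarrow> int list" where
  "potentials 0 c s = []"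
| "potentials (Suc n) c s =
     c div 50 # potentials n ((- 737369 * c + 675490 * s) div 1000000) ((- 737369 * s - 675490 * c) div 1000000)"

text \<open>The Riccati recursion for \<open>10\<^sup>4\<close> times the slope. Integer division rounds down, which is the
  safe direction for \<open>a\<close>; in the recursion for \<open>b\<close> the quotient is subtracted, which makes rounding
  down safe again.\<close>

fun lower_slopes :: "int \<Rightarrow> int list \<Rightarrow> int \<Rightarrow> int list" where
  "lower_slopes l [] a = [a]"
| "lower_slopes l (c # cs) a = a # lower_slopes l cs (l - c + (- 100000000) div a)"

fun upper_slopes :: "int \<Rightarrow> int list \<Rightarrow> int \<Rightarrow> int list" where
  "upper_slopes u [] b = [b]"
| "upper_slopes u (c # cs) b = b # upper_slopes u cs (u - c - 100000000 div b)"

text \<open>The comparison \<open>1 / a < 1 / b\<close> for nonzero integers.\<close>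

definition recip_less :: "int \<Rightarrow> int \<Rightarrow> bool" where
  "recip_less a b \<longleftrightarrow> (if 0 < a \<longleftrightarrow> 0 < b then b < a else a < 0)"

fun aligned :: "int list \<Rightarrow> int list \<Rightarrow> bool" where
  "aligned (a # a' # as) (b # b' # bs) \<longleftrightarrow>
     a \<noteq> 0 \<and> b \<noteq> 0 \<and> a \<noteq> b \<and> (recip_less a b \<longrightarrow> b' < a') \<and> aligned (a' # as) (b' # bs)"
| "aligned as bs \<longleftrightarrow> True"

fun positives :: "int list \<Rightarrow> int" where
  "positives [] = 0"
| "positives (a # as) = (if 0 < a then 1 else 0) + positives as"

text \<open>What \<open>tower_certificate\<close> requires of a tower of height \<open>m + 1\<close>, whose top is level \<open>m\<close>.\<close>

definition closes :: "int list \<Rightarrow> int list \<Rightarrow> nat \<Rightarrow> int \<Rightarrow> bool" where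
  "closes A B m q \<longleftrightarrow>
     hd A \<le> A ! Suc m \<and> B ! Suc m \<le> hd B \<and> (recip_less (A ! m) (B ! m) \<longrightarrow> hd B < hd A) \<and>
     positives (take (Suc m) A) = q \<and> positives (take (Suc m) B) = q"

definition certificate :: "int \<Rightarrow> int \<Rightarrow> int list \<Rightarrow> int list \<Rightarrow> bool" where
  "certificate k n A B \<longleftrightarrow>
     aligned A B \<and> closes A B 232 (n * 233 + k * 144) \<and> closes A B 376 (n * 377 + k * 233)"

text \<open>For each gap, the ends of the energy interval, scaled by \<open>10\<^sup>4\<close> and moved outwards by \<open>220\<close>,
  which stands for \<open>0.022\<close>, the initial slopes, found by iterating the recursion around the towers,
  and the numbers \<open>k\<close> and \<open>n\<close> in the density \<open>k * \<omega> + n\<close>. The first line treats the energies below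
  the spectrum.\<close>

definition all_gaps_certified :: "int list \<Rightarrow> bool" where
  "all_gaps_certified cs \<longleftrightarrow>
     certificate 0 0 (lower_slopes (- 90220) cs (- 74500)) (upper_slopes (- 26006) cs (- 5000)) \<and>
     certificate (- 3) 2 (lower_slopes (- 25129) cs (- 41000)) (upper_slopes (- 23718) cs (- 4900)) \<and>
     certificate 2 (- 1) (lower_slopes (- 23211) cs (- 4674)) (upper_slopes (- 19949) cs 50) \<and>
     certificate (- 1) 1 (lower_slopes (- 18711) cs 600) (upper_slopes (- 1921) cs (- 13500)) \<and>
     certificate 4 (- 2) (lower_slopes (- 1329) cs 12900) (upper_slopes (- 166) cs (- 11997))"

lemma all_gaps_certified: "all_gaps_certified (potentials 377 1000000 0)"
  by code_simp

section \<open>The computation encloses the golden mean towers\<close>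

lemma length_slopes [simp]:
  "length (lower_slopes l cs a) = Suc (length cs)" "length (upper_slopes l cs a) = Suc (length cs)"
  "length (potentials n c s) = n"
proof -
  show "length (lower_slopes l cs a) = Suc (length cs)" by (induction cs arbitrary: a) auto
  show "length (upper_slopes l cs a) = Suc (length cs)" by (induction cs arbitrary: a) auto
  show "length (potentials n c s) = n" by (induction n arbitrary: c s) auto
qed

lemma slopes_0 [simp]: "lower_slopes l cs a ! 0 = a" "hd (lower_slopes l cs a) = a"
  "upper_slopes l cs a ! 0 = a" "hd (upper_slopes l cs a) = a"
  by (cases cs; simp)+

lemma lower_slopes_Suc:
  "h < length cs \<Longrightarrow> lower_slopes l cs a ! Suc h = l - cs ! h + (- 100000000) div (lower_slopes l cs a ! h)"
proof (induction cs arbitrary: a h)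
  case (Cons c cs)
  then show ?case by (cases h) auto
qed simp

lemma upper_slopes_Suc:
  "h < length cs \<Longrightarrow> upper_slopes u cs b ! Suc h = u - cs ! h - 100000000 div (upper_slopes u cs b ! h)"
proof (induction cs arbitrary: b h)
  case (Cons c cs)
  then show ?case by (cases h) auto
qed simp

lemma recip_less_iff:
  assumes "a \<noteq> 0" "b \<noteq> 0"
  shows "recip_less a b \<longleftrightarrow> 1 / real_of_int a < 1 / real_of_int b"
  using assms unfolding recip_less_def
  by (cases "0 < a"; cases "0 < b") (auto simp: divide_simps mult_less_0_iff zero_less_mult_iff not_less)

lemma aligned_nth:
  assumes "aligned A B" "length A = length B" "Suc h < length A"
  shows "A ! h \<noteq> 0 \<and> B ! h \<noteq> 0 \<and> A ! h \<noteq> B ! h \<and> (recip_less (A ! h) (B ! h) \<longrightarrow> B ! Suc h < A ! Suc h)"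
  using assms
proof (induction A B arbitrary: h rule: aligned.induct)
  case (1 a a' as b b' bs)
  then show ?case by (cases h) auto
qed auto

lemma positives_append: "positives (xs @ ys) = positives xs + positives ys"
  by (induction xs) auto

lemma positives_take: "m \<le> length A \<Longrightarrow> positives (take m A) = int (card {h. h < m \<and> 0 < A ! h})"
proof (induction m)
  case (Suc m)
  then have "take (Suc m) A = take m A @ [A ! m]" by (simp add: take_Suc_conv_app_nth)
  then show ?case using Suc by (simp add: positives_append card_less_Suc_filter)
qed simp

lemma slope_inequality_lower:
  assumes "A \<noteq> 0" "A0 \<le> l - c + (- 100000000) div A" "real_of_int l \<le> 10000 * l' - 220"
  shows "real_of_int A0 / 10000 + 1 / (real_of_int A / 10000) \<le> l' - real_of_int c / 10000 - 22 / 1000"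
proof -
  have "real_of_int ((- 100000000) div A) \<le> real_of_int (- 100000000) / real_of_int A"
    by (rule real_of_int_div4)
  then have "real_of_int A0 \<le> real_of_int l - real_of_int c - 100000000 / real_of_int A"
    using assms(2) by linarith
  moreover have "1 / (real_of_int A / 10000) = (100000000 / real_of_int A) / 10000" by simp
  ultimately show ?thesis using assms(3) by simp
qed

lemma slope_inequality_upper:
  assumes "B \<noteq> 0" "u - c - 100000000 div B \<le> B0" "10000 * u' + 220 \<le> real_of_int u"
  shows "u' - real_of_int c / 10000 + 22 / 1000 \<le> real_of_int B0 / 10000 + 1 / (real_of_int B / 10000)"
proof -
  have "real_of_int (100000000 div B) \<le> real_of_int 100000000 / real_of_int B"
    by (rule real_of_int_div4)
  then have "real_of_int u - real_of_int c - 100000000 / real_of_int B \<le> real_of_int B0"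
    using assms(2) by linarith
  moreover have "1 / (real_of_int B / 10000) = (100000000 / real_of_int B) / 10000" by simp
  ultimately show ?thesis using assms(3) by simp
qed

text \<open>Comparing the Taylor polynomial of the sine near \<open>pi / 6\<close> with \<open>sin (pi / 6) = 1 / 2\<close>.\<close>

lemma pi_bounds: "3.141592 < pi" "pi < 3.141593"
proof -
  have h: "sin (pi / 6) = 1 / 2" by (rule sin_30)
  have *: "\<bar>sin x - (\<Sum>m<9. sin_coeff m * x ^ m)\<bar> \<le> inverse (fact 9) * \<bar>x\<bar> ^ 9" for x :: real
    by (rule Maclaurin_sin_bound)
  have s: "(\<Sum>m<9. sin_coeff m * x ^ m) = x - x ^ 3 / 6 + x ^ 5 / 120 - x ^ 7 / 5040" for x :: real
    by (simp add: sin_coeff_def lessThan_nat_numeral lessThan_Suc fact_numeral)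
  let ?a = "392699 / 750000 :: real" and ?b = "3141593 / 6000000 :: real"
  have f: "inverse (fact 9) * \<bar>x\<bar> ^ 9 \<le> 1 / 100000000" if "0 \<le> x" "x \<le> 53 / 100" for x :: real
  proof -
    have "\<bar>x\<bar> ^ 9 \<le> (53 / 100) ^ 9" using that by (intro power_mono) auto
    also have "\<dots> \<le> 0.0035" by (simp add: power_divide)
    finally show ?thesis by (simp add: fact_numeral)
  qed
  have "\<bar>sin ?a - (?a - ?a ^ 3 / 6 + ?a ^ 5 / 120 - ?a ^ 7 / 5040)\<bar> \<le> 1 / 100000000"
    by (rule order_trans[OF *[of ?a, unfolded s] f]) simp_all
  moreover have "?a - ?a ^ 3 / 6 + ?a ^ 5 / 120 - ?a ^ 7 / 5040 < 1 / 2 - 1 / 100000000"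
    by (simp add: power_divide)
  ultimately have "sin ?a < 1 / 2" by linarith
  then have "?a < pi / 6"
    using sin_mono_less_eq[of ?a "pi / 6"] h pi_ge_two by simp
  then show "3.141592 < pi" by simp
  have "\<bar>sin ?b - (?b - ?b ^ 3 / 6 + ?b ^ 5 / 120 - ?b ^ 7 / 5040)\<bar> \<le> 1 / 100000000"
    by (rule order_trans[OF *[of ?b, unfolded s] f]) simp_all
  moreover have "1 / 2 + 1 / 100000000 < ?b - ?b ^ 3 / 6 + ?b ^ 5 / 120 - ?b ^ 7 / 5040"
    by (simp add: power_divide)
  ultimately have "1 / 2 < sin ?b" by linarith
  then have "pi / 6 < ?b"
    using sin_mono_less_eq[of "pi / 6" ?b] h pi_ge_two by simp
  then show "pi < 3.141593" by simp
qed

lemma sqrt5_bounds: "2.23606797 < sqrt 5" "sqrt 5 < 2.23606798"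
  by (rule real_less_rsqrt, simp add: power2_eq_square) (rule real_less_lsqrt, simp_all add: power2_eq_square)

lemma abs_cos_diff_le: "\<bar>cos x - cos y\<bar> \<le> \<bar>x - y\<bar>" for x y :: real
proof -
  have "\<bar>cos x - cos y\<bar> = 2 * (\<bar>sin ((x + y) / 2)\<bar> * \<bar>sin ((y - x) / 2)\<bar>)"
    by (simp add: cos_diff_cos abs_mult)
  also have "\<dots> \<le> 2 * (1 * \<bar>(y - x) / 2\<bar>)"
    by (intro mult_left_mono mult_mono abs_sin_x_le_abs_x) auto
  finally show ?thesis by simp
qed

lemma abs_sin_diff_le: "\<bar>sin x - sin y\<bar> \<le> \<bar>x - y\<bar>" for x y :: real
  using abs_cos_diff_le[of "pi / 2 - x" "pi / 2 - y"] by (simp add: cos_diff)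

text \<open>Since \<open>2 * \<omega> = sqrt 5 - 1\<close>, the angle is \<open>pi\<close> plus the small angle \<open>y = pi * (sqrt 5 - 2)\<close>,
  for which short Taylor polynomials suffice.\<close>

lemma rotation_enclosure:
  assumes "\<omega> = (sqrt 5 - 1) / 2"
  shows "cmod (cis (2 * pi * \<omega>) - Complex (- 737369 / 1000000) (- 675490 / 1000000)) \<le> 1 / 1000000"
proof -
  define y where "y = pi * (sqrt 5 - 2)"
  define y0 :: real where "y0 = 7416293 / 10000000"
  have y: "\<bar>y - y0\<bar> \<le> 4 / 10000000"
  proof -
    have "3141592 / 1000000 * (23606797 / 100000000) \<le> y"
      unfolding y_def using pi_bounds sqrt5_bounds by (intro mult_mono) auto
    moreover have "y \<le> 3141593 / 1000000 * (23606798 / 100000000)"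
      unfolding y_def using pi_bounds sqrt5_bounds by (intro mult_mono) auto
    ultimately show ?thesis unfolding y0_def by linarith
  qed
  have w: "2 * pi * \<omega> = y + pi" by (simp add: assms y_def field_simps)
  obtain t where t: "cos y0 = (\<Sum>m<10. cos_coeff m * y0 ^ m) + cos (t + 1 / 2 * real 10 * pi) / fact 10 * y0 ^ 10"
    using Maclaurin_cos_expansion[of y0 10] by auto
  have y0b: "y0 ^ 10 \<le> (3 / 4) ^ 10" "y0 ^ 11 \<le> (3 / 4) ^ 11" by (auto simp: y0_def intro!: power_mono)
  have "\<bar>cos (t + 1 / 2 * real 10 * pi) / fact 10 * y0 ^ 10\<bar> = \<bar>cos (t + 1 / 2 * real 10 * pi)\<bar> * y0 ^ 10 / fact 10"
    by (simp add: abs_mult y0_def)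
  also have "\<dots> \<le> 1 * (3 / 4) ^ 10 / fact 10"
    by (intro divide_right_mono mult_mono y0b abs_cos_le_one) (auto simp: y0_def)
  also have "\<dots> \<le> 2 / 100000000" by (simp add: fact_numeral power_divide)
  finally have "\<bar>cos y0 - (\<Sum>m<10. cos_coeff m * y0 ^ m)\<bar> \<le> 2 / 100000000" using t by simp
  moreover have "(\<Sum>m<10. cos_coeff m * y0 ^ m) = 1 - y0 ^ 2 / 2 + y0 ^ 4 / 24 - y0 ^ 6 / 720 + y0 ^ 8 / 40320"
    by (simp add: cos_coeff_def lessThan_nat_numeral lessThan_Suc fact_numeral)
  moreover have "\<bar>1 - y0 ^ 2 / 2 + y0 ^ 4 / 24 - y0 ^ 6 / 720 + y0 ^ 8 / 40320 - 737369 / 1000000\<bar> \<le> 9 / 100000000"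
    by (simp add: y0_def power_divide)
  ultimately have c: "\<bar>cos y0 - 737369 / 1000000\<bar> \<le> 11 / 100000000" by linarith
  have "\<bar>sin y0 - (\<Sum>m<11. sin_coeff m * y0 ^ m)\<bar> \<le> inverse (fact 11) * \<bar>y0\<bar> ^ 11"
    by (rule Maclaurin_sin_bound)
  also have "\<dots> \<le> inverse (fact 11) * (3 / 4) ^ 11"
    using y0b(2) by (intro mult_left_mono) (auto simp: y0_def)
  also have "\<dots> \<le> 1 / 100000000" by (simp add: fact_numeral power_divide)
  finally have "\<bar>sin y0 - (\<Sum>m<11. sin_coeff m * y0 ^ m)\<bar> \<le> 1 / 100000000" .
  moreover have "(\<Sum>m<11. sin_coeff m * y0 ^ m) = y0 - y0 ^ 3 / 6 + y0 ^ 5 / 120 - y0 ^ 7 / 5040 + y0 ^ 9 / 362880"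
    by (simp add: sin_coeff_def lessThan_nat_numeral lessThan_Suc fact_numeral)
  moreover have "\<bar>y0 - y0 ^ 3 / 6 + y0 ^ 5 / 120 - y0 ^ 7 / 5040 + y0 ^ 9 / 362880 - 675490 / 1000000\<bar> \<le> 30 / 100000000"
    by (simp add: y0_def power_divide)
  ultimately have s: "\<bar>sin y0 - 675490 / 1000000\<bar> \<le> 31 / 100000000" by linarith
  have "\<bar>Re (cis (2 * pi * \<omega>) - Complex (- 737369 / 1000000) (- 675490 / 1000000))\<bar> \<le> 51 / 100000000"
  proof -
    have e: "Re (cis (2 * pi * \<omega>) - Complex (- 737369 / 1000000) (- 675490 / 1000000)) = 737369 / 1000000 - cos y"
      unfolding w by simp
    show ?thesis unfolding e using c y abs_cos_diff_le[of y y0] by linarith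
  qed
  moreover have "\<bar>Im (cis (2 * pi * \<omega>) - Complex (- 737369 / 1000000) (- 675490 / 1000000))\<bar> \<le> 71 / 100000000"
  proof -
    have e: "Im (cis (2 * pi * \<omega>) - Complex (- 737369 / 1000000) (- 675490 / 1000000)) = 675490 / 1000000 - sin y"
      unfolding w by simp
    show ?thesis unfolding e using s y abs_sin_diff_le[of y y0] by linarith
  qed
  moreover have "cmod z \<le> 1 / 1000000" if "\<bar>Re z\<bar> \<le> 51 / 100000000" "\<bar>Im z\<bar> \<le> 71 / 100000000" for z
  proof -
    have "(cmod z)\<^sup>2 = \<bar>Re z\<bar>\<^sup>2 + \<bar>Im z\<bar>\<^sup>2" by (simp add: cmod_power2)
    also have "\<dots> \<le> (51 / 100000000)\<^sup>2 + (71 / 100000000)\<^sup>2" using that by (intro add_mono power_mono) auto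
    also have "\<dots> \<le> (1 / 1000000)\<^sup>2" by (simp add: power2_eq_square)
    finally show ?thesis by (rule power2_le_imp_le) simp
  qed
  ultimately show ?thesis by blast
qed


definition rotate_step :: "int \<times> int \<Rightarrow> int \<times> int" where
  "rotate_step = (\<lambda>(c, s). ((- 737369 * c + 675490 * s) div 1000000, (- 737369 * s - 675490 * c) div 1000000))"

lemma potentials_nth: "h < n \<Longrightarrow> potentials n c s ! h = fst ((rotate_step ^^ h) (c, s)) div 50"
proof (induction n arbitrary: c s h)
  case (Suc n)
  then show ?case by (cases h) (auto simp: rotate_step_def funpow_Suc_right simp del: funpow.simps)
qed simp

lemma div_million_error: "\<bar>real_of_int x / 1000000000000 - real_of_int (x div 1000000) / 1000000\<bar> \<le> 1 / 1000000"
  using real_of_int_div2[of x 1000000] real_of_int_div3[of x 1000000] by (simp add: abs_le_iff)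

text \<open>Each step adds at most \<open>1.01 * 10\<^sup>-\<^sup>6\<close> for the rounded rotation and \<open>2 * 10\<^sup>-\<^sup>6\<close> for the two
  integer divisions; earlier errors are only rotated.\<close>

lemma rotation_error:
  assumes "\<omega> = (sqrt 5 - 1) / 2" "h \<le> 377"
  shows "cmod (cis (2 * pi * \<omega>) ^ h
      - Complex (fst ((rotate_step ^^ h) (1000000, 0)) / 1000000) (snd ((rotate_step ^^ h) (1000000, 0)) / 1000000))
    \<le> real h * (31 / 10000000)"
  using assms(2)
proof (induction h)
  case 0
  have "Complex 1 0 = 1" by (simp add: complex_eq_iff)
  then show ?case by simp
next
  case (Suc h)
  define \<zeta> where "\<zeta> = cis (2 * pi * \<omega>)"
  define Z where "Z = Complex (- 737369 / 1000000) (- 675490 / 1000000)"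
  obtain c s where cs: "(rotate_step ^^ h) (1000000, 0) = (c, s)" by (cases "(rotate_step ^^ h) (1000000, 0)")
  define z where "z = Complex (c / 1000000) (s / 1000000)"
  define c' s' where "c' = - 737369 * c + 675490 * s" and "s' = - 737369 * s - 675490 * c"
  define z' where "z' = Complex (real_of_int (c' div 1000000) / 1000000) (real_of_int (s' div 1000000) / 1000000)"
  have next_z: "(rotate_step ^^ Suc h) (1000000, 0) = (c' div 1000000, s' div 1000000)"
    unfolding funpow.simps o_apply cs by (simp add: rotate_step_def c'_def s'_def)
  have IH: "cmod (\<zeta> ^ h - z) \<le> real h * (31 / 10000000)"
    using Suc by (simp add: cs \<zeta>_def z_def)
  have "real h * (31 / 10000000) \<le> 1 / 100" using Suc.prems by simp
  then have "cmod z \<le> 1 + 1 / 100"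
    using IH norm_triangle_ineq3[of "\<zeta> ^ h" z] by (simp add: \<zeta>_def norm_power)
  then have 1: "cmod ((\<zeta> - Z) * z) \<le> 1 / 1000000 * (1 + 1 / 100)"
    unfolding norm_mult using rotation_enclosure[OF assms(1)] by (intro mult_mono) (auto simp: \<zeta>_def Z_def)
  have "Z * z = Complex (real_of_int c' / 1000000000000) (real_of_int s' / 1000000000000)"
    by (simp add: Z_def z_def c'_def s'_def complex_eq_iff field_simps)
  then have 2: "cmod (Z * z - z') \<le> 1 / 1000000 + 1 / 1000000"
    using cmod_le[of "Z * z - z'"] div_million_error[of c'] div_million_error[of s']
    by (simp add: z'_def)
  have 3: "cmod (\<zeta> * (\<zeta> ^ h - z)) \<le> real h * (31 / 10000000)"
    using IH by (simp add: norm_mult \<zeta>_def)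
  have "\<zeta> ^ Suc h - z' = \<zeta> * (\<zeta> ^ h - z) + (\<zeta> - Z) * z + (Z * z - z')"
    by (simp add: algebra_simps)
  then have "cmod (\<zeta> ^ Suc h - z') \<le> cmod (\<zeta> * (\<zeta> ^ h - z)) + cmod ((\<zeta> - Z) * z) + cmod (Z * z - z')"
    by (metis (no_types, lifting) norm_triangle_ineq norm_triangle_le add_right_mono order_trans)
  also have "\<dots> \<le> real h * (31 / 10000000) + 1 / 1000000 * (1 + 1 / 100) + (1 / 1000000 + 1 / 1000000)"
    by (intro add_mono 1 2 3)
  also have "\<dots> \<le> real (Suc h) * (31 / 10000000)" by simp
  finally show ?case unfolding next_z by (simp add: \<zeta>_def z'_def)
qed

text \<open>Three errors add up to less than \<open>0.022\<close>: about \<open>0.0195\<close> from the width of the base arc,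
  \<open>0.0023\<close> from the rotation and \<open>0.0001\<close> from dividing by \<open>50\<close>.\<close>

lemma potential_enclosure:
  assumes \<omega>: "\<omega> = (sqrt 5 - 1) / 2" and h: "h < 377" and s: "\<bar>s\<bar> \<le> (161 - 72 * sqrt 5) / 2"
  shows "\<bar>2 * cos (2 * pi * (real h * \<omega> + s)) - real_of_int (potentials 377 1000000 0 ! h) / 10000\<bar> \<le> 22 / 1000"
proof -
  define c where "c = fst ((rotate_step ^^ h) (1000000, 0))"
  have "\<bar>cos (2 * pi * (real h * \<omega> + s)) - cos (2 * pi * (real h * \<omega>))\<bar> \<le> 2 * pi * \<bar>s\<bar>"
    using abs_cos_diff_le[of "2 * pi * (real h * \<omega> + s)" "2 * pi * (real h * \<omega>)"]
    by (simp add: distrib_left abs_mult)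
  also have "\<dots> \<le> 2 * (3141593 / 1000000) * (155308 / 100000000)"
    using pi_bounds s sqrt5_bounds by (intro mult_mono) auto
  finally have 1: "\<bar>cos (2 * pi * (real h * \<omega> + s)) - cos (2 * pi * (real h * \<omega>))\<bar> \<le> 2 * (3141593 / 1000000) * (155308 / 100000000)" .
  have "Re (cis (2 * pi * \<omega>) ^ h) = cos (2 * pi * (real h * \<omega>))"
    by (subst Complex.DeMoivre) (simp add: mult_ac)
  then have "\<bar>cos (2 * pi * (real h * \<omega>)) - c / 1000000\<bar> \<le> real h * (31 / 10000000)"
    using order_trans[OF abs_Re_le_cmod rotation_error[OF \<omega>, of h]] h by (simp add: c_def)
  also have "\<dots> \<le> 376 * (31 / 10000000)" using h by (intro mult_right_mono) auto
  finally have 2: "\<bar>cos (2 * pi * (real h * \<omega>)) - c / 1000000\<bar> \<le> 376 * (31 / 10000000)" .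
  have "\<bar>real_of_int c / 50 - real_of_int (c div 50)\<bar> \<le> 1"
    using real_of_int_div2[of c 50] real_of_int_div3[of c 50] by (simp add: abs_le_iff)
  then have 3: "\<bar>2 * (c / 1000000) - real_of_int (c div 50) / 10000\<bar> \<le> 1 / 10000" by (simp add: abs_le_iff)
  have 4: "potentials 377 1000000 0 ! h = c div 50" using potentials_nth[OF h] by (simp add: c_def)
  show ?thesis unfolding 4 using 1 2 3 by linarith
qed

lemma golden_gap_from_certificate:
  fixes k n L U a b :: int and l u :: real
  defines "cs \<equiv> potentials 377 1000000 0"
  assumes \<omega>: "\<omega> = (sqrt 5 - 1) / 2"
    and cert: "certificate k n (lower_slopes L cs a) (upper_slopes U cs b)"
    and L: "of_int L \<le> 10000 * l - 220" and U: "10000 * u + 220 \<le> of_int U"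
  shows "hyperbolic_gap (\<lambda>m. 2 * cos (2 * pi * (\<omega> * of_int m + \<theta>))) l u (of_int k * \<omega> + of_int n)"
proof -
  interpret rokhlin_towers \<omega> 233 377 144 233
    by unfold_locales (use sqrt5_bounds in \<open>auto simp: \<omega>\<close>)
  have r: "r = (161 - 72 * sqrt 5) / 2"
    unfolding r_def D1_def D_def unfolding \<omega> by (simp add: field_simps)
  define A B where "A = lower_slopes L cs a" and "B = upper_slopes U cs b"
  have len: "length cs = 377" "length A = 378" "length B = 378" by (simp_all add: cs_def A_def B_def)
  have al: "aligned A B" and cl: "closes A B 232 (n * 233 + k * 144)" "closes A B 376 (n * 377 + k * 233)"
    using cert by (auto simp: certificate_def A_def B_def)
  have nth: "A ! h \<noteq> 0" "B ! h \<noteq> 0" "A ! h \<noteq> B ! h" "recip_less (A ! h) (B ! h) \<Longrightarrow> B ! Suc h < A ! Suc h"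
    if "h < 377" for h
    using aligned_nth[OF al, of h] that len by auto
  have hd: "hd A = A ! 0" "hd B = B ! 0" by (simp_all add: A_def B_def)
  have step: "riccati_step l u (22 / 1000) (\<lambda>h. real_of_int (cs ! h) / 10000)
      (\<lambda>h. real_of_int (A ! h) / 10000) (\<lambda>h. real_of_int (B ! h) / 10000) h h'"
    if h: "h < 377" and A': "A ! h' \<le> A ! Suc h" and B': "B ! Suc h \<le> B ! h'"
      and rl: "recip_less (A ! h) (B ! h) \<Longrightarrow> B ! h' < A ! h'" for h h'
  proof -
    have "real_of_int (A ! h') / 10000 + 1 / (real_of_int (A ! h) / 10000) \<le> l - real_of_int (cs ! h) / 10000 - 22 / 1000"
      using A' lower_slopes_Suc[of h cs L a] h len nth[OF h]
      by (intro slope_inequality_lower[OF _ _ L]) (auto simp: A_def)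
    moreover have "u - real_of_int (cs ! h) / 10000 + 22 / 1000 \<le> real_of_int (B ! h') / 10000 + 1 / (real_of_int (B ! h) / 10000)"
      using B' upper_slopes_Suc[of h cs U b] h len nth[OF h]
      by (intro slope_inequality_upper[OF _ _ U]) (auto simp: B_def)
    moreover have "1 / (real_of_int (A ! h) / 10000) < 1 / (real_of_int (B ! h) / 10000) \<longleftrightarrow> recip_less (A ! h) (B ! h)"
      using recip_less_iff[OF nth(1,2)[OF h]] by (simp add: divide_simps)
    ultimately show ?thesis using rl unfolding riccati_step_def by auto
  qed
  show ?thesis
  proof (rule tower_certificate[where pot = "\<lambda>x. 2 * cos (2 * pi * x)" and \<delta> = "22 / 1000"
        and a = "\<lambda>h. real_of_int (A ! h) / 10000" and b = "\<lambda>h. real_of_int (B ! h) / 10000"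
        and c = "\<lambda>h. real_of_int (cs ! h) / 10000"])
    show "2 * cos (2 * pi * (x + of_int i)) = 2 * cos (2 * pi * x)" for x i
      using cos_int_2pin[of i] sin_int_2pin[of i] by (simp add: distrib_left cos_add)
    show "\<bar>2 * cos (2 * pi * (real h * \<omega> + s)) - real_of_int (cs ! h) / 10000\<bar> \<le> 22 / 1000"
      if "h < 377" "\<bar>s\<bar> \<le> r" for h s
      using potential_enclosure[OF \<omega>] that r by (simp add: cs_def)
    show "riccati_step l u (22 / 1000) (\<lambda>h. real_of_int (cs ! h) / 10000)
        (\<lambda>h. real_of_int (A ! h) / 10000) (\<lambda>h. real_of_int (B ! h) / 10000) h (Suc h)" if "Suc h < 377" for h
      using that nth by (intro step) auto
    show "riccati_step l u (22 / 1000) (\<lambda>h. real_of_int (cs ! h) / 10000)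
        (\<lambda>h. real_of_int (A ! h) / 10000) (\<lambda>h. real_of_int (B ! h) / 10000) (233 - 1) 0"
      using cl(1) by (intro step) (auto simp: closes_def hd)
    show "riccati_step l u (22 / 1000) (\<lambda>h. real_of_int (cs ! h) / 10000)
        (\<lambda>h. real_of_int (A ! h) / 10000) (\<lambda>h. real_of_int (B ! h) / 10000) (377 - 1) 0"
      using cl(2) by (intro step) (auto simp: closes_def hd)
    have "positives (take 233 A) = n * 233 + k * 144" "positives (take 233 B) = n * 233 + k * 144"
      "positives (take 377 A) = n * 377 + k * 233" "positives (take 377 B) = n * 377 + k * 233"
      using cl by (simp_all add: closes_def)
    then show "int (card {h. h < m \<and> 0 < f h}) = n * int m + k * q"
      if "f \<in> {\<lambda>h. real_of_int (A ! h) / 10000, \<lambda>h. real_of_int (B ! h) / 10000}" "(m, q) \<in> {(233, 144), (377, 233)}" for f m q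
      using that len by (auto simp: positives_take)
  qed (use nth in auto)
qed

section \<open>Gaps, their labels and the reflection of energies\<close>

text \<open>Negating the potential, the energy and the slopes preserves the Riccati recursion and
  exchanges the roles of \<open>a\<close> and \<open>b\<close>.\<close>

lemma hyperbolic_gap_reflect:
  assumes "hyperbolic_gap V l u \<rho>"
  shows "hyperbolic_gap (\<lambda>n. - V n) (- u) (- l) (1 - \<rho>)"
proof -
  obtain K where K: "K \<ge> 1" and *: "\<forall>R. \<exists>N\<le>R. \<exists>a b C. trapped K V l u N a b \<and>
     (\<forall>L. \<bar>real (card {n \<in> {1..int L}. 0 < a n}) - \<rho> * real L\<bar> \<le> C \<and>
          \<bar>real (card {n \<in> {1..int L}. 0 < b n}) - \<rho> * real L\<bar> \<le> C)"
    using assms unfolding hyperbolic_gap_def by blast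
  have "\<exists>N\<le>R. \<exists>a b C. trapped K (\<lambda>n. - V n) (- u) (- l) N a b \<and>
     (\<forall>L. \<bar>real (card {n \<in> {1..int L}. 0 < a n}) - (1 - \<rho>) * real L\<bar> \<le> C \<and>
          \<bar>real (card {n \<in> {1..int L}. 0 < b n}) - (1 - \<rho>) * real L\<bar> \<le> C)" for R
  proof -
    obtain N a b C where N: "N \<le> min R 1" and tr: "trapped K V l u N a b"
      and C: "\<And>L. \<bar>real (card {n \<in> {1..int L}. 0 < a n}) - \<rho> * real L\<bar> \<le> C"
        "\<And>L. \<bar>real (card {n \<in> {1..int L}. 0 < b n}) - \<rho> * real L\<bar> \<le> C"
      using * by blast
    have tr': "trapped K (\<lambda>n. - V n) (- u) (- l) N (\<lambda>n. - b n) (\<lambda>n. - a n)"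
      using tr unfolding trapped_def by (auto simp: abs_minus_commute)
    have cnt: "\<bar>real (card {n \<in> {1..int L}. 0 < - f n}) - (1 - \<rho>) * real L\<bar> \<le> C"
      if f: "\<And>L. \<bar>real (card {n \<in> {1..int L}. 0 < f n}) - \<rho> * real L\<bar> \<le> C"
        and nz: "\<And>n. N \<le> n \<Longrightarrow> f n \<noteq> 0" for f :: "int \<Rightarrow> real" and L
    proof -
      have pn: "f n > 0 \<or> - f n > 0" if "n \<in> {1..int L}" for n
        using nz[of n] N that by fastforce
      have "{n \<in> {1..int L}. 0 < f n} \<union> {n \<in> {1..int L}. 0 < - f n} = {1..int L}"
        using pn by blast
      moreover have "card ({n \<in> {1..int L}. 0 < f n} \<union> {n \<in> {1..int L}. 0 < - f n})
          = card {n \<in> {1..int L}. 0 < f n} + card {n \<in> {1..int L}. 0 < - f n}"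
      proof -
        have fin: "finite {n \<in> {1..int L}. P n}" for P
          by (rule finite_subset[of _ "{1..int L}"]) auto
        show ?thesis by (rule card_Un_disjoint[OF fin fin]) auto
      qed
      ultimately have "card {n \<in> {1..int L}. 0 < f n} + card {n \<in> {1..int L}. 0 < - f n} = card {1..int L}"
        by simp
      then have "real (card {n \<in> {1..int L}. 0 < f n}) + real (card {n \<in> {1..int L}. 0 < - f n}) = real L"
        by simp
      then show ?thesis using f[of L] by (simp add: left_diff_distrib)
    qed
    have "1 / K > 0" using K by simp
    then have "a n \<noteq> 0 \<and> b n \<noteq> 0" if "N \<le> n" for n
      using tr that unfolding trapped_def by force
    then show ?thesis
      using N tr' cnt[OF C(1)] cnt[OF C(2)]
      by (intro exI[of _ N] conjI exI[of _ "\<lambda>n. - b n"] exI[of _ "\<lambda>n. - a n"] exI[of _ C]) auto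
  qed
  then show ?thesis unfolding hyperbolic_gap_def using K by blast
qed

abbreviation am_potential :: "real \<Rightarrow> real \<Rightarrow> real \<Rightarrow> int \<Rightarrow> real" where
  "am_potential b \<omega> \<theta> n \<equiv> b * cos (2 * pi * (\<omega> * of_int n + \<theta>))"

lemma almost_mathieu_shift:
  "(\<lambda>n. almost_mathieu b \<omega> \<theta> x n - complex_of_real E * x n) = jacobi_op (\<lambda>n. am_potential b \<omega> \<theta> n - E) x"
  by (simp add: almost_mathieu_def jacobi_op_def algebra_simps)

lemma am_restriction_eq: "am_restriction b \<omega> \<theta> L = jacobi_mat (\<lambda>n. am_potential b \<omega> \<theta> (int n)) L"
  by (simp add: am_restriction_def jacobi_mat_def)

lemma am_potential_bound: "\<bar>am_potential b \<omega> \<theta> n\<bar> \<le> \<bar>b\<bar>"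
  by (simp add: abs_mult mult_left_le)

lemma resolvent_iff_bounded_below:
  "E \<notin> am_spectrum b \<omega> \<theta> \<longleftrightarrow>
    (\<exists>k>0. \<forall>x\<in>ell2. k * ell2_norm x \<le> ell2_norm (jacobi_op (\<lambda>n. am_potential b \<omega> \<theta> n - E) x))"
proof
  assume "E \<notin> am_spectrum b \<omega> \<theta>"
  then obtain R where R: "bounded_operator_ell2 R"
    "\<And>x. x \<in> ell2 \<Longrightarrow> R (jacobi_op (\<lambda>n. am_potential b \<omega> \<theta> n - E) x) = x"
    unfolding am_spectrum_def spectrum_ell2_def mem_Collect_eq almost_mathieu_shift by blast
  obtain C where C: "\<And>x. x \<in> ell2 \<Longrightarrow> ell2_norm (R x) \<le> C * ell2_norm x"
    using R(1) unfolding bounded_operator_ell2_def by blast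
  have W: "\<bar>am_potential b \<omega> \<theta> n - E\<bar> \<le> \<bar>b\<bar> + \<bar>E\<bar>" for n
    using am_potential_bound[of b \<omega> n \<theta>] by linarith
  show "\<exists>k>0. \<forall>x\<in>ell2. k * ell2_norm x \<le> ell2_norm (jacobi_op (\<lambda>n. am_potential b \<omega> \<theta> n - E) x)"
  proof (intro exI[of _ "1 / (\<bar>C\<bar> + 1)"] conjI ballI)
    fix x assume x: "x \<in> ell2"
    let ?f = "jacobi_op (\<lambda>n. am_potential b \<omega> \<theta> n - E) x"
    have f: "?f \<in> ell2" by (rule jacobi_op_ell2(1)[OF x W])
    have "ell2_norm x \<le> C * ell2_norm ?f" using C[OF f] R(2)[OF x] by simp
    also have "\<dots> \<le> (\<bar>C\<bar> + 1) * ell2_norm ?f" using ell2_norm_nonneg[of ?f] by (intro mult_right_mono) auto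
    finally show "1 / (\<bar>C\<bar> + 1) * ell2_norm x \<le> ell2_norm ?f" by (simp add: field_simps)
  qed simp
next
  assume "\<exists>k>0. \<forall>x\<in>ell2. k * ell2_norm x \<le> ell2_norm (jacobi_op (\<lambda>n. am_potential b \<omega> \<theta> n - E) x)"
  then obtain k where k: "k > 0"
    "\<And>x. x \<in> ell2 \<Longrightarrow> k * ell2_norm x \<le> ell2_norm (jacobi_op (\<lambda>n. am_potential b \<omega> \<theta> n - E) x)" by blast
  have W: "\<bar>am_potential b \<omega> \<theta> n - E\<bar> \<le> \<bar>b\<bar> + \<bar>E\<bar>" for n
    using am_potential_bound[of b \<omega> n \<theta>] by linarith
  show "E \<notin> am_spectrum b \<omega> \<theta>"
    using bounded_below_resolvent[OF W k]
    unfolding am_spectrum_def spectrum_ell2_def mem_Collect_eq almost_mathieu_shift by blast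
qed

text \<open>The norm of the operator is at most \<open>2 + \<bar>b\<bar>\<close>.\<close>

lemma far_energy_resolvent:
  assumes "\<bar>E\<bar> > 2 + \<bar>b\<bar>"
  shows "E \<notin> am_spectrum b \<omega> \<theta>"
  unfolding resolvent_iff_bounded_below
proof (intro exI[of _ "\<bar>E\<bar> - (2 + \<bar>b\<bar>)"] conjI ballI)
  fix x assume x: "x \<in> ell2"
  let ?V = "am_potential b \<omega> \<theta>"
  have W: "\<bar>?V n - E\<bar> \<le> \<bar>b\<bar> + \<bar>E\<bar>" for n
    using am_potential_bound[of b \<omega> n \<theta>] by linarith
  have T: "jacobi_op (\<lambda>n. ?V n - E) x \<in> ell2" by (rule jacobi_op_ell2(1)[OF x W])
  note H = jacobi_op_ell2[OF x am_potential_bound[where b = b and \<omega> = \<omega> and \<theta> = \<theta>]]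
  have m: "(\<lambda>n. - 1 * jacobi_op ?V x n) \<in> ell2" "ell2_norm (\<lambda>n. - 1 * jacobi_op ?V x n) \<le> ell2_norm (jacobi_op ?V x)"
    using ell2_scale[OF H(1), of "-1"] by simp_all
  have e: "(\<lambda>n. complex_of_real (- E) * x n) = (\<lambda>n. jacobi_op (\<lambda>n. ?V n - E) x n + - 1 * jacobi_op ?V x n)"
    by (simp add: jacobi_op_def algebra_simps)
  have "\<bar>E\<bar> * ell2_norm x \<le> ell2_norm (\<lambda>n. complex_of_real (- E) * x n)"
  proof (cases "E = 0")
    case False
    have "x = (\<lambda>n. complex_of_real (- 1 / E) * (complex_of_real (- E) * x n))"
      using False by auto
    then have "ell2_norm x \<le> cmod (complex_of_real (- 1 / E)) * ell2_norm (\<lambda>n. complex_of_real (- E) * x n)"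
      using ell2_scale(2)[OF ell2_scale(1)[OF x, of "complex_of_real (- E)"], of "complex_of_real (- 1 / E)"] by metis
    then show ?thesis using False by (simp add: norm_divide field_simps)
  qed (simp add: ell2_norm_nonneg)
  also have "\<dots> \<le> ell2_norm (jacobi_op (\<lambda>n. ?V n - E) x) + ell2_norm (jacobi_op ?V x)"
    unfolding e using ell2_add(2)[OF T m(1)] m(2) by linarith
  also have "ell2_norm (jacobi_op ?V x) \<le> (2 + \<bar>b\<bar>) * ell2_norm x" by (rule H(2))
  finally show "(\<bar>E\<bar> - (2 + \<bar>b\<bar>)) * ell2_norm x \<le> ell2_norm (jacobi_op (\<lambda>n. ?V n - E) x)"
    by (simp add: left_diff_distrib)
qed (use assms in simp)

lemma hyperbolic_gap_subset:
  assumes "hyperbolic_gap (am_potential b \<omega> \<theta>) l u \<rho>"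
  shows "{l<..<u} \<subseteq> - am_spectrum b \<omega> \<theta>"
proof
  fix E assume "E \<in> {l<..<u}"
  then have E: "l < E" "E < u" by auto
  have "E \<notin> am_spectrum b \<omega> \<theta>"
    unfolding resolvent_iff_bounded_below
    by (rule hyperbolic_gap_bounded_below[OF assms am_potential_bound E])
  then show "E \<in> - am_spectrum b \<omega> \<theta>" by simp
qed

definition ids_ratio :: "real \<Rightarrow> real \<Rightarrow> real \<Rightarrow> real \<Rightarrow> nat \<Rightarrow> real" where
  "ids_ratio b \<omega> \<theta> E L = real (eigenvalue_count (am_restriction b \<omega> \<theta> L) E) / real L"

lemma LIMSEQ_ratio_diff:
  fixes x y :: "nat \<Rightarrow> real"
  assumes "\<And>L. \<bar>x L - y L\<bar> \<le> C"
  shows "(\<lambda>L. x L / real L - y L / real L) \<longlonglongrightarrow> 0"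
proof (rule Lim_null_comparison)
  show "\<forall>\<^sub>F L in sequentially. norm (x L / real L - y L / real L) \<le> C / real L"
    using assms by (intro always_eventually allI) (auto simp: diff_divide_distrib[symmetric] divide_right_mono)
  show "(\<lambda>L. C / real L) \<longlonglongrightarrow> 0" by (rule lim_const_over_n)
qed

lemma hyperbolic_gap_ids:
  assumes "hyperbolic_gap (am_potential b \<omega> \<theta>) l u \<rho>" "l < E" "E < u"
  shows "ids_ratio b \<omega> \<theta> E \<longlonglongrightarrow> \<rho>"
proof -
  obtain C where "\<And>L. \<bar>real (eigenvalue_count (am_restriction b \<omega> \<theta> L) E) - \<rho> * real L\<bar> \<le> C"
    using hyperbolic_gap_count[OF assms] by (auto simp: am_restriction_eq)
  from LIMSEQ_ratio_diff[where y = "\<lambda>L. \<rho> * real L", OF this]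
  have "(\<lambda>L. ids_ratio b \<omega> \<theta> E L - \<rho> * real L / real L) \<longlonglongrightarrow> 0"
    by (simp only: ids_ratio_def)
  moreover have "(\<lambda>L. \<rho> * real L / real L) \<longlonglongrightarrow> \<rho>"
  proof (rule tendsto_eventually)
    show "\<forall>\<^sub>F L in sequentially. \<rho> * real L / real L = \<rho>"
      using eventually_gt_at_top[of 0] by eventually_elim simp
  qed
  ultimately have "(\<lambda>L. (ids_ratio b \<omega> \<theta> E L - \<rho> * real L / real L) + \<rho> * real L / real L) \<longlonglongrightarrow> 0 + \<rho>"
    by (rule tendsto_add)
  then show ?thesis by simp
qed

text \<open>The eigenvalue counts at nearby energies differ by at most two for every \<open>L\<close>, which does not
  affect the limit of the ratios, nor its existence.\<close>

lemma ids_locally_constant: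
  assumes "E \<notin> am_spectrum b \<omega> \<theta>"
  shows "\<exists>e>0. \<forall>E'. \<bar>E' - E\<bar> < e \<longrightarrow> (ids_ratio b \<omega> \<theta> E' \<longlonglongrightarrow> \<rho> \<longleftrightarrow> ids_ratio b \<omega> \<theta> E \<longlonglongrightarrow> \<rho>)"
proof -
  let ?V = "am_potential b \<omega> \<theta>"
  obtain k where k: "k > 0" "\<And>x. x \<in> ell2 \<Longrightarrow> k * ell2_norm x \<le> ell2_norm (jacobi_op (\<lambda>n. ?V n - E) x)"
    using assms unfolding resolvent_iff_bounded_below by blast
  have "ell2_norm x \<le> (1 / k) * ell2_norm (jacobi_op (\<lambda>n. ?V n - E) x)" if "x \<in> ell2" for x
    using k(2)[OF that] k(1) by (simp add: field_simps)
  then have few: "card {x \<in> jacobi_roots (\<lambda>n. ?V (int n)) L. \<bar>x - E\<bar> < k} \<le> 2" for L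
    using few_eigenvalues_near_resolvent[of "1 / k" ?V E L] k(1) by simp
  have "ids_ratio b \<omega> \<theta> E' \<longlonglongrightarrow> \<rho> \<longleftrightarrow> ids_ratio b \<omega> \<theta> E \<longlonglongrightarrow> \<rho>" if E': "\<bar>E' - E\<bar> < k" for E'
  proof -
    have "\<bar>real (eigenvalue_count (am_restriction b \<omega> \<theta> L) E') - real (eigenvalue_count (am_restriction b \<omega> \<theta> L) E)\<bar> \<le> 2" for L
    proof -
      let ?J = "jacobi_roots (\<lambda>n. ?V (int n)) L"
      have "card {x \<in> ?J. x \<le> p} \<le> card {x \<in> ?J. x \<le> q} + 2" if "\<bar>p - E\<bar> < k" "\<bar>q - E\<bar> < k" for p q
      proof -
        have "{x \<in> ?J. x \<le> p} \<subseteq> {x \<in> ?J. x \<le> q} \<union> {x \<in> ?J. \<bar>x - E\<bar> < k}" using that by auto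
        then have "card {x \<in> ?J. x \<le> p} \<le> card ({x \<in> ?J. x \<le> q} \<union> {x \<in> ?J. \<bar>x - E\<bar> < k})"
          by (intro card_mono) (auto simp: finite_jacobi_roots_filter)
        also have "\<dots> \<le> card {x \<in> ?J. x \<le> q} + card {x \<in> ?J. \<bar>x - E\<bar> < k}" by (rule card_Un_le)
        finally show ?thesis using few[of L] by simp
      qed
      from this[of E' E] this[of E E'] show ?thesis
        using E' k(1) by (simp add: am_restriction_eq eigenvalue_count_jacobi)
    qed
    from LIMSEQ_ratio_diff[where y = "\<lambda>L. real (eigenvalue_count (am_restriction b \<omega> \<theta> L) E)", OF this]
    have "(\<lambda>L. ids_ratio b \<omega> \<theta> E' L - ids_ratio b \<omega> \<theta> E L) \<longlonglongrightarrow> 0"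
      by (simp add: ids_ratio_def)
    then show ?thesis by (rule Lim_transform_eq)
  qed
  then show ?thesis using k(1) by blast
qed

lemma ids_constant_on_gap:
  assumes G: "spectral_gap b \<omega> \<theta> G" and E: "E0 \<in> G" "E \<in> G" and lim: "ids_ratio b \<omega> \<theta> E0 \<longlonglongrightarrow> \<rho>"
  shows "ids_ratio b \<omega> \<theta> E \<longlonglongrightarrow> \<rho>"
proof -
  have "connected G" and sub: "G \<subseteq> - am_spectrum b \<omega> \<theta>"
    using G in_components_connected in_components_subset unfolding spectral_gap_def by blast+
  from this(1) E lim show ?thesis
  proof (rule connected_induction_simple[where P = "\<lambda>E. ids_ratio b \<omega> \<theta> E \<longlonglongrightarrow> \<rho>"])
    fix a assume a: "a \<in> G"
    then obtain e where e: "e > 0"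
      "\<And>E'. \<bar>E' - a\<bar> < e \<Longrightarrow> (ids_ratio b \<omega> \<theta> E' \<longlonglongrightarrow> \<rho> \<longleftrightarrow> ids_ratio b \<omega> \<theta> a \<longlonglongrightarrow> \<rho>)"
      using ids_locally_constant[of a b \<omega> \<theta> \<rho>] sub by blast
    have near: "\<bar>x - a\<bar> < e" if "x \<in> ball a e" for x
      using that by (simp add: dist_real_def abs_minus_commute)
    show "\<exists>T. openin (top_of_set G) T \<and> a \<in> T \<and> (\<forall>x\<in>T. \<forall>y\<in>T. ids_ratio b \<omega> \<theta> x \<longlonglongrightarrow> \<rho> \<longrightarrow> ids_ratio b \<omega> \<theta> y \<longlonglongrightarrow> \<rho>)"
    proof (intro exI[of _ "G \<inter> ball a e"] conjI ballI impI)
      show "openin (top_of_set G) (G \<inter> ball a e)" by (rule openin_open_Int) simp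
      show "a \<in> G \<inter> ball a e" using a e by simp
    next
      fix x y assume "x \<in> G \<inter> ball a e" "y \<in> G \<inter> ball a e" "ids_ratio b \<omega> \<theta> x \<longlonglongrightarrow> \<rho>"
      then show "ids_ratio b \<omega> \<theta> y \<longlonglongrightarrow> \<rho>" using e(2) near by blast
    qed
  qed
qed

lemma gap_component:
  assumes "x \<in> {l<..<u}" "{l<..<u} \<subseteq> - am_spectrum b \<omega> \<theta>"
  shows "\<exists>G. spectral_gap b \<omega> \<theta> G \<and> {l<..<u} \<subseteq> G"
  using assms by (intro exI[of _ "connected_component_set (- am_spectrum b \<omega> \<theta>) x"])
    (auto simp: spectral_gap_def intro!: componentsI dest: connected_component_maximal[OF assms(1) connected_Ioo assms(2), THEN subsetD])

text \<open>The density of states is \<open>\<rho>\<close> on the whole component, but \<open>0\<close> at \<open>e0\<close> and \<open>1\<close> at \<open>e1\<close>. So the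
  component contains neither of these points, and being connected it lies between them.\<close>

lemma labelled_gap:
  assumes gap: "hyperbolic_gap (am_potential b \<omega> \<theta>) l u \<rho>" and lu: "l < u"
    and lower: "hyperbolic_gap (am_potential b \<omega> \<theta>) l0 u0 0" "l0 < e0" "e0 < u0" "e0 \<le> l"
    and upper: "hyperbolic_gap (am_potential b \<omega> \<theta>) l1 u1 1" "l1 < e1" "e1 < u1" "u \<le> e1"
    and \<rho>: "\<rho> = frac (of_int k * \<omega>)" "\<rho> \<noteq> 0"
  shows "\<exists>G. spectral_gap b \<omega> \<theta> G \<and> bounded G \<and> {l<..<u} \<subseteq> G \<and> gap_has_label b \<omega> \<theta> G k"
proof -
  define x where "x = (l + u) / 2"
  have x: "x \<in> {l<..<u}" using lu by (simp add: x_def)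
  obtain G where G: "spectral_gap b \<omega> \<theta> G" "{l<..<u} \<subseteq> G"
    using gap_component[OF x hyperbolic_gap_subset[OF gap]] by blast
  have conn: "connected G" using G in_components_connected unfolding spectral_gap_def by blast
  have lim: "ids_ratio b \<omega> \<theta> E \<longlonglongrightarrow> \<rho>" if "E \<in> G" for E
    using ids_constant_on_gap[OF G(1) _ that hyperbolic_gap_ids[OF gap]] G(2) x by auto
  have "e0 \<notin> G"
    using LIMSEQ_unique[OF lim hyperbolic_gap_ids[OF lower(1-3)]] \<rho>(2) by blast
  moreover have "e1 \<notin> G"
    using LIMSEQ_unique[OF lim hyperbolic_gap_ids[OF upper(1-3)]] \<rho>(1) frac_lt_1[of "of_int k * \<omega>"] by fastforce
  moreover have "x \<in> G" using G(2) x by blast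
  ultimately have "G \<subseteq> {e0..e1}"
  proof (intro subsetI)
    fix y assume y: "y \<in> G" and n: "e0 \<notin> G" "e1 \<notin> G" and xG: "x \<in> G"
    have "e0 \<notin> {y..x}" "e1 \<notin> {x..y}"
      using connected_contains_Icc[OF conn y xG] connected_contains_Icc[OF conn xG y] n by blast+
    moreover have "e0 \<le> x" "x \<le> e1" using x lower(4) upper(4) by auto
    ultimately show "y \<in> {e0..e1}" by auto
  qed
  then have bd: "bounded G" using bounded_closed_interval bounded_subset by blast
  have "ids b \<omega> \<theta> a = frac (of_int k * \<omega>)" if "a \<in> G" for a
    using limI[OF lim[OF that]] \<rho>(1) by (simp add: ids_def ids_ratio_def[abs_def])
  then show ?thesis using G bd by (auto simp: gap_has_label_def)
qed

section \<open>Gaps of the golden mean operator\<close>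

lemma am_potential_half_shift: "- am_potential b \<omega> (\<theta> + 1 / 2) n = am_potential b \<omega> \<theta> n"
proof -
  have "2 * pi * (\<omega> * of_int n + (\<theta> + 1 / 2)) = 2 * pi * (\<omega> * of_int n + \<theta>) + pi"
    by (simp add: algebra_simps)
  then show ?thesis by (simp only: cos_periodic_pi)
qed

lemma hyperbolic_gap_mirror:
  assumes "\<And>\<theta>. hyperbolic_gap (am_potential b \<omega> \<theta>) l u \<rho>"
  shows "hyperbolic_gap (am_potential b \<omega> \<theta>) (- u) (- l) (1 - \<rho>)"
  using hyperbolic_gap_reflect[OF assms[of "\<theta> + 1 / 2"]] unfolding am_potential_half_shift .

lemma lower_unbounded_gap:
  assumes gap: "hyperbolic_gap (am_potential b \<omega> \<theta>) l u \<rho>" and l: "l < - (2 + \<bar>b\<bar>)" "l < u"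
  shows "\<exists>G. spectral_gap b \<omega> \<theta> G \<and> \<not> bdd_below G \<and> {..<u} \<subseteq> G \<and> gap_has_label b \<omega> \<theta> G 0"
proof -
  have sub: "{..<u} \<subseteq> - am_spectrum b \<omega> \<theta>"
  proof
    fix E assume E: "E \<in> {..<u}"
    show "E \<in> - am_spectrum b \<omega> \<theta>"
    proof (cases "l < E")
      case True
      then show ?thesis using hyperbolic_gap_subset[OF gap] E by auto
    next
      case False
      then show ?thesis using far_energy_resolvent[of b E] l by auto
    qed
  qed
  let ?G = "connected_component_set (- am_spectrum b \<omega> \<theta>) l"
  have "l \<in> {..<u}" using l by simp
  then have G: "spectral_gap b \<omega> \<theta> ?G" "{..<u} \<subseteq> ?G"
    using sub connected_component_maximal[OF _ _ sub, of l]
    by (auto simp: spectral_gap_def intro!: componentsI)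
  have "\<not> bdd_below ?G"
  proof
    assume "bdd_below ?G"
    then obtain m where "\<And>x. x \<in> ?G \<Longrightarrow> m \<le> x" unfolding bdd_below_def by blast
    moreover have "min m u - 1 \<in> ?G" using G(2) by (rule subsetD) simp
    ultimately show False by fastforce
  qed
  then show ?thesis
    using G bounded_imp_bdd_below unfolding gap_has_label_def by metis
qed

lemma upper_unbounded_gap:
  assumes gap: "hyperbolic_gap (am_potential b \<omega> \<theta>) l u \<rho>" and u: "2 + \<bar>b\<bar> < u" "l < u"
  shows "\<exists>G. spectral_gap b \<omega> \<theta> G \<and> \<not> bdd_above G \<and> {l<..} \<subseteq> G \<and> gap_has_label b \<omega> \<theta> G 0"
proof -
  have sub: "{l<..} \<subseteq> - am_spectrum b \<omega> \<theta>"
  proof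
    fix E assume E: "E \<in> {l<..}"
    show "E \<in> - am_spectrum b \<omega> \<theta>"
    proof (cases "E < u")
      case True
      then show ?thesis using hyperbolic_gap_subset[OF gap] E by auto
    next
      case False
      then show ?thesis using far_energy_resolvent[of b E] u by auto
    qed
  qed
  let ?G = "connected_component_set (- am_spectrum b \<omega> \<theta>) u"
  have "u \<in> {l<..}" using u by simp
  then have G: "spectral_gap b \<omega> \<theta> ?G" "{l<..} \<subseteq> ?G"
    using sub connected_component_maximal[OF _ _ sub, of u]
    by (auto simp: spectral_gap_def intro!: componentsI)
  have "\<not> bdd_above ?G"
  proof
    assume "bdd_above ?G"
    then obtain m where "\<And>x. x \<in> ?G \<Longrightarrow> x \<le> m" unfolding bdd_above_def by blast
    moreover have "max m l + 1 \<in> ?G" using G(2) by (rule subsetD) simp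
    ultimately show False by fastforce
  qed
  then show ?thesis
    using G bounded_imp_bdd_above unfolding gap_has_label_def by metis
qed

theorem mainTheorem3:
  fixes \<omega> \<theta> :: real
  assumes "\<omega> = (sqrt 5 - 1) / 2"
  shows "(\<forall>(l :: real, u :: real, k :: int) \<in>
            {(- 2.49080746353, - 2.39389225666, - 3),
             (- 2.29908225829, - 2.01696396030, 2),
             (- 1.84909334969, - 0.214184658337, - 1),
             (- 0.110814328134, - 0.0386155348422, 4),
             (0.0386155348422, 0.110814328134, - 4),
             (0.214184658337, 1.84909334969, 1),
             (2.01696396030, 2.29908225829, - 2),
             (2.39389225666, 2.49080746353, 3)}.
            \<exists>G. spectral_gap 2 \<omega> \<theta> G \<and> bounded G \<and> {l<..<u} \<subseteq> G \<and>
                gap_has_label 2 \<omega> \<theta> G k) \<and>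
         (\<exists>G. spectral_gap 2 \<omega> \<theta> G \<and> \<not> bdd_below G \<and> {..< - 2.62263996148} \<subseteq> G \<and>
              gap_has_label 2 \<omega> \<theta> G 0) \<and>
         (\<exists>G. spectral_gap 2 \<omega> \<theta> G \<and> \<not> bdd_above G \<and> {2.62263996148 <..} \<subseteq> G \<and>
              gap_has_label 2 \<omega> \<theta> G 0)"
proof -
  note \<omega> = assms
  let ?H = "\<lambda>l u k n. \<forall>\<theta>. hyperbolic_gap (am_potential 2 \<omega> \<theta>) l u (of_int k * \<omega> + of_int n)"
  note cert = all_gaps_certified[unfolded all_gaps_certified_def]
  have bottom: "?H (- 9) (- 2.62263996148) 0 0"
    by (intro allI golden_gap_from_certificate[OF \<omega> cert[THEN conjunct1]]) simp_all
  have gap3: "?H (- 2.49080746353) (- 2.39389225666) (- 3) 2"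
    by (intro allI golden_gap_from_certificate[OF \<omega> cert[THEN conjunct2, THEN conjunct1]]) simp_all
  have gap2: "?H (- 2.29908225829) (- 2.01696396030) 2 (- 1)"
    by (intro allI golden_gap_from_certificate[OF \<omega> cert[THEN conjunct2, THEN conjunct2, THEN conjunct1]]) simp_all
  have gap1: "?H (- 1.84909334969) (- 0.214184658337) (- 1) 1"
    by (intro allI golden_gap_from_certificate[OF \<omega> cert[THEN conjunct2, THEN conjunct2, THEN conjunct2, THEN conjunct1]]) simp_all
  have gap4: "?H (- 0.110814328134) (- 0.0386155348422) 4 (- 2)"
    by (intro allI golden_gap_from_certificate[OF \<omega> cert[THEN conjunct2, THEN conjunct2, THEN conjunct2, THEN conjunct2]]) simp_all
  have lower: "hyperbolic_gap (am_potential 2 \<omega> \<theta>) (- 9) (- 2.62263996148) 0" for \<theta>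
    using bottom by simp
  have upper: "hyperbolic_gap (am_potential 2 \<omega> \<theta>) 2.62263996148 9 1"
    using hyperbolic_gap_mirror[OF lower, of \<theta>] by simp
  have neg: "\<exists>G. spectral_gap 2 \<omega> \<theta> G \<and> bounded G \<and> {l<..<u} \<subseteq> G \<and> gap_has_label 2 \<omega> \<theta> G k"
    if H: "?H l u k n" and k: "0 < of_int k * \<omega> + of_int n" "of_int k * \<omega> + of_int n < 1"
      and lu: "- 3 \<le> l" "l < u" "u \<le> 3" for l u k n
  proof (rule labelled_gap[OF H[rule_format] lu(2) lower _ _ lu(1) upper _ _ lu(3)])
    have "of_int k * \<omega> - (of_int k * \<omega> + of_int n) = of_int (- n)" by simp
    then have "of_int k * \<omega> - (of_int k * \<omega> + of_int n) \<in> \<int>" by (metis Ints_of_int)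
    then show "of_int k * \<omega> + of_int n = frac (of_int k * \<omega>)"
      using k by (intro frac_unique_iff[THEN iffD2, symmetric]) auto
  qed (use k in auto)
  have pos: "\<exists>G. spectral_gap 2 \<omega> \<theta> G \<and> bounded G \<and> {- u<..<- l} \<subseteq> G \<and> gap_has_label 2 \<omega> \<theta> G (- k)"
    if H: "?H l u k n" and k: "0 < of_int k * \<omega> + of_int n" "of_int k * \<omega> + of_int n < 1"
      and lu: "- 3 \<le> l" "l < u" "u \<le> 3" for l u k n
  proof (rule neg[where n = "1 - n"])
    have e: "1 - (of_int k * \<omega> + of_int n) = of_int (- k) * \<omega> + of_int (1 - n)" by simp
    show "?H (- u) (- l) (- k) (1 - n)"
      using hyperbolic_gap_mirror[OF H[rule_format]] unfolding e by blast
  qed (use k lu in auto)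
  have \<omega>_bounds: "0.61803398 < \<omega>" "\<omega> < 0.618034" using sqrt5_bounds by (auto simp: \<omega>)
  note g3 = neg[OF gap3] pos[OF gap3] and g2 = neg[OF gap2] pos[OF gap2]
    and g1 = neg[OF gap1] pos[OF gap1] and g4 = neg[OF gap4] pos[OF gap4]
  have labelled: "\<forall>(l :: real, u :: real, k :: int) \<in>
            {(- 2.49080746353, - 2.39389225666, - 3),
             (- 2.29908225829, - 2.01696396030, 2),
             (- 1.84909334969, - 0.214184658337, - 1),
             (- 0.110814328134, - 0.0386155348422, 4),
             (0.0386155348422, 0.110814328134, - 4),
             (0.214184658337, 1.84909334969, 1),
             (2.01696396030, 2.29908225829, - 2),
             (2.39389225666, 2.49080746353, 3)}.
            \<exists>G. spectral_gap 2 \<omega> \<theta> G \<and> bounded G \<and> {l<..<u} \<subseteq> G \<and> gap_has_label 2 \<omega> \<theta> G k"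
    unfolding ball_simps prod.case
    using g3[simplified] g2[simplified] g1[simplified] g4[simplified] \<omega>_bounds
    by simp
  show ?thesis
    using labelled lower_unbounded_gap[OF lower, of \<theta>] upper_unbounded_gap[OF upper] by simp
qed

end
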